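(* Let $\eta>0$ be given. There exists a subset $\mathcal{E}\subseteq\mathcal{D}$ of measure zero such that for every $\bm{\alpha}\in\mathcal{D}\setminus\mathcal{E}$ we have $$P(\bm{\alpha},N,[0,\Delta])=(1+o(1))\,\Delta,\qquad N\to\infty,$$ uniformly in $N^{-1+\eta}\le\Delta\le N^{-\eta}$; that is, $\sup_{N^{-1+\eta}\le\Delta\le N^{-\eta}}\big|\Delta^{-1}P(\bm{\alpha},N,[0,\Delta])-1\big|\to 0$ as $N\to\infty$.
   Context: Let $\mathcal{D}=\{(\alpha_1,\alpha_2,\alpha_3)\in\mathbb{R}^3 : 0\le\alpha_2\le\alpha_1\le\alpha_3,\ \alpha_1>0\}$, equipped with the measure $d_{\mathrm{hyp}}\bm{\alpha}=\dfrac{d\alpha_1\,d\alpha_2\,d\alpha_3}{(4\alpha_1\alpha_3-\alpha_2^2)^{3/2}}$ (it has the same null sets as Lebesgue measure on $\mathcal{D}$). For $\bm{\alpha}=(\alpha_1,\alpha_2,\alpha_3)\in\mathcal{D}$ let $q_{\bm{\alpha}}(m,n)=\alpha_1m^2+\alpha_2mn+\alpha_3n^2$ be the corresponding positive definite binary quadratic form, and let $D(\bm{\alpha})=\frac1\pi\sqrt{4\alpha_1\alpha_3-\alpha_2^2}$. Let $0<\Lambda_1\le\Lambda_2\le\cdots$ (depending on $\bm{\alpha}$) be the values $q_{\bm{\alpha}}(m,n)/D(\bm{\alpha})$, listed in increasing order with multiplicity, where $(m,n)$ runs over integer pairs with $m>0$, or $m=0$ and $n>0$. For an interval $I\subseteq\mathbb{R}$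 and $N\ge1$ put $$P(\bm{\alpha},N,I)=\frac1N\#\{(j,k) : \Lambda_j,\Lambda_k\le N,\ j\ne k,\ \Lambda_j-\Lambda_k\in I\}.$$ *)

theory Defs
  imports "HOL-Analysis.Analysis"
begin

definition form_domain :: "(real \<times> real \<times> real) set" where
  "form_domain = {(a1, a2, a3). 0 \<le> a2 \<and> a2 \<le> a1 \<and> a1 \<le> a3 \<and> a1 > 0}"

fun hyp_density :: "real \<times> real \<times> real \<Rightarrow> real" where
  "hyp_density (a1, a2, a3) = 1 / (4 * a1 * a3 - a2\<^sup>2) powr (3 / 2)"

text \<open>Built on the completed Lebesgue measure, so that null sets need not be Borel.\<close>

definition hyp_measure :: "(real \<times> real \<times> real) measure" where
  "hyp_measure = density (lebesgue_on form_domain) (\<lambda>a. ennreal (hyp_density a))"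

fun qform :: "real \<times> real \<times> real \<Rightarrow> int \<times> int \<Rightarrow> real" where
  "qform (a1, a2, a3) (m, n) =
     a1 * (of_int m)\<^sup>2 + a2 * of_int m * of_int n + a3 * (of_int n)\<^sup>2"

fun form_scale :: "real \<times> real \<times> real \<Rightarrow> real" where
  "form_scale (a1, a2, a3) = sqrt (4 * a1 * a3 - a2\<^sup>2) / pi"

definition half_lattice :: "(int \<times> int) set" where
  "half_lattice = {(m, n). m > 0 \<or> (m = 0 \<and> n > 0)}"

definition lists_increasingly :: "(nat \<Rightarrow> real) \<Rightarrow> ('a \<Rightarrow> real) \<Rightarrow> 'a set \<Rightarrow> bool" where
  "lists_increasingly L v S \<longleftrightarrow>
     mono L \<and> (\<exists>b. bij_betw b UNIV S \<and> (\<forall>j. L j = v (b j)))"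

text \<open>Indices start at 0, so \<open>spectrum \<alpha> j\<close> is $\Lambda_{j+1}$.  The sequence exists and
  is unique for every form in the domain: see \<open>lists_increasingly_spectrum\<close> below.\<close>

definition spectrum :: "real \<times> real \<times> real \<Rightarrow> nat \<Rightarrow> real" where
  "spectrum \<alpha> =
     (THE L. lists_increasingly L (\<lambda>p. qform \<alpha> p / form_scale \<alpha>) half_lattice)"

definition pair_correlation :: "real \<times> real \<times> real \<Rightarrow> real \<Rightarrow> real set \<Rightarrow> real" where
  "pair_correlation \<alpha> N I =
     real (card {(j, k). spectrum \<alpha> j \<le> N \<and> spectrum \<alpha> k \<le> N \<and> j \<noteq> k \<and>
                         spectrum \<alpha> j - spectrum \<alpha> k \<in> I}) / N"

lemma hyp_measure_null_iff:
  "E \<in> null_sets hyp_measure \<longleftrightarrow> E \<subseteq> form_domain \<and> negligible E"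
proof -
  have D: "form_domain = {a. 0 \<le> fst (snd a) \<and> fst (snd a) \<le> fst a \<and>
      fst a \<le> snd (snd a) \<and> fst a > 0}"
    by (auto simp: form_domain_def)
  have f: "fst \<in> borel_measurable (borel :: (real \<times> real \<times> real) measure)"
      "(\<lambda>a. fst (snd a)) \<in> borel_measurable (borel :: (real \<times> real \<times> real) measure)"
      "(\<lambda>a. snd (snd a)) \<in> borel_measurable (borel :: (real \<times> real \<times> real) measure)"
    by (intro borel_measurable_continuous_onI continuous_intros)+
  have "{a \<in> space borel. 0 \<le> fst (snd a) \<and> fst (snd a) \<le> fst a \<and>
      fst a \<le> snd (snd a) \<and> fst a > 0} \<in> sets (borel :: (real \<times> real \<times> real) measure)"
    by (intro sets.sets_Collect_conj borel_measurable_le borel_measurable_less f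
        borel_measurable_const)
  then have "form_domain \<in> sets borel" by (simp add: D)
  then have sD: "form_domain \<in> sets lebesgue" by simp
  have hd: "hyp_density =
      (\<lambda>a. 1 / (4 * fst a * snd (snd a) - (fst (snd a))\<^sup>2) powr (3 / 2))"
    by (auto simp: fun_eq_iff)
  have "(\<lambda>a. ennreal (hyp_density a)) \<in> borel_measurable borel"
    unfolding hd by (intro measurable_compose[OF _ measurable_ennreal] borel_measurable_divide
      powr_real_measurable borel_measurable_diff borel_measurable_times borel_measurable_power
      borel_measurable_const f)
  then have "(\<lambda>a. ennreal (hyp_density a)) \<in> borel_measurable lebesgue"
    by (simp add: measurable_completion)
  then have m: "(\<lambda>a. ennreal (hyp_density a)) \<in> borel_measurable (lebesgue_on form_domain)"
    by (rule measurable_restrict_space1)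
  have pos: "hyp_density a > 0" if "a \<in> form_domain" for a
  proof -
    obtain a1 a2 a3 where a: "a = (a1, a2, a3)" by (cases a)
    have h: "0 \<le> a2" "a2 \<le> a1" "a1 \<le> a3" "a1 > 0"
      using that by (auto simp: a form_domain_def)
    have "a2 * a2 \<le> a1 * a3" using h by (intro mult_mono) auto
    moreover have "0 < a1 * a3" using h by simp
    ultimately have "a2\<^sup>2 < 4 * a1 * a3" by (simp add: power2_eq_square)
    then show ?thesis by (simp add: a)
  qed
  have "E \<in> null_sets hyp_measure \<longleftrightarrow>
      E \<in> sets (lebesgue_on form_domain) \<and>
      (AE x in lebesgue_on form_domain. x \<in> E \<longrightarrow> ennreal (hyp_density x) = 0)"
    unfolding hyp_measure_def by (rule null_sets_density_iff[OF m])
  also have "\<dots> \<longleftrightarrow> E \<in> sets (lebesgue_on form_domain) \<and>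
      (AE x in lebesgue_on form_domain. x \<notin> E)"
  proof (intro conj_cong refl AE_cong)
    fix x assume "x \<in> space (lebesgue_on form_domain)"
    then have "hyp_density x > 0" using pos by (simp add: space_restrict_space)
    then show "(x \<in> E \<longrightarrow> ennreal (hyp_density x) = 0) \<longleftrightarrow> x \<notin> E"
      by (simp add: ennreal_eq_0_iff)
  qed
  also have "\<dots> \<longleftrightarrow> E \<in> null_sets (lebesgue_on form_domain)"
    using AE_iff_null_sets by blast
  also have "\<dots> \<longleftrightarrow> E \<subseteq> form_domain \<and> negligible E"
    using sD by (auto simp: null_sets_restrict_space negligible_iff_null_sets)
  finally show ?thesis .
qed

lemma lists_increasingly_exists:
  fixes v :: "'a \<Rightarrow> real"
  assumes inf: "infinite S" and fin: "\<And>x. finite {s \<in> S. v s \<le> x}"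
  shows "\<exists>L. lists_increasingly L v S"
proof -
  have ex: "\<exists>s. s \<in> S - A \<and> (\<forall>t \<in> S - A. v s \<le> v t)" if A: "finite A" for A
  proof -
    have "infinite (S - A)" using inf A by simp
    then obtain t where t: "t \<in> S - A" by (metis finite.emptyI ex_in_conv)
    let ?T = "{s \<in> S - A. v s \<le> v t}"
    have T: "finite ?T" by (rule finite_subset[OF _ fin[of "v t"]]) auto
    have "?T \<noteq> {}" using t by auto
    then obtain s where s: "s \<in> ?T" "\<forall>u\<in>?T. v s \<le> v u"
      using T by (metis (no_types, lifting) arg_min_if_finite(1) arg_min_least)
    have "v s \<le> v u" if "u \<in> S - A" for u
      using s that by (cases "v u \<le> v t") auto
    with s(1) show ?thesis by blast
  qed
  define pick where "pick A = (SOME s. s \<in> S - A \<and> (\<forall>t \<in> S - A. v s \<le> v t))" for A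
  define A where "A = rec_nat {} (\<lambda>_ X. insert (pick X) X)"
  have A0: "A 0 = {}" and AS: "A (Suc n) = insert (pick (A n)) (A n)" for n
    by (simp_all add: A_def)
  have finA: "finite (A n)" for n by (induction n) (simp_all add: A0 AS)
  define b where "b n = pick (A n)" for n
  have b: "b n \<in> S - A n" "t \<in> S - A n \<Longrightarrow> v (b n) \<le> v t" for n t
  proof -
    have *: "b n \<in> S - A n \<and> (\<forall>t \<in> S - A n. v (b n) \<le> v t)" for n
      unfolding b_def pick_def by (rule someI_ex[OF ex[OF finA]])
    show "b n \<in> S - A n" using * by blast
    show "v (b n) \<le> v t" if "t \<in> S - A n" using * that by blast
  qed
  have Aeq: "A n = b ` {..<n}" for n
    by (induction n) (auto simp: A0 AS b_def lessThan_Suc)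
  have inj: "inj b"
  proof (rule linorder_injI)
    fix i j :: nat assume "i < j"
    then have "b i \<in> A j" by (simp add: Aeq)
    moreover have "b j \<notin> A j" using b(1)[of j] by blast
    ultimately show "b i \<noteq> b j" by metis
  qed
  have surj: "range b = S"
  proof (rule ccontr)
    assume "range b \<noteq> S"
    then obtain s where s: "s \<in> S" "s \<notin> range b" using b(1) by blast
    have "s \<in> S - A n" for n using s by (auto simp: Aeq)
    then have "range b \<subseteq> {u \<in> S. v u \<le> v s}" using b(1) b(2)[of s] by blast
    then have "finite (range b)" using fin finite_subset by blast
    then show False using inj finite_imageD by blast
  qed
  have "mono (\<lambda>n. v (b n))"
  proof (rule mono_iff_le_Suc[THEN iffD2], rule allI)
    fix n
    have "b (Suc n) \<in> S - A n" using b(1)[of "Suc n"] by (simp add: AS)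
    then show "v (b n) \<le> v (b (Suc n))" by (rule b(2))
  qed
  then show ?thesis
    unfolding lists_increasingly_def using inj surj by (auto simp: bij_betw_def)
qed

lemma lists_increasingly_le:
  fixes v :: "'a \<Rightarrow> real"
  assumes fin: "\<And>x. finite {s \<in> S. v s \<le> x}"
    and L: "lists_increasingly L v S" and M: "lists_increasingly M v S"
  shows "M j \<le> L j"
proof (rule ccontr)
  assume less: "\<not> M j \<le> L j"
  obtain b where b: "bij_betw b UNIV S" "\<And>i. L i = v (b i)" and mL: "mono L"
    using L unfolding lists_increasingly_def by blast
  obtain c where c: "bij_betw c UNIV S" "\<And>i. M i = v (c i)" and mM: "mono M"
    using M unfolding lists_increasingly_def by blast
  let ?X = "{s \<in> S. v s \<le> L j}"
  have "b ` {..j} \<subseteq> ?X"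
    using b mL by (auto simp: bij_betw_def mono_def)
  then have "card (b ` {..j}) \<le> card ?X" by (rule card_mono[OF fin])
  moreover have "card (b ` {..j}) = Suc j"
    using b(1) by (subst card_image) (auto simp: bij_betw_def intro: inj_on_subset)
  moreover have "?X \<subseteq> c ` {..<j}"
  proof
    fix s assume s: "s \<in> ?X"
    then obtain i where i: "s = c i" using c(1) by (auto simp: bij_betw_def)
    then have "M i < M j" using s less c(2) by auto
    then have "i < j" using mM by (metis monoD not_le)
    then show "s \<in> c ` {..<j}" using i by blast
  qed
  then have "card ?X \<le> card {..<j}" by (meson card_image_le card_mono finite_imageI finite_lessThan le_trans)
  ultimately show False by simp
qed

lemma finite_qform_le:
  assumes "\<alpha> \<in> form_domain"
  shows "finite {p \<in> half_lattice. qform \<alpha> p / form_scale \<alpha> \<le> x}"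
proof -
  obtain a1 a2 a3 where a: "\<alpha> = (a1, a2, a3)" by (cases \<alpha>)
  have h: "0 \<le> a2" "a2 \<le> a1" "a1 \<le> a3" "a1 > 0"
    using assms by (auto simp: a form_domain_def)
  have "a2 * a2 \<le> a1 * a3" using h by (intro mult_mono) auto
  moreover have "0 < a1 * a3" using h by simp
  ultimately have "a2\<^sup>2 < 4 * a1 * a3" by (simp add: power2_eq_square)
  then have d: "form_scale \<alpha> > 0" by (simp add: a)
  define K where "K = \<lceil>2 * (x * form_scale \<alpha>) / a1\<rceil>"
  have "{p \<in> half_lattice. qform \<alpha> p / form_scale \<alpha> \<le> x} \<subseteq> {-K..K} \<times> {-K..K}"
  proof (rule subsetI)
    fix p assume p: "p \<in> {p \<in> half_lattice. qform \<alpha> p / form_scale \<alpha> \<le> x}"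
    obtain m n where mn: "p = (m, n)" by (cases p)
    from p have "qform \<alpha> (m, n) / form_scale \<alpha> \<le> x" by (simp add: mn)
    then have q: "qform \<alpha> (m, n) \<le> x * form_scale \<alpha>" using d by (simp add: divide_le_eq)
    define s t where "s = real_of_int m" and "t = real_of_int n"
    have am: "2 * \<bar>s * t\<bar> \<le> s\<^sup>2 + t\<^sup>2"
      using sum_squares_bound[of "\<bar>s\<bar>" "\<bar>t\<bar>"] by (simp add: abs_mult)
    have "- (a2 * (s * t)) \<le> a2 * \<bar>s * t\<bar>"
      using mult_left_mono[OF abs_ge_minus_self[of "s * t"] h(1)] by simp
    also have "\<dots> \<le> a1 * \<bar>s * t\<bar>" using h by (intro mult_right_mono) auto
    also have "\<dots> \<le> a1 * ((s\<^sup>2 + t\<^sup>2) / 2)" using h am by (intro mult_left_mono) auto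
    finally have "- (a2 * (s * t)) \<le> a1 * ((s\<^sup>2 + t\<^sup>2) / 2)" .
    moreover have "a1 * t\<^sup>2 \<le> a3 * t\<^sup>2" using h by (intro mult_right_mono) auto
    ultimately have "a1 * ((s\<^sup>2 + t\<^sup>2) / 2) \<le> qform \<alpha> (m, n)"
      by (simp add: a s_def t_def algebra_simps)
    with q have "a1 * ((s\<^sup>2 + t\<^sup>2) / 2) \<le> x * form_scale \<alpha>" by simp
    then have "s\<^sup>2 + t\<^sup>2 \<le> 2 * (x * form_scale \<alpha>) / a1"
      using h(4) by (simp add: field_simps)
    then have "real_of_int (m\<^sup>2 + n\<^sup>2) \<le> 2 * (x * form_scale \<alpha>) / a1"
      by (simp add: s_def t_def)
    then have "m\<^sup>2 + n\<^sup>2 \<le> K" unfolding K_def by linarith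
    moreover have sq: "\<bar>k\<bar> \<le> k\<^sup>2" for k :: int
      using self_le_power[of "\<bar>k\<bar>" 2] by (cases "k = 0") auto
    ultimately have "\<bar>m\<bar> \<le> K \<and> \<bar>n\<bar> \<le> K"
      using sq[of m] sq[of n] zero_le_power2[of m] zero_le_power2[of n] by linarith
    then show "p \<in> {-K..K} \<times> {-K..K}" by (auto simp: mn)
  qed
  then show ?thesis by (rule finite_subset) simp
qed

lemma infinite_half_lattice: "infinite half_lattice"
proof -
  have "range (\<lambda>n::nat. (1::int, int n)) \<subseteq> half_lattice" by (auto simp: half_lattice_def)
  moreover have "infinite (range (\<lambda>n::nat. (1::int, int n)))"
    by (rule range_inj_infinite) (auto simp: inj_def)
  ultimately show ?thesis using finite_subset by blast
qed

lemma lists_increasingly_spectrum: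
  assumes "\<alpha> \<in> form_domain"
  shows "lists_increasingly L (\<lambda>p. qform \<alpha> p / form_scale \<alpha>) half_lattice \<longleftrightarrow> L = spectrum \<alpha>"
proof -
  let ?v = "\<lambda>p. qform \<alpha> p / form_scale \<alpha>"
  have fin: "finite {p \<in> half_lattice. ?v p \<le> x}" for x using finite_qform_le[OF assms] .
  have "\<exists>!L. lists_increasingly L ?v half_lattice"
  proof (rule ex_ex1I)
    show "\<exists>L. lists_increasingly L ?v half_lattice"
      by (rule lists_increasingly_exists[OF infinite_half_lattice fin])
  next
    fix L M assume "lists_increasingly L ?v half_lattice" "lists_increasingly M ?v half_lattice"
    then show "L = M"
      using lists_increasingly_le[where v = ?v, OF fin] by (intro ext antisym) blast+
  qed
  then show ?thesis unfolding spectrum_def by (metis (mono_tags, lifting) theI')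
qed

lemma finite_pair_correlation_set:
  assumes "\<alpha> \<in> form_domain"
  shows "finite {(j, k). spectrum \<alpha> j \<le> N \<and> spectrum \<alpha> k \<le> N \<and> j \<noteq> k \<and>
                         spectrum \<alpha> j - spectrum \<alpha> k \<in> I}"
proof -
  let ?v = "\<lambda>p. qform \<alpha> p / form_scale \<alpha>"
  obtain b where b: "bij_betw b UNIV half_lattice" "\<And>j. spectrum \<alpha> j = ?v (b j)"
    using lists_increasingly_spectrum[OF assms, of "spectrum \<alpha>"]
    unfolding lists_increasingly_def by blast
  have "b ` {j. spectrum \<alpha> j \<le> N} \<subseteq> {p \<in> half_lattice. ?v p \<le> N}"
    using b by (auto simp: bij_betw_def)
  then have "finite (b ` {j. spectrum \<alpha> j \<le> N})"
    using finite_qform_le[OF assms] by (rule finite_subset)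
  then have "finite {j. spectrum \<alpha> j \<le> N}"
    by (rule finite_imageD) (use b(1) in \<open>auto simp: bij_betw_def intro: inj_on_subset\<close>)
  then have "finite ({j. spectrum \<alpha> j \<le> N} \<times> {k. spectrum \<alpha> k \<le> N})" by simp
  then show ?thesis by (rule finite_subset[rotated]) auto
qed

end

theory Submission
  imports Defs "HOL-Real_Asymp.Real_Asymp"
begin

text \<open>
  Writing $x - y = a$ and $x + y = b$, the difference $q(x) - q(y)$ is the linear form
  $\alpha_1 a_1 b_1 + \alpha_2 (a_1 b_2 + a_2 b_1)/2 + \alpha_3 a_2 b_2$ in $\alpha$.  Instead of
  an asymptotic formula for the second moment of the pair count at scale $\delta$, one compares
  this count with the one at the coarse scale $\delta' = T^{5/8}$, where counting lattice points
  in annuli is enough.  The difference of the two normalised counts is a sum of the mean zero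
  function $1_{[0,\delta]}/\delta - 1_{[0,\delta']}/\delta'$ over such linear forms $v, w$.  In the
  second moment over a small region of $\alpha$, with a Lipschitz weight, the covariance of $v$
  and $w$ is then $O(\min(1/|m|, \delta'|v|/m^2))$ for every nonzero minor $m$ of $(v, w)$
  involving the first coordinate, so that only an upper bound for the number of nearly parallel
  pairs $v, w$ is needed.  It follows from the factorisation of the associated binary forms into
  linear factors.  Vectors $a, b$ with a small coordinate or a large gcd are removed by a first
  moment bound.  Chebyshev's inequality, the Borel-Cantelli lemma along geometric progressions
  of $T$ and $\delta$, and monotonicity of the pair count in both parameters do the rest.
\<close>


section \<open>Counting nearly parallel products of linear forms\<close>

text \<open>The normalised counts have size T, comparable to X^2 with X =
  \<open>\<kappa> * sqrt T\<close>, so the second moment must fall below X^4 by a power of T. Up to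
  powers of \<open>B\<close> it is at most X^2/\<delta> + X^3 + M + X^10 \<delta>'/M^2. The first
  term comes from proportional coefficient vectors and is the reason for \<delta> >= T^(-1+\<eta>).
  M is a free threshold: minors below it are counted, larger ones cost \<delta>' X^2/M^2 for each of
  O(X^8) quadruples. For \<delta>' about X^(5/4), balancing M^3 = X^10 \<delta>' gives M = X^(15/4)
  and saves X^(1/4), that is T^(1/8), whence \<eta> <= 1/8. The coarse exponent has to exceed 1/2
  for Gauss's O(sqrt T) error to be harmless in annuli, and to stay below 1 for the balanced M to
  stay below X^4. With B = \<beta>^4 and \<beta> = T^(\<eta>/48), all losses on good vectors amount
  to \<beta>^46. The set of lattice points is frozen at a centre c while \<alpha> varies; the
  resulting distortion by a factor \<rho>, like the rounding to powers of \<rho>, disappears only in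
  the limit \<rho> -> 1.\<close>

lemma card_int_interval:
  fixes S :: "int set" and x y :: real
  assumes "S \<subseteq> {n. x \<le> of_int n \<and> of_int n \<le> y}" "x \<le> y"
  shows "finite S" "real (card S) \<le> y - x + 1"
proof -
  have sub: "S \<subseteq> {\<lceil>x\<rceil>..\<lfloor>y\<rfloor>}"
    using assms(1) by (auto simp: ceiling_le_iff le_floor_iff)
  then show "finite S" by (rule finite_subset) simp
  have "card S \<le> card {\<lceil>x\<rceil>..\<lfloor>y\<rfloor>}" using sub by (rule card_mono[rotated]) simp
  also have "\<dots> = nat (\<lfloor>y\<rfloor> - \<lceil>x\<rceil> + 1)" by simp
  finally have "real (card S) \<le> real (nat (\<lfloor>y\<rfloor> - \<lceil>x\<rceil> + 1))" by simp
  also have "\<dots> \<le> y - x + 1"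
  proof (cases "\<lfloor>y\<rfloor> - \<lceil>x\<rceil> + 1 \<ge> 0")
    case True
    then have "real (nat (\<lfloor>y\<rfloor> - \<lceil>x\<rceil> + 1)) = of_int \<lfloor>y\<rfloor> - of_int \<lceil>x\<rceil> + 1" by simp
    also have "\<dots> \<le> y - x + 1" using of_int_floor_le[of y] le_of_int_ceiling[of x] by linarith
    finally show ?thesis .
  qed (use assms(2) in simp)
  finally show "real (card S) \<le> y - x + 1" .
qed

section \<open>Boxes of integer vectors, determinants and minors\<close>

definition sq_box :: "real \<Rightarrow> (int \<times> int) set" where
  "sq_box X = {a. \<bar>of_int (fst a)\<bar> \<le> X \<and> \<bar>of_int (snd a)\<bar> \<le> X}"

text \<open>The lower bounds on both coordinates keep products such as \<open>coef1\<close> of size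
  X^2 up to a factor B^2, and the gcd bound limits how many vectors of the box are parallel to a
  given one.\<close>

definition good_box :: "real \<Rightarrow> real \<Rightarrow> (int \<times> int) set" where
  "good_box X B = {a \<in> sq_box X. \<bar>of_int (fst a)\<bar> \<ge> X / B \<and> \<bar>of_int (snd a)\<bar> \<ge> X / B \<and>
     of_int (gcd (fst a) (snd a)) \<le> B}"

definition cross :: "int \<times> int \<Rightarrow> int \<times> int \<Rightarrow> int" where
  "cross a c = fst a * snd c - snd a * fst c"

text \<open>The coefficients of $\alpha_1$, $\alpha_2$, $\alpha_3$ in $q_\alpha(x) - q_\alpha(y)$,
  as functions of $a = x - y$ and $b = x + y$.\<close>

fun coef1 :: "(int \<times> int) \<times> (int \<times> int) \<Rightarrow> real" where
  "coef1 (a, b) = of_int (fst a) * of_int (fst b)"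
fun coef2 :: "(int \<times> int) \<times> (int \<times> int) \<Rightarrow> real" where
  "coef2 (a, b) = (of_int (fst a) * of_int (snd b) + of_int (snd a) * of_int (fst b)) / 2"
fun coef3 :: "(int \<times> int) \<times> (int \<times> int) \<Rightarrow> real" where
  "coef3 (a, b) = of_int (snd a) * of_int (snd b)"

text \<open>Both minors contain the first column: \<open>coef1\<close> is bounded below on good
  vectors, and the integration begins by solving for the first coordinate of \<alpha>.\<close>

definition minor2 :: "(int \<times> int) \<times> (int \<times> int) \<Rightarrow> (int \<times> int) \<times> (int \<times> int) \<Rightarrow> real" where
  "minor2 p q = coef1 p * coef2 q - coef2 p * coef1 q"
definition minor3 :: "(int \<times> int) \<times> (int \<times> int) \<Rightarrow> (int \<times> int) \<times> (int \<times> int) \<Rightarrow> real" where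
  "minor3 p q = coef1 p * coef3 q - coef3 p * coef1 q"

lemma int_abs_le:
  fixes X :: real
  assumes "X \<ge> 0"
  shows "finite {n::int. \<bar>of_int n\<bar> \<le> X}" "real (card {n::int. \<bar>of_int n\<bar> \<le> X}) \<le> 2 * X + 1"
proof -
  have "{n::int. \<bar>of_int n\<bar> \<le> X} \<subseteq> {n. -X \<le> of_int n \<and> of_int n \<le> X}" by auto
  from card_int_interval[OF this] assms
  show "finite {n::int. \<bar>of_int n\<bar> \<le> X}" "real (card {n::int. \<bar>of_int n\<bar> \<le> X}) \<le> 2 * X + 1"
    by auto
qed

lemma sq_box_eq: "sq_box X = {n. \<bar>of_int n\<bar> \<le> X} \<times> {n. \<bar>of_int n\<bar> \<le> X}"
  by (auto simp: sq_box_def)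

lemma finite_sq_box [simp]: "finite (sq_box X)"
proof (cases "X \<ge> 0")
  case True
  then show ?thesis by (simp add: sq_box_eq int_abs_le)
next
  case False
  then have "{n::int. \<bar>of_int n\<bar> \<le> X} = {}" by auto
  then show ?thesis by (simp add: sq_box_eq)
qed

lemma finite_good_box [simp]: "finite (good_box X B)"
  by (rule finite_subset[OF _ finite_sq_box[of X]]) (auto simp: good_box_def)

lemma good_box_subset: "good_box X B \<subseteq> sq_box X" by (auto simp: good_box_def)

lemma card_sq_box:
  assumes "X \<ge> 1"
  shows "real (card (sq_box X)) \<le> 9 * X^2"
proof -
  have "real (card (sq_box X)) = real (card {n::int. \<bar>of_int n\<bar> \<le> X}) * real (card {n::int. \<bar>of_int n\<bar> \<le> X})"
    by (simp add: sq_box_eq card_cartesian_product)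
  also have "\<dots> \<le> (3 * X) * (3 * X)"
    using int_abs_le(2)[of X] assms by (intro mult_mono) auto
  finally show ?thesis by (simp add: power2_eq_square)
qed

lemma card_good_box: "X \<ge> 1 \<Longrightarrow> real (card (good_box X B)) \<le> 9 * X^2"
  using card_sq_box[of X] card_mono[OF finite_sq_box good_box_subset, of X B] by linarith

text \<open>Coprimality of the coordinates of c / gcd forces the ratio to be an integer, so the
  lattice points on the line through \<open>c\<close> are spaced by c / gcd.\<close>

lemma cross_eq_0_imp:
  assumes "cross a c = 0" "c \<noteq> (0, 0)"
  obtains j where "fst a = j * (fst c div gcd (fst c) (snd c))"
    "snd a = j * (snd c div gcd (fst c) (snd c))"
proof -
  define g where "g = gcd (fst c) (snd c)"
  define c1 c2 where "c1 = fst c div g" and "c2 = snd c div g"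
  have g0: "g \<noteq> 0" using assms(2) by (auto simp: g_def prod_eq_iff)
  have e: "fst c = g * c1" "snd c = g * c2" by (auto simp: c1_def c2_def g_def)
  have cop: "coprime c1 c2" unfolding c1_def c2_def g_def
    by (rule div_gcd_coprime) (use assms(2) in \<open>auto simp: prod_eq_iff\<close>)
  have "g * (fst a * c2 - snd a * c1) = 0" using assms(1) by (simp add: cross_def e algebra_simps)
  then have eq: "fst a * c2 = snd a * c1" using g0 by simp
  show thesis
  proof (cases "c1 = 0")
    case True
    then have "c2 \<noteq> 0" using assms(2) e by (auto simp: prod_eq_iff)
    then have "is_unit c2" using cop True by simp
    \<comment> \<open>\<open>c2\<close> is 1 or -1 and thus its own inverse, which makes
      \<open>snd a * c2\<close> the multiplier.\<close>
    then have "c2 * c2 = 1" by (auto simp: zdvd1_eq abs_if split: if_splits)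
    then have "fst a = (snd a * c2) * c1" "snd a = (snd a * c2) * c2"
      using eq True \<open>c2 \<noteq> 0\<close> by (auto simp: mult.assoc)
    then show ?thesis using that unfolding c1_def c2_def g_def by blast
  next
    case False
    have "c1 dvd fst a * c2" using eq by simp
    then have "c1 dvd fst a" using cop by (simp add: coprime_dvd_mult_left_iff)
    then obtain j where j: "fst a = j * c1" by (metis dvd_def mult.commute)
    then have "snd a = j * c2" using eq False by (simp add: mult.assoc)
    with j show ?thesis using that unfolding c1_def c2_def g_def by blast
  qed
qed

lemma good_boxD:
  assumes "a \<in> good_box X B" "X > 0" "B > 0"
  shows "fst a \<noteq> 0" "snd a \<noteq> 0" "X / B \<le> \<bar>of_int (fst a)\<bar>" "X / B \<le> \<bar>of_int (snd a)\<bar>"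
    "\<bar>of_int (fst a)\<bar> \<le> X" "\<bar>of_int (snd a)\<bar> \<le> X" "of_int (gcd (fst a) (snd a)) \<le> B"
proof -
  have "X / B > 0" using assms by simp
  then show "fst a \<noteq> 0" "snd a \<noteq> 0" using assms(1) by (auto simp: good_box_def)
qed (use assms in \<open>auto simp: good_box_def sq_box_def\<close>)

text \<open>Two solutions differ by a multiple of c / gcd, whose first coordinate is at least X /
  B^2 because the gcd is at most B. The box has width 2X, so the multiplier is at most 2 B^2 in
  absolute value, which leaves 4 B^2 + 1 points.\<close>

lemma card_cross_fibre:
  assumes c: "c \<in> good_box X B" and X: "X \<ge> 1" and B: "B \<ge> 1"
  shows "real (card {a \<in> sq_box X. cross a c = k}) \<le> 5 * B^2"
proof (cases "{a \<in> sq_box X. cross a c = k} = {}")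
  case True
  then show ?thesis by (simp only: card.empty) simp
next
  case False
  then obtain a0 where a0: "a0 \<in> sq_box X" "cross a0 c = k" by auto
  define g where "g = gcd (fst c) (snd c)"
  define c1 c2 where "c1 = fst c div g" and "c2 = snd c div g"
  note gd = good_boxD[OF c]
  have c0: "fst c \<noteq> 0" using gd X B by simp
  have g: "g > 0" "real_of_int g \<le> B" using c0 gd(7) X B by (auto simp: g_def)
  have e: "fst c = g * c1" by (simp add: c1_def g_def)
  have "X / B \<le> real_of_int \<bar>fst c\<bar>" using gd X B by simp
  also have "\<dots> = real_of_int g * \<bar>real_of_int c1\<bar>" using g by (simp add: e abs_mult)
  also have "\<dots> \<le> B * \<bar>real_of_int c1\<bar>" using g by (intro mult_right_mono) auto
  finally have c1: "X / B^2 \<le> \<bar>real_of_int c1\<bar>" using B by (simp add: field_simps power2_eq_square)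
  have sub: "{a \<in> sq_box X. cross a c = k} \<subseteq>
      (\<lambda>j. (fst a0 + j * c1, snd a0 + j * c2)) ` {j. \<bar>of_int j\<bar> \<le> 2 * B^2}"
  proof
    fix a assume a: "a \<in> {a \<in> sq_box X. cross a c = k}"
    have "cross (fst a - fst a0, snd a - snd a0) c = 0" using a a0 by (simp add: cross_def algebra_simps)
    moreover have "c \<noteq> (0, 0)" using c0 by auto
    ultimately obtain j where j: "fst a - fst a0 = j * c1" "snd a - snd a0 = j * c2"
      by (rule cross_eq_0_imp) (auto simp: c1_def c2_def g_def)
    have "\<bar>real_of_int j\<bar> * (X / B^2) \<le> \<bar>real_of_int j\<bar> * \<bar>real_of_int c1\<bar>"
      using c1 by (intro mult_left_mono) auto
    also have "\<dots> = \<bar>real_of_int (fst a) - real_of_int (fst a0)\<bar>"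
      by (metis abs_mult j(1) of_int_diff of_int_mult)
    also have "\<dots> \<le> 2 * X" using a a0 by (auto simp: sq_box_def)
    finally have "\<bar>real_of_int j\<bar> \<le> 2 * B^2" using X B by (simp add: field_simps)
    then show "a \<in> (\<lambda>j. (fst a0 + j * c1, snd a0 + j * c2)) ` {j. \<bar>of_int j\<bar> \<le> 2 * B^2}"
      using j by (intro image_eqI[where x = j]) (auto simp: prod_eq_iff algebra_simps)
  qed
  have fin: "finite {j::int. \<bar>of_int j\<bar> \<le> 2 * B^2}" by (rule int_abs_le) simp
  have "card {a \<in> sq_box X. cross a c = k} \<le> card {j::int. \<bar>of_int j\<bar> \<le> 2 * B^2}"
    using surj_card_le[OF fin sub] .
  then have "real (card {a \<in> sq_box X. cross a c = k}) \<le> 2 * (2 * B^2) + 1"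
    using int_abs_le(2)[of "2 * B^2"] by (simp add: order_trans)
  also have "\<dots> \<le> 5 * B^2" using B one_le_power[of B 2] by simp
  finally show ?thesis .
qed

lemma harm_le: "n \<ge> 1 \<Longrightarrow> harm n \<le> 1 + ln (real n)"
proof (induction n rule: nat_induct_at_least)
  case base
  then show ?case by (simp add: harm_def)
next
  case (Suc n)
  have "ln (real n) - ln (real (Suc n)) = ln (real n / real (Suc n))"
    using Suc by (subst ln_div) auto
  also have "\<dots> \<le> real n / real (Suc n) - 1" using Suc by (intro ln_le_minus_one) auto
  also have "\<dots> = - inverse (real (Suc n))" by (simp add: field_simps)
  finally show ?case using Suc by (simp add: harm_Suc)
qed

lemma sum_inverse_abs_le:
  fixes K :: real
  assumes "K \<ge> 1"
  shows "(\<Sum>k \<in> {k::int. k \<noteq> 0 \<and> \<bar>of_int k\<bar> \<le> K}. 1 / \<bar>real_of_int k\<bar>) \<le> 2 * (1 + ln K)"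
proof -
  define n where "n = nat \<lfloor>K\<rfloor>"
  have n: "n \<ge> 1" "real n \<le> K" using assms by (auto simp: n_def le_nat_iff le_floor_iff)
  have eq: "{k::int. k \<noteq> 0 \<and> \<bar>of_int k\<bar> \<le> K} = int ` {1..n} \<union> (\<lambda>i. - int i) ` {1..n}"
  proof (intro equalityI subsetI)
    fix k :: int assume "k \<in> {k::int. k \<noteq> 0 \<and> \<bar>of_int k\<bar> \<le> K}"
    then have k: "k \<noteq> 0" "\<bar>k\<bar> \<le> \<lfloor>K\<rfloor>" by (auto simp: le_floor_iff)
    show "k \<in> int ` {1..n} \<union> (\<lambda>i. - int i) ` {1..n}"
    proof (cases "k > 0")
      case True
      then have "k = int (nat k)" "nat k \<in> {1..n}" using k by (auto simp: n_def)
      then show ?thesis by blast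
    next
      case False
      then have "k = - int (nat (-k))" "nat (-k) \<in> {1..n}" using k by (auto simp: n_def)
      then show ?thesis by blast
    qed
  qed (use n in auto)
  have "(\<Sum>k \<in> {k::int. k \<noteq> 0 \<and> \<bar>of_int k\<bar> \<le> K}. 1 / \<bar>real_of_int k\<bar>)
    \<le> (\<Sum>k \<in> int ` {1..n}. 1 / \<bar>real_of_int k\<bar>) + (\<Sum>k \<in> (\<lambda>i. - int i) ` {1..n}. 1 / \<bar>real_of_int k\<bar>)"
    unfolding eq by (subst sum.union_inter[symmetric]) (auto intro: sum_nonneg)
  also have "\<dots> = 2 * harm n"
    by (subst (1 2) sum.reindex) (auto simp: inj_on_def harm_def inverse_eq_divide)
  also have "\<dots> \<le> 2 * (1 + ln (real n))" by (intro mult_left_mono harm_le n) auto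
  also have "\<dots> \<le> 2 * (1 + ln K)" using n by simp
  finally show ?thesis .
qed

lemma abs_cross_le:
  assumes "a \<in> sq_box X" "c \<in> sq_box X"
  shows "\<bar>of_int (cross a c)\<bar> \<le> 2 * X^2"
proof -
  have "\<bar>real_of_int (fst a) * real_of_int (snd c)\<bar> \<le> X * X" "\<bar>real_of_int (snd a) * real_of_int (fst c)\<bar> \<le> X * X"
    unfolding abs_mult using assms by (auto simp: sq_box_def intro!: mult_mono)
  then show ?thesis unfolding cross_def power2_eq_square of_int_diff of_int_mult by linarith
qed

text \<open>Grouping by the value k of the determinant gives fibres of at most 5 B^2 vectors and a
  harmonic sum over 0 < |k| <= 2 X^2. The hypothesis on the logarithm bounds that sum by 2
  B.\<close>

lemma sum_inverse_cross_le:
  assumes c: "c \<in> good_box X B" and X: "X \<ge> 1" and B: "B \<ge> 1" "1 + ln (2 * X^2) \<le> B"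
  shows "(\<Sum>a \<in> {a \<in> sq_box X. cross a c \<noteq> 0}. 1 / \<bar>real_of_int (cross a c)\<bar>) \<le> 10 * B ^ 3"
proof -
  let ?S = "{a \<in> sq_box X. cross a c \<noteq> 0}" and ?T = "{k::int. k \<noteq> 0 \<and> \<bar>of_int k\<bar> \<le> 2 * X^2}"
  have finT: "finite ?T" by (rule finite_subset[OF _ int_abs_le(1)[of "2 * X^2"]]) auto
  have X2: "1 \<le> 2 * X^2" using X one_le_power[of X 2] by linarith
  have "(\<Sum>a \<in> ?S. 1 / \<bar>real_of_int (cross a c)\<bar>) =
     (\<Sum>k \<in> ?T. \<Sum>a \<in> {a \<in> ?S. cross a c = k}. 1 / \<bar>real_of_int (cross a c)\<bar>)"
    using abs_cross_le[of _ X c] c good_box_subset[of X B] finT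
    by (intro sum.group[symmetric] image_subsetI) auto
  also have "\<dots> = (\<Sum>k \<in> ?T. real (card {a \<in> ?S. cross a c = k}) * (1 / \<bar>real_of_int k\<bar>))"
    by (intro sum.cong refl) simp
  also have "\<dots> \<le> (\<Sum>k \<in> ?T. (5 * B^2) * (1 / \<bar>real_of_int k\<bar>))"
  proof (intro sum_mono mult_right_mono)
    fix k
    have "card {a \<in> ?S. cross a c = k} \<le> card {a \<in> sq_box X. cross a c = k}"
      by (intro card_mono) auto
    then show "real (card {a \<in> ?S. cross a c = k}) \<le> 5 * B^2"
      using card_cross_fibre[OF c X B(1), of k] by linarith
  qed simp
  also have "\<dots> = 5 * B^2 * (\<Sum>k \<in> ?T. 1 / \<bar>real_of_int k\<bar>)" by (simp add: sum_distrib_left)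
  also have "\<dots> \<le> 5 * B^2 * (2 * B)"
    using sum_inverse_abs_le[OF X2] B by (intro mult_left_mono) auto
  finally show ?thesis by (simp add: power2_eq_square power3_eq_cube)
qed

text \<open>For fixed $a$, $b$, $c$ and $d_1$ the minor is affine in $d_2$, with slope at least
  $(X/B)^3/2$ in absolute value.\<close>

lemma card_minor2_fibre:
  assumes a: "a \<in> good_box X B" and b: "b \<in> good_box X B" and c: "c \<in> good_box X B"
    and X: "X \<ge> 1" and B: "B \<ge> 1" and M: "M \<ge> 0"
  shows "real (card {d \<in> sq_box X. \<bar>minor2 (a, b) (c, d)\<bar> \<le> M}) \<le> 3 * X * (4 * M * B ^ 3 / X ^ 3 + 1)"
proof -
  let ?S = "{d \<in> sq_box X. \<bar>minor2 (a, b) (c, d)\<bar> \<le> M}"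
  let ?I = "{n::int. \<bar>of_int n\<bar> \<le> X}"
  \<comment> \<open>\<open>p\<close> is twice the slope in the second coordinate of
    \<open>d\<close>; below, \<open>h\<close> is the zero of the affine function.\<close>
  define p :: real where "p = of_int (fst a) * of_int (fst b) * of_int (fst c)"
  have XB: "0 \<le> X / B" using X B by simp
  have "(X / B) ^ 3 \<le> \<bar>p\<bar>"
    unfolding p_def abs_mult power3_eq_cube using X B XB
    by (intro mult_mono good_boxD(3)[OF a] good_boxD(3)[OF b] good_boxD(3)[OF c] mult_nonneg_nonneg) linarith+
  then have p: "X ^ 3 / B ^ 3 \<le> \<bar>p\<bar>" by (simp add: power_divide)
  have "0 < X ^ 3 / B ^ 3" using X B by (intro divide_pos_pos zero_less_power) auto
  then have p0: "\<bar>p\<bar> > 0" using p by (rule less_le_trans)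
  have fib: "real (card {e. (d1, e) \<in> ?S}) \<le> 4 * M * B ^ 3 / X ^ 3 + 1" for d1
  proof -
    define h :: real where "h = of_int d1 * (2 * coef2 (a, b) * of_int (fst c) - of_int (snd c) * coef1 (a, b)) / p"
    have "{e. (d1, e) \<in> ?S} \<subseteq> {e. h - 2 * M / \<bar>p\<bar> \<le> of_int e \<and> of_int e \<le> h + 2 * M / \<bar>p\<bar>}"
    proof clarsimp
      fix e assume "\<bar>minor2 (a, b) (c, d1, e)\<bar> \<le> M"
      moreover have "2 * minor2 (a, b) (c, d1, e) = p * (of_int e - h)"
        using p0 by (simp add: minor2_def h_def p_def field_simps)
      ultimately have "\<bar>p\<bar> * \<bar>of_int e - h\<bar> \<le> 2 * M"
        by (metis abs_mult abs_numeral mult_left_mono zero_le_numeral)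
      then have "\<bar>of_int e - h\<bar> \<le> 2 * M / \<bar>p\<bar>" using p0 by (simp add: field_simps)
      then show "h - 2 * M / \<bar>p\<bar> \<le> of_int e \<and> of_int e \<le> h + 2 * M / \<bar>p\<bar>" by linarith
    qed
    moreover have "h - 2 * M / \<bar>p\<bar> \<le> h + 2 * M / \<bar>p\<bar>" using M by simp
    ultimately have "real (card {e. (d1, e) \<in> ?S}) \<le> h + 2 * M / \<bar>p\<bar> - (h - 2 * M / \<bar>p\<bar>) + 1"
      by (rule card_int_interval(2))
    also have "\<dots> = 4 * M / \<bar>p\<bar> + 1" by simp
    also have "4 * M / \<bar>p\<bar> \<le> 4 * M / (X ^ 3 / B ^ 3)"
      using p M X B p0 \<open>0 < X ^ 3 / B ^ 3\<close> by (intro divide_left_mono mult_pos_pos) auto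
    finally show ?thesis by simp
  qed
  have "?S = Sigma ?I (\<lambda>d1. {e. (d1, e) \<in> ?S})" by (auto simp: sq_box_def)
  then have "card ?S = card (Sigma ?I (\<lambda>d1. {e. (d1, e) \<in> ?S}))" by (rule arg_cong)
  also have "\<dots> = (\<Sum>d1\<in>?I. card {e. (d1, e) \<in> ?S})"
  proof (intro card_SigmaI ballI)
    show "finite ?I" using X by (intro int_abs_le) auto
    show "finite {e. (d1, e) \<in> ?S}" for d1
      by (rule finite_subset[of _ "?I"]) (use X in \<open>auto simp: sq_box_def intro: int_abs_le\<close>)
  qed
  finally have "real (card ?S) = (\<Sum>d1\<in>?I. real (card {e. (d1, e) \<in> ?S}))" by simp
  also have "\<dots> \<le> (\<Sum>d1\<in>?I. 4 * M * B ^ 3 / X ^ 3 + 1)" by (intro sum_mono fib)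
  also have "\<dots> = real (card ?I) * (4 * M * B ^ 3 / X ^ 3 + 1)" by simp
  also have "\<dots> \<le> 3 * X * (4 * M * B ^ 3 / X ^ 3 + 1)"
    using int_abs_le(2)[of X] X B M by (intro mult_right_mono) auto
  finally show ?thesis .
qed

text \<open>If $v$ and $w$ are the coefficient vectors of $(a, b)$ and $(c, d)$, then both sides are
  $w_1$ times the binary form of $v$ evaluated at the zero $(c_2, -c_1)$ of the binary form of $w$.\<close>

lemma minor_identity:
  "coef1 (c, d) * of_int (cross a c) * of_int (cross b c) =
     2 * of_int (fst c) * of_int (snd c) * minor2 (a, b) (c, d) - (of_int (fst c))^2 * minor3 (a, b) (c, d)"
  by (simp add: cross_def minor2_def minor3_def field_simps power2_eq_square)

text \<open>The relation a1 c2 = a2 c1 pulls a common factor out of both products in the minor. This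
  serves the quadruples in which only one factor of (a, b) is parallel to its partner;
  \<open>minor3_swap\<close> carries it over to the other matching.\<close>

lemma minor3_of_cross_0:
  assumes "cross a c = 0"
  shows "minor3 (a, b) (c, d) = of_int (snd a) * of_int (fst c) * of_int (cross b d)"
proof -
  have "of_int (fst a) * of_int (snd c) = (of_int (snd a) * of_int (fst c) :: real)"
    using assms by (simp add: cross_def flip: of_int_mult)
  then show ?thesis
    by (simp add: cross_def minor3_def algebra_simps)
qed

lemma minor3_swap: "minor3 (b, a) q = minor3 (a, b) q"
  by (simp add: minor3_def mult.commute)

lemma sum_inverse_cross_good_le:
  assumes c: "c \<in> good_box X B" and X: "X \<ge> 1" and B: "B \<ge> 1" "1 + ln (2 * X^2) \<le> B"
  shows "(\<Sum>a \<in> good_box X B. 1 / \<bar>real_of_int (cross a c)\<bar>) \<le> 10 * B ^ 3"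
proof -
  have "(\<Sum>a \<in> good_box X B. 1 / \<bar>real_of_int (cross a c)\<bar>) =
      (\<Sum>a \<in> {a \<in> good_box X B. cross a c \<noteq> 0}. 1 / \<bar>real_of_int (cross a c)\<bar>)"
    by (rule sum.mono_neutral_right) auto
  also have "\<dots> \<le> (\<Sum>a \<in> {a \<in> sq_box X. cross a c \<noteq> 0}. 1 / \<bar>real_of_int (cross a c)\<bar>)"
    using good_box_subset[of X B] by (intro sum_mono2) auto
  also have "\<dots> \<le> 10 * B ^ 3" by (rule sum_inverse_cross_le[OF assms])
  finally show ?thesis .
qed

section \<open>A majorant for the sum of all covariances\<close>

abbreviation sum4 :: "'a set \<Rightarrow> ('a \<Rightarrow> 'a \<Rightarrow> 'a \<Rightarrow> 'a \<Rightarrow> real) \<Rightarrow> real" where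
  "sum4 S f \<equiv> (\<Sum>a\<in>S. \<Sum>b\<in>S. \<Sum>c\<in>S. \<Sum>d\<in>S. f a b c d)"

text \<open>The second equation serves the crossed matching, b with c and a with d; exchanging the
  two outer sums reduces it to the first.\<close>

lemma sum4_product:
  fixes f g :: "'a \<Rightarrow> 'a \<Rightarrow> real"
  shows "sum4 S (\<lambda>a b c d. f a c * g b d) = (\<Sum>a\<in>S. \<Sum>c\<in>S. f a c) * (\<Sum>b\<in>S. \<Sum>d\<in>S. g b d)"
    and "sum4 S (\<lambda>a b c d. f b c * g a d) = (\<Sum>a\<in>S. \<Sum>c\<in>S. f a c) * (\<Sum>b\<in>S. \<Sum>d\<in>S. g b d)"
proof -
  show *: "sum4 S (\<lambda>a b c d. f a c * g b d) = (\<Sum>a\<in>S. \<Sum>c\<in>S. f a c) * (\<Sum>b\<in>S. \<Sum>d\<in>S. g b d)"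
    by (simp only: sum_distrib_left[symmetric] sum_distrib_right[symmetric])
  have "sum4 S (\<lambda>a b c d. f b c * g a d) = (\<Sum>b\<in>S. \<Sum>a\<in>S. \<Sum>c\<in>S. \<Sum>d\<in>S. f b c * g a d)"
    by (rule sum.swap)
  then show "sum4 S (\<lambda>a b c d. f b c * g a d) = (\<Sum>a\<in>S. \<Sum>c\<in>S. f a c) * (\<Sum>b\<in>S. \<Sum>d\<in>S. g b d)"
    using * by simp
qed

lemma sum4_cmult:
  fixes k :: real
  shows "sum4 S (\<lambda>a b c d. k * f a b c d) = k * sum4 S (\<lambda>a b c d. f a b c d)"
  by (simp only: sum_distrib_left)

text \<open>The majorant \<open>W\<close> follows the possible matchings. If both factors are
  parallel to their partners, the coefficient vectors are proportional and the trivial bound J1 is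
  used, but such pairs are few. If only one is, \<open>minor3\<close> factors and J2 applies. If
  neither a nor b is parallel to c, then by \<open>minor_identity\<close> the larger minor is at
  least |cross a c| |cross b c| / (3 B^2), and M decides between J2 and J3.\<close>

lemma covariance_sum_le:
  fixes J :: "(int \<times> int) \<times> (int \<times> int) \<Rightarrow> (int \<times> int) \<times> (int \<times> int) \<Rightarrow> real"
  assumes X: "X \<ge> 1" and B: "B \<ge> 1" "1 + ln (2 * X^2) \<le> B"
    and A: "A \<subseteq> good_box X B \<times> good_box X B" and M: "M > 0" and dd: "\<delta> > 0" "\<delta>' > 0" and K: "K \<ge> 0"
    and J1: "\<And>p q. p \<in> A \<Longrightarrow> q \<in> A \<Longrightarrow> \<bar>J p q\<bar> \<le> K * (B^2 / (\<delta> * X^2))"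
    and J2: "\<And>p q m. p \<in> A \<Longrightarrow> q \<in> A \<Longrightarrow> m \<in> {minor2 p q, minor3 p q} \<Longrightarrow> m \<noteq> 0 \<Longrightarrow> \<bar>J p q\<bar> \<le> K * (1 / \<bar>m\<bar>)"
    and J3: "\<And>p q m. p \<in> A \<Longrightarrow> q \<in> A \<Longrightarrow> m \<in> {minor2 p q, minor3 p q} \<Longrightarrow> m \<noteq> 0 \<Longrightarrow> \<bar>J p q\<bar> \<le> K * (\<delta>' * X^2 / m^2)"
  shows "(\<Sum>p\<in>A. \<Sum>q\<in>A. \<bar>J p q\<bar>) \<le> 50000 * K * B ^ 11 * (X^2 / \<delta> + X ^ 3 + M + X ^ 10 * \<delta>' / M^2)"
proof -
  define G where "G = good_box X B"
  define F :: "int \<times> int \<Rightarrow> int \<times> int \<Rightarrow> real" where "F a c = of_bool (cross a c = 0)" for a c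
  \<comment> \<open>\<open>H\<close> vanishes on parallel vectors, since \<open>1 / 0 = 0\<close>.\<close>
  define H where "H a c = 1 / \<bar>real_of_int (cross a c)\<bar>" for a c
  define L :: "int \<times> int \<Rightarrow> int \<times> int \<Rightarrow> int \<times> int \<Rightarrow> int \<times> int \<Rightarrow> real"
    where "L a b c d = of_bool (\<bar>minor2 (a, b) (c, d)\<bar> \<le> M)" for a b c d
  define w0 w1 w2 where "w0 = B^2 / (\<delta> * X^2)" and "w1 = B^2 / X^2" and "w2 = \<delta>' * X^2 / M^2"
  define W where "W a b c d = w0 * (F a c * F b d) + w0 * (F b c * F a d) + w1 * (F a c * H b d)
      + w1 * (F b c * H a d) + 3 * B^2 * (H a c * H b c * L a b c d) + w2" for a b c d
  have pos: "X > 0" "B > 0" using X B by auto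
  have w: "w0 \<ge> 0" "w1 \<ge> 0" "w2 \<ge> 0" using pos dd M by (auto simp: w0_def w1_def w2_def)
  have FH: "F a c \<ge> 0" "H a c \<ge> 0" "L a b c d \<ge> 0" for a b c d by (auto simp: F_def H_def L_def)
  have W0: "W a b c d \<ge> 0" for a b c d unfolding W_def using w FH by simp
  have finG: "finite G" by (simp add: G_def)
  have prod_ge: "X^2 / B^2 \<le> \<bar>real_of_int x * real_of_int y\<bar>"
    if "X / B \<le> \<bar>real_of_int x\<bar>" "X / B \<le> \<bar>real_of_int y\<bar>" for x y
  proof -
    have "0 \<le> X / B" using pos by simp
    with that have "X / B * (X / B) \<le> \<bar>real_of_int x\<bar> * \<bar>real_of_int y\<bar>" by (intro mult_mono) linarith+
    then show ?thesis by (simp add: abs_mult power2_eq_square)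
  qed
  \<comment> \<open>One factor is parallel to its partner: |x| and |fst c| are at least X / B, so
    the minor is at least X^2 / B^2 times the remaining determinant.\<close>
  have deg: "\<bar>J (a, b) (c, d)\<bar> \<le> K * (w1 * H y z)"
    if p: "(a, b) \<in> A" "(c, d) \<in> A" and m: "minor3 (a, b) (c, d) = of_int x * of_int (fst c) * of_int (cross y z)"
      and x: "X / B \<le> \<bar>real_of_int x\<bar>" and yz: "cross y z \<noteq> 0" for a b c d x y z
  proof -
    have cG: "c \<in> good_box X B" using A p by auto
    note gc = good_boxD[OF cG pos]
    have pg: "X^2 / B^2 \<le> \<bar>real_of_int x * real_of_int (fst c)\<bar>" using prod_ge[OF x gc(3)] .
    have XB2: "0 < X^2 / B^2" using pos by simp
    have m0: "minor3 (a, b) (c, d) \<noteq> 0" using m pg XB2 yz by auto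
    have "\<bar>J (a, b) (c, d)\<bar> \<le> K * (1 / \<bar>minor3 (a, b) (c, d)\<bar>)" by (rule J2[OF p _ m0]) simp
    also have "\<dots> = K * (1 / \<bar>real_of_int x * real_of_int (fst c)\<bar> * H y z)"
      by (simp add: m H_def abs_mult)
    also have "\<dots> \<le> K * (1 / (X^2 / B^2) * H y z)"
      using pg XB2 K FH by (intro mult_left_mono mult_right_mono frac_le) auto
    finally show ?thesis by (simp add: w1_def)
  qed
  have pw: "\<bar>J (a, b) (c, d)\<bar> \<le> K * W a b c d" if p: "(a, b) \<in> A" "(c, d) \<in> A" for a b c d
  proof -
    have G: "a \<in> good_box X B" "b \<in> good_box X B" "c \<in> good_box X B" "d \<in> good_box X B" using A p by auto
    note gd = good_boxD[OF G(1) pos] good_boxD[OF G(2) pos] good_boxD[OF G(3) pos] good_boxD[OF G(4) pos]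
    consider "cross a c = 0" "cross b d = 0" | "cross b c = 0" "cross a d = 0"
      | "cross a c = 0" "cross b d \<noteq> 0" | "cross b c = 0" "cross a d \<noteq> 0"
      | "cross a c \<noteq> 0" "cross b c \<noteq> 0" by blast
    then have "\<exists>t. \<bar>J (a, b) (c, d)\<bar> \<le> K * t \<and> t \<le> W a b c d"
    proof cases
      case 1
      have "w0 \<le> W a b c d" unfolding W_def using w FH 1 pos by (simp add: F_def)
      then show ?thesis using J1[OF p] unfolding w0_def by blast
    next
      case 2
      have "w0 \<le> W a b c d" unfolding W_def using w FH 2 pos by (simp add: F_def)
      then show ?thesis using J1[OF p] unfolding w0_def by blast
    next
      case 3
      have "w1 * H b d \<le> W a b c d" unfolding W_def using w FH 3 pos by (simp add: F_def)
      then show ?thesis using deg[OF p minor3_of_cross_0[OF 3(1)] gd(4) 3(2)] by blast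
    next
      case 4
      have "w1 * H a d \<le> W a b c d" unfolding W_def using w FH 4 pos by (simp add: F_def)
      moreover have "minor3 (a, b) (c, d) = of_int (snd b) * of_int (fst c) * of_int (cross a d)"
        using minor3_of_cross_0[OF 4(1), of a d] minor3_swap[of a b] by simp
      ultimately show ?thesis using deg[OF p _ gd(11) 4(2)] by blast
    next
      case 5
      \<comment> \<open>The identity bounds a combination of both minors from below, so only the
        larger one is known to be large; J2 or J3 is applied to it.\<close>
      define m where "m = (if \<bar>minor2 (a, b) (c, d)\<bar> \<ge> \<bar>minor3 (a, b) (c, d)\<bar> then minor2 (a, b) (c, d) else minor3 (a, b) (c, d))"
      have mm: "m \<in> {minor2 (a, b) (c, d), minor3 (a, b) (c, d)}"
        "\<bar>minor2 (a, b) (c, d)\<bar> \<le> \<bar>m\<bar>" "\<bar>minor3 (a, b) (c, d)\<bar> \<le> \<bar>m\<bar>" by (auto simp: m_def)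
      define kl where "kl = \<bar>real_of_int (cross a c)\<bar> * \<bar>real_of_int (cross b c)\<bar>"
      have kl: "kl > 0" using 5 by (simp add: kl_def)
      have t1: "\<bar>of_int (fst c) * of_int (snd c) * minor2 (a, b) (c, d)\<bar> \<le> X * X * \<bar>m\<bar>"
        unfolding abs_mult by (intro mult_mono mult_nonneg_nonneg gd(19) gd(20) mm(2)) (use pos in auto)
      have t2: "\<bar>(of_int (fst c))^2 * minor3 (a, b) (c, d)\<bar> \<le> X * X * \<bar>m\<bar>"
        unfolding abs_mult power2_eq_square by (intro mult_mono mult_nonneg_nonneg gd(19) mm(3)) (use pos in auto)
      have "X^2 / B^2 * kl \<le> \<bar>of_int (fst c) * of_int (fst d)\<bar> * kl"
        using prod_ge[OF gd(17) gd(24)] kl by (intro mult_right_mono) auto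
      also have "\<dots> = \<bar>2 * of_int (fst c) * of_int (snd c) * minor2 (a, b) (c, d) - (of_int (fst c))^2 * minor3 (a, b) (c, d)\<bar>"
        unfolding minor_identity[symmetric] by (simp add: kl_def abs_mult)
      also have "\<dots> \<le> 3 * X^2 * \<bar>m\<bar>" using t1 t2 unfolding power2_eq_square by linarith
      finally have "X^2 * kl \<le> X^2 * (3 * B^2 * \<bar>m\<bar>)" using pos by (simp add: field_simps)
      then have klm: "kl \<le> 3 * B^2 * \<bar>m\<bar>" using pos by simp
      then have m0: "m \<noteq> 0" using kl by auto
      show ?thesis
      proof (cases "\<bar>m\<bar> \<le> M")
        case True
        \<comment> \<open>\<open>minor2\<close> is dominated by \<open>m\<close>, so it is at most M
          as well; the factor \<open>L\<close> keeps this condition, which later limits the choices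
          of \<open>d\<close>.\<close>
        have "1 / \<bar>m\<bar> \<le> 3 * B^2 * (1 / kl)" using klm kl m0 by (simp add: field_simps)
        also have "1 / kl = H a c * H b c * L a b c d" using True mm by (simp add: kl_def H_def L_def)
        also have "3 * B^2 * \<dots> \<le> W a b c d" unfolding W_def using w FH by simp
        finally show ?thesis using J2[OF p mm(1) m0] by blast
      next
        case False
        then have "M^2 \<le> m^2" using M by (simp add: abs_le_square_iff[symmetric])
        then have "\<delta>' * X^2 / m^2 \<le> w2" unfolding w2_def using dd M m0 by (intro divide_left_mono) auto
        also have "w2 \<le> W a b c d" unfolding W_def using w FH by simp
        finally show ?thesis using J3[OF p mm(1) m0] by blast
      qed
    qed
    then show ?thesis using K by (meson mult_left_mono order_trans)
  qed
  have F1: "(\<Sum>a\<in>G. \<Sum>c\<in>G. F a c) \<le> 45 * X^2 * B^2"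
  proof -
    have "(\<Sum>a\<in>G. \<Sum>c\<in>G. F a c) = (\<Sum>c\<in>G. \<Sum>a\<in>G. F a c)" by (rule sum.swap)
    also have "\<dots> \<le> (\<Sum>c\<in>G. 5 * B^2)"
    proof (rule sum_mono)
      fix c assume c: "c \<in> G"
      have "(\<Sum>a\<in>G. F a c) = real (card {a \<in> G. cross a c = 0})"
        unfolding F_def using finG by (simp add: sum.If_cases of_bool_def Int_def)
      also have "card {a \<in> G. cross a c = 0} \<le> card {a \<in> sq_box X. cross a c = 0}"
        unfolding G_def using good_box_subset[of X B] by (intro card_mono) auto
      finally show "(\<Sum>a\<in>G. F a c) \<le> 5 * B^2"
        using card_cross_fibre[OF c[unfolded G_def] X B(1), of 0] by linarith
    qed
    also have "\<dots> = real (card G) * (5 * B^2)" by simp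
    also have "\<dots> \<le> 9 * X^2 * (5 * B^2)" unfolding G_def using card_good_box[OF X] by (intro mult_right_mono) auto
    finally show ?thesis by simp
  qed
  have Hc: "(\<Sum>a\<in>G. H a c) \<le> 10 * B ^ 3" if "c \<in> G" for c
    using sum_inverse_cross_good_le[OF that[unfolded G_def] X B] by (simp add: H_def G_def)
  have H1: "(\<Sum>a\<in>G. \<Sum>c\<in>G. H a c) \<le> 90 * X^2 * B ^ 3"
  proof -
    have "(\<Sum>a\<in>G. \<Sum>c\<in>G. H a c) = (\<Sum>c\<in>G. \<Sum>a\<in>G. H a c)" by (rule sum.swap)
    also have "\<dots> \<le> (\<Sum>c\<in>G. 10 * B ^ 3)" by (intro sum_mono Hc)
    also have "\<dots> = real (card G) * (10 * B ^ 3)" by simp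
    also have "\<dots> \<le> 9 * X^2 * (10 * B ^ 3)" unfolding G_def using card_good_box[OF X] B by (intro mult_right_mono) auto
    finally show ?thesis by simp
  qed
  define D where "D = 3 * X * (4 * M * B ^ 3 / X ^ 3 + 1)"
  have D0: "D \<ge> 0" unfolding D_def using pos M by simp
  \<comment> \<open>For fixed a, b, c at most D vectors d meet the condition on
    \<open>minor2\<close>; for each c the remaining sums over a and b are independent and
    factor.\<close>
  have T5: "sum4 G (\<lambda>a b c d. H a c * H b c * L a b c d) \<le> 900 * X^2 * B ^ 6 * D"
  proof -
    have "sum4 G (\<lambda>a b c d. H a c * H b c * L a b c d) \<le> (\<Sum>a\<in>G. \<Sum>b\<in>G. \<Sum>c\<in>G. H a c * H b c * D)"
    proof (intro sum_mono)
      fix a b c assume abc: "a \<in> G" "b \<in> G" "c \<in> G"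
      have "(\<Sum>d\<in>G. L a b c d) = real (card {d \<in> G. \<bar>minor2 (a, b) (c, d)\<bar> \<le> M})"
        unfolding L_def using finG by (simp add: sum.If_cases of_bool_def Int_def)
      also have "card {d \<in> G. \<bar>minor2 (a, b) (c, d)\<bar> \<le> M} \<le> card {d \<in> sq_box X. \<bar>minor2 (a, b) (c, d)\<bar> \<le> M}"
        unfolding G_def using good_box_subset[of X B] by (intro card_mono) auto
      finally have "(\<Sum>d\<in>G. L a b c d) \<le> D"
        using card_minor2_fibre[OF abc[unfolded G_def] X B(1), of M] M by (simp add: D_def)
      then show "(\<Sum>d\<in>G. H a c * H b c * L a b c d) \<le> H a c * H b c * D"
        unfolding sum_distrib_left[symmetric] using FH by (intro mult_left_mono) auto
    qed
    also have "\<dots> = (\<Sum>a\<in>G. \<Sum>c\<in>G. \<Sum>b\<in>G. H a c * H b c * D)" by (intro sum.cong sum.swap refl)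
    also have "\<dots> = (\<Sum>c\<in>G. \<Sum>a\<in>G. \<Sum>b\<in>G. H a c * H b c * D)" by (rule sum.swap)
    also have "\<dots> = (\<Sum>c\<in>G. (\<Sum>a\<in>G. H a c) * (\<Sum>b\<in>G. H b c) * D)"
      by (simp only: sum_distrib_left[symmetric] sum_distrib_right[symmetric])
    also have "\<dots> \<le> (\<Sum>c\<in>G. (10 * B ^ 3) * (10 * B ^ 3) * D)"
      using D0 FH B by (intro sum_mono mult_right_mono mult_mono Hc) (auto intro: sum_nonneg)
    also have "\<dots> = real (card G) * (100 * B ^ 6 * D)" by (simp add: power_add[symmetric])
    also have "\<dots> \<le> 9 * X^2 * (100 * B ^ 6 * D)"
      unfolding G_def using card_good_box[OF X] B D0 by (intro mult_right_mono) auto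
    finally show ?thesis by simp
  qed
  have T6: "sum4 G (\<lambda>a b c d. w2) \<le> 6561 * X ^ 8 * w2"
  proof -
    have "sum4 G (\<lambda>a b c d. w2) = real (card G) ^ 4 * w2" by (simp add: power4_eq_xxxx)
    also have "\<dots> \<le> (9 * X^2) ^ 4 * w2"
      unfolding G_def using card_good_box[OF X, of B] w by (intro mult_right_mono power_mono) auto
    finally show ?thesis by (simp add: power_mult_distrib power_mult[symmetric])
  qed
  have nn: "0 \<le> (\<Sum>a\<in>G. \<Sum>c\<in>G. F a c)" "0 \<le> (\<Sum>a\<in>G. \<Sum>c\<in>G. H a c)"
    using FH by (auto intro!: sum_nonneg)
  have "(\<Sum>p\<in>A. \<Sum>q\<in>A. \<bar>J p q\<bar>) \<le> (\<Sum>p\<in>A. \<Sum>q\<in>A. K * W (fst p) (snd p) (fst q) (snd q))"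
    by (intro sum_mono) (use pw in auto)
  also have "\<dots> \<le> (\<Sum>p\<in>A. \<Sum>q\<in>G\<times>G. K * W (fst p) (snd p) (fst q) (snd q))"
    using A W0 K finG by (intro sum_mono sum_mono2) (auto simp: G_def)
  also have "\<dots> \<le> (\<Sum>p\<in>G\<times>G. \<Sum>q\<in>G\<times>G. K * W (fst p) (snd p) (fst q) (snd q))"
    using A W0 K finG by (intro sum_mono2) (auto simp: G_def intro: sum_nonneg)
  also have "\<dots> = sum4 G (\<lambda>a b c d. K * W a b c d)"
    by (simp add: sum.cartesian_product' )
  also have "\<dots> = K * sum4 G (\<lambda>a b c d. W a b c d)" by (simp only: sum_distrib_left)
  also have "sum4 G (\<lambda>a b c d. W a b c d) =
     2 * (w0 * ((\<Sum>a\<in>G. \<Sum>c\<in>G. F a c) * (\<Sum>b\<in>G. \<Sum>d\<in>G. F b d)))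
     + 2 * (w1 * ((\<Sum>a\<in>G. \<Sum>c\<in>G. F a c) * (\<Sum>b\<in>G. \<Sum>d\<in>G. H b d)))
     + 3 * B^2 * sum4 G (\<lambda>a b c d. H a c * H b c * L a b c d)
     + sum4 G (\<lambda>a b c d. w2)"
    unfolding W_def sum.distrib sum4_cmult sum4_product by (simp add: algebra_simps)
  also have "\<dots> \<le> 2 * (w0 * ((45 * X^2 * B^2) * (45 * X^2 * B^2))) + 2 * (w1 * ((45 * X^2 * B^2) * (90 * X^2 * B ^ 3)))
     + 3 * B^2 * (900 * X^2 * B ^ 6 * D) + 6561 * X ^ 8 * w2"
    using w F1 H1 nn T5 T6 B by (intro add_mono mult_left_mono mult_mono) auto
  also have "\<dots> = 4050 * B ^ 6 * (X^2 / \<delta>) + 8100 * (B ^ 7 * X^2) + 8100 * B ^ 8 * X ^ 3 + 32400 * B ^ 11 * M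
      + 6561 * (X ^ 10 * \<delta>' / M^2)"
    using pos dd M unfolding w0_def w1_def w2_def D_def by (simp add: field_simps eval_nat_numeral)
  also have "\<dots> \<le> 4050 * B ^ 11 * (X^2 / \<delta>) + 8100 * (B ^ 11 * X ^ 3) + 8100 * B ^ 11 * X ^ 3 + 32400 * B ^ 11 * M
      + 6561 * (B ^ 11 * (X ^ 10 * \<delta>' / M^2))"
  proof -
    have b: "B ^ k \<le> B ^ 11" if "k \<le> 11" for k using B that by (intro power_increasing) auto
    have "B ^ 6 * (X^2 / \<delta>) \<le> B ^ 11 * (X^2 / \<delta>)" using b[of 6] dd by (intro mult_right_mono) auto
    moreover have "B ^ 7 * X^2 \<le> B ^ 11 * X ^ 3"
      using b[of 7] B X by (intro mult_mono power_increasing) auto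
    moreover have "B ^ 8 * X ^ 3 \<le> B ^ 11 * X ^ 3" using b[of 8] pos by (intro mult_right_mono) auto
    moreover have "1 * (X ^ 10 * \<delta>' / M^2) \<le> B ^ 11 * (X ^ 10 * \<delta>' / M^2)"
      using b[of 0] dd pos by (intro mult_right_mono) auto
    ultimately show ?thesis by linarith
  qed
  also have "\<dots> \<le> 50000 * (B ^ 11 * (X^2 / \<delta>)) + 50000 * (B ^ 11 * X ^ 3) + 50000 * (B ^ 11 * M)
      + 50000 * (B ^ 11 * (X ^ 10 * \<delta>' / M^2))"
  proof -
    have "4050 * t1 + 8100 * t2 + 8100 * t2 + 32400 * t3 + 6561 * t4 \<le> 50000 * t1 + 50000 * t2 + 50000 * t3 + 50000 * t4"
      if "0 \<le> t1" "0 \<le> t2" "0 \<le> t3" "0 \<le> t4" for t1 t2 t3 t4 :: real using that by linarith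
    note aux = this
    show ?thesis unfolding mult.assoc by (rule aux) (use pos dd M in simp_all)
  qed
  also have "\<dots> = 50000 * B ^ 11 * (X^2 / \<delta> + X ^ 3 + M + X ^ 10 * \<delta>' / M^2)" by (simp only: distrib_left mult.assoc)
  finally have "(\<Sum>p\<in>A. \<Sum>q\<in>A. \<bar>J p q\<bar>) \<le> K * (50000 * B ^ 11 * (X^2 / \<delta> + X ^ 3 + M + X ^ 10 * \<delta>' / M^2))"
    using K by (simp add: mult_left_mono)
  then show ?thesis by (simp only: mult_ac)
qed


section \<open>Covariances of a mean zero function of linear forms\<close>

text \<open>The difference of two probability densities on [0, d] and [0, d'] for positive scales.
  The covariance bounds exploit that it has mean zero and an L1 norm of at most 2, uniformly in the
  scales.\<close>

definition osc :: "real \<Rightarrow> real \<Rightarrow> real \<Rightarrow> real" where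
  "osc d d' s = indicator {0..d} s / d - indicator {0..d'} s / d'"

lemma osc_measurable [measurable]: "osc d d' \<in> borel_measurable borel"
  unfolding osc_def by measurable

lemma osc_bound: "0 < d \<Longrightarrow> d \<le> d' \<Longrightarrow> \<bar>osc d d' s\<bar> \<le> 1 / d"
  using frac_le[of 1 1 d d'] by (auto simp: osc_def indicator_def)

lemma osc_eq_0: "d \<le> d' \<Longrightarrow> \<not> (0 \<le> s \<and> s \<le> d') \<Longrightarrow> osc d d' s = 0"
  by (auto simp: osc_def indicator_def)

lemma osc_integrable [simp]: "integrable lborel (osc d d')"
  unfolding osc_def
  by (intro Bochner_Integration.integrable_diff integrable_divide_zero integrable_real_indicator)
    (simp_all add: emeasure_lborel_Icc_eq)

lemma osc_integral: "0 < d \<Longrightarrow> 0 < d' \<Longrightarrow> (LBINT s. osc d d' s) = 0"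
  unfolding osc_def
  by (subst Bochner_Integration.integral_diff) (auto intro!: integrable_divide_zero)

lemma osc_abs_nn_integral:
  assumes "0 < d" "0 < d'"
  shows "(\<integral>\<^sup>+s. ennreal \<bar>osc d d' s\<bar> \<partial>lborel) \<le> ennreal 2"
proof -
  have "(\<integral>\<^sup>+s. ennreal \<bar>osc d d' s\<bar> \<partial>lborel)
     \<le> (\<integral>\<^sup>+s. ennreal (1 / d) * indicator {0..d} s + ennreal (1 / d') * indicator {0..d'} s \<partial>lborel)"
  proof (intro nn_integral_mono)
    fix s
    define u u' where "u = 1 / d" and "u' = 1 / d'"
    have u: "u > 0" "u' > 0" using assms by (auto simp: u_def u'_def)
    have "osc d d' s = indicator {0..d} s * u - indicator {0..d'} s * u'"
      by (simp add: osc_def u_def u'_def)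
    then show "ennreal \<bar>osc d d' s\<bar> \<le> ennreal (1 / d) * indicator {0..d} s + ennreal (1 / d') * indicator {0..d'} s"
      unfolding u_def[symmetric] u'_def[symmetric] using u
      by (auto simp: indicator_def simp flip: ennreal_plus intro!: ennreal_leI)
  qed
  also have "\<dots> = ennreal 2"
    using assms by (subst nn_integral_add) (auto simp: nn_integral_cmult simp flip: ennreal_mult ennreal_plus)
  finally show ?thesis .
qed

lemma osc_abs_integral:
  assumes "0 < d" "0 < d'"
  shows "(LBINT s. \<bar>osc d d' s\<bar>) \<le> 2"
  by (rule integral_real_bounded) (use osc_abs_nn_integral[OF assms] in auto)

lemma osc_test_bound:
  assumes d: "0 < d" "d \<le> d'" and k: "k \<ge> 0"
    and \<phi>: "\<And>x. 0 \<le> x \<Longrightarrow> x \<le> d' \<Longrightarrow> \<bar>\<phi> x\<bar> \<le> k"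
  shows "\<bar>LBINT x. osc d d' x * \<phi> x\<bar> \<le> 2 * k"
proof (cases "integrable lborel (\<lambda>x. osc d d' x * \<phi> x)")
  case True
  have "\<bar>LBINT x. osc d d' x * \<phi> x\<bar> \<le> (LBINT x. \<bar>osc d d' x * \<phi> x\<bar>)"
    by (rule integral_abs_bound)
  also have "\<dots> \<le> (LBINT x. \<bar>osc d d' x\<bar> * k)"
  proof (rule integral_mono)
    show "\<bar>osc d d' x * \<phi> x\<bar> \<le> \<bar>osc d d' x\<bar> * k" for x
    proof (cases "0 \<le> x \<and> x \<le> d'")
      case True
      then show ?thesis using \<phi>[of x] by (auto simp: abs_mult intro: mult_left_mono)
    next
      case False
      then show ?thesis using osc_eq_0[OF d(2)] k by simp
    qed
  qed (use True in auto)
  also have "\<dots> \<le> 2 * k" using osc_abs_integral[of d d'] d k by (simp add: mult_right_mono)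
  finally show ?thesis .
\<comment> \<open>A nonintegrable function has integral 0 by convention, so the bound holds
  trivially.\<close>
qed (use k in \<open>simp add: not_integrable_integral_eq\<close>)

text \<open>Substituting x = \<mu> y + h costs the Jacobian 1 / |\<mu>|. For the second bound the
  value of the weight at x = 0 is subtracted, which changes nothing because \<open>osc\<close> has
  mean zero; on the support [0, d'] the Lipschitz condition then gains the factor L d' /
  |\<mu>|.\<close>

lemma osc_affine_test_bound:
  assumes d: "0 < d" "d \<le> d'" and \<mu>: "\<mu> \<noteq> 0" and [measurable]: "\<psi> \<in> borel_measurable borel"
    and bd: "\<And>y. \<bar>\<psi> y\<bar> \<le> 1" and lip: "\<And>y z. \<bar>\<psi> y - \<psi> z\<bar> \<le> L * \<bar>y - z\<bar>"
  shows "\<bar>LBINT y. osc d d' (\<mu> * y + h) * \<psi> y\<bar> \<le> 2 / \<bar>\<mu>\<bar>"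
    and "\<bar>LBINT y. osc d d' (\<mu> * y + h) * \<psi> y\<bar> \<le> 2 / \<bar>\<mu>\<bar> * (L * d' / \<bar>\<mu>\<bar>)"
proof -
  let ?\<phi> = "\<lambda>x. \<psi> (- h / \<mu> + 1 / \<mu> * x)"
  have "(LBINT y. osc d d' (\<mu> * y + h) * \<psi> y)
    = \<bar>1 / \<mu>\<bar> *\<^sub>R (LBINT x. osc d d' (\<mu> * (- h / \<mu> + 1 / \<mu> * x) + h) * ?\<phi> x)"
    by (rule lborel_integral_real_affine) (use \<mu> in simp)
  also have "(\<lambda>x. \<mu> * (- h / \<mu> + 1 / \<mu> * x) + h) = (\<lambda>x. x)" using \<mu> by (auto simp: field_simps)
  then have "(LBINT x. osc d d' (\<mu> * (- h / \<mu> + 1 / \<mu> * x) + h) * ?\<phi> x) = (LBINT x. osc d d' x * ?\<phi> x)"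
    by (metis (no_types, lifting))
  finally have eq: "(LBINT y. osc d d' (\<mu> * y + h) * \<psi> y) = 1 / \<bar>\<mu>\<bar> * (LBINT x. osc d d' x * ?\<phi> x)"
    by simp
  have "\<bar>LBINT x. osc d d' x * ?\<phi> x\<bar> \<le> 2 * 1"
    by (rule osc_test_bound[OF d]) (use bd in auto)
  then show "\<bar>LBINT y. osc d d' (\<mu> * y + h) * \<psi> y\<bar> \<le> 2 / \<bar>\<mu>\<bar>"
    unfolding eq using \<mu> by (simp add: abs_mult divide_right_mono)
  have L0: "L \<ge> 0" using order_trans[OF abs_ge_zero lip[of 1 0]] by simp
  have int: "integrable lborel (\<lambda>x. osc d d' x * ?\<phi> x)"
    by (rule Bochner_Integration.integrable_bound[OF osc_integrable[of d d']])
      (use bd in \<open>auto simp: abs_mult intro!: AE_I2 mult_left_le\<close>)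
  have "(LBINT x. osc d d' x * (?\<phi> x - ?\<phi> 0))
      = (LBINT x. osc d d' x * ?\<phi> x) - (LBINT x. osc d d' x * ?\<phi> 0)"
    unfolding right_diff_distrib by (rule Bochner_Integration.integral_diff) (use int in auto)
  also have "(LBINT x. osc d d' x * ?\<phi> 0) = 0" using osc_integral[of d d'] d by simp
  finally have eq2: "(LBINT x. osc d d' x * ?\<phi> x) = (LBINT x. osc d d' x * (?\<phi> x - ?\<phi> 0))" by simp
  have "\<bar>LBINT x. osc d d' x * ?\<phi> x\<bar> \<le> 2 * (L * d' / \<bar>\<mu>\<bar>)"
    unfolding eq2
  proof (rule osc_test_bound[OF d])
    show "0 \<le> L * d' / \<bar>\<mu>\<bar>" using L0 d by simp
    fix x assume x: "0 \<le> x" "x \<le> d'"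
    have "\<bar>?\<phi> x - ?\<phi> 0\<bar> \<le> L * \<bar>(- h / \<mu> + 1 / \<mu> * x) - (- h / \<mu> + 1 / \<mu> * 0)\<bar>" by (rule lip)
    also have "\<dots> = L * x / \<bar>\<mu>\<bar>" using x by (simp add: abs_mult)
    also have "\<dots> \<le> L * d' / \<bar>\<mu>\<bar>" using x L0 by (intro divide_right_mono mult_left_mono) auto
    finally show "\<bar>?\<phi> x - ?\<phi> 0\<bar> \<le> L * d' / \<bar>\<mu>\<bar>" .
  qed
  then have "1 / \<bar>\<mu>\<bar> * \<bar>LBINT x. osc d d' x * ?\<phi> x\<bar> \<le> 1 / \<bar>\<mu>\<bar> * (2 * (L * d' / \<bar>\<mu>\<bar>))"
    by (rule mult_left_mono) simp
  then show "\<bar>LBINT y. osc d d' (\<mu> * y + h) * \<psi> y\<bar> \<le> 2 / \<bar>\<mu>\<bar> * (L * d' / \<bar>\<mu>\<bar>)"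
    unfolding eq by (simp add: abs_mult)
qed

lemma abs_integral_le_interval:
  fixes G :: "real \<Rightarrow> real"
  assumes "\<And>z. \<bar>G z\<bar> \<le> K" "\<And>z. z \<notin> {a..b} \<Longrightarrow> G z = 0" "a \<le> b"
  shows "\<bar>LBINT z. G z\<bar> \<le> K * (b - a)"
proof (cases "integrable lborel G")
  case True
  have "\<bar>LBINT z. G z\<bar> \<le> (LBINT z. \<bar>G z\<bar>)" by (rule integral_abs_bound)
  also have "\<dots> \<le> (LBINT z. K * indicator {a..b} z)"
  proof (rule integral_mono)
    show "\<bar>G z\<bar> \<le> K * indicator {a..b} z" for z
      using assms(1)[of z] assms(2)[of z] by (cases "z \<in> {a..b}") auto
    show "integrable lborel (\<lambda>z. K * indicator {a..b} z)"
      by (intro integrable_mult_right integrable_real_indicator) (simp_all add: emeasure_lborel_Icc_eq)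
  qed (use True in auto)
  also have "\<dots> = K * (b - a)" using assms(3) by simp
  finally show ?thesis .
next
  case False
  have "K \<ge> 0" using assms(1)[of 0] by linarith
  then show ?thesis using False assms(3) by (simp add: not_integrable_integral_eq)
qed

lemma integrable_bounded_box2:
  fixes g :: "real \<times> real \<Rightarrow> real"
  assumes "g \<in> borel_measurable (lborel \<Otimes>\<^sub>M lborel)" "\<And>p. \<bar>g p\<bar> \<le> K"
    "\<And>p. p \<notin> {a..b} \<times> {a'..b'} \<Longrightarrow> g p = 0"
  shows "integrable (lborel \<Otimes>\<^sub>M lborel) g"
proof (rule integrableI_bounded_set[where A = "{a..b} \<times> {a'..b'}" and B = K])
  show "emeasure (lborel \<Otimes>\<^sub>M lborel) ({a..b} \<times> {a'..b'}) < \<infinity>"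
    by (subst lborel.emeasure_pair_measure_Times) (auto simp: emeasure_lborel_Icc_eq ennreal_mult_less_top)
qed (use assms in auto)

text \<open>Taking the first linear form $s$ as a variable instead of $x$, the second form is, for
  fixed $s$, an affine function of $y$ of slope $m/p_1$; the mean zero property is used only for it.\<close>

lemma osc_plane_bound:
  fixes \<kappa> :: "real \<Rightarrow> real \<Rightarrow> real" and c e :: real
  assumes d: "0 < d" "d \<le> d'" and p1: "p1 \<noteq> 0" and m: "m = p1 * q2 - p2 * q1" "m \<noteq> 0"
    and [measurable]: "case_prod \<kappa> \<in> borel_measurable (borel \<Otimes>\<^sub>M borel)"
    and bd: "\<And>x y. \<bar>\<kappa> x y\<bar> \<le> 1" and supp: "\<And>x y. y \<notin> {a..b} \<Longrightarrow> \<kappa> x y = 0"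
    and lip: "\<And>x y x' y'. \<bar>\<kappa> x y - \<kappa> x' y'\<bar> \<le> L * (\<bar>x - x'\<bar> + \<bar>y - y'\<bar>)"
  defines "I \<equiv> (LBINT y. LBINT x. osc d d' (p1 * x + p2 * y + c) * osc d d' (q1 * x + q2 * y + e) * \<kappa> x y)"
  shows "\<bar>I\<bar> \<le> 4 / \<bar>m\<bar>" "\<bar>I\<bar> \<le> 4 * L * d' * (\<bar>p1\<bar> + \<bar>p2\<bar>) / m^2"
proof -
  define \<mu> where "\<mu> = m / p1"
  define h where "h s = q1 / p1 * (s - c) + e" for s
  define \<psi> where "\<psi> s y = \<kappa> (- (p2 * y + c) / p1 + 1 / p1 * s) y" for s y
  define g where "g y s = osc d d' s * osc d d' (\<mu> * y + h s) * \<psi> s y" for y s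
  have L0: "L \<ge> 0" using order_trans[OF abs_ge_zero lip[of 1 0 0 0]] by simp
  have \<mu>0: "\<mu> \<noteq> 0" using m p1 by (simp add: \<mu>_def)
  have inner: "(LBINT x. osc d d' (p1 * x + p2 * y + c) * osc d d' (q1 * x + q2 * y + e) * \<kappa> x y)
     = 1 / \<bar>p1\<bar> * (LBINT s. g y s)" for y
  proof -
    have "p1 * (- (p2 * y + c) / p1 + 1 / p1 * s) + p2 * y + c = s" for s
      using p1 by (simp add: field_simps)
    moreover have "q1 * (- (p2 * y + c) / p1 + 1 / p1 * s) + q2 * y + e = \<mu> * y + h s" for s
      using p1 by (simp add: field_simps \<mu>_def h_def m)
    ultimately show ?thesis
      using lborel_integral_real_affine[of "1 / p1" "\<lambda>x. osc d d' (p1 * x + p2 * y + c) * osc d d' (q1 * x + q2 * y + e) * \<kappa> x y"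
        "- (p2 * y + c) / p1"] p1
      by (simp add: g_def \<psi>_def)
  qed
  have meas: "case_prod g \<in> borel_measurable (lborel \<Otimes>\<^sub>M lborel)"
  proof -
    have "(\<lambda>p. case_prod \<kappa> ((- (p2 * fst p + c) / p1 + 1 / p1 * snd p), fst p)) \<in> borel_measurable (lborel \<Otimes>\<^sub>M lborel)"
      by measurable
    then show ?thesis unfolding g_def \<psi>_def h_def by (simp add: case_prod_beta')
  qed
  have "integrable (lborel \<Otimes>\<^sub>M lborel) (case_prod g)"
  proof (rule integrable_bounded_box2[OF meas])
    fix q :: "real \<times> real"
    obtain y s where q: "q = (y, s)" by (cases q)
    have "\<bar>g y s\<bar> \<le> (1 / d) * (1 / d) * 1"
      unfolding g_def abs_mult \<psi>_def using d by (intro mult_mono osc_bound bd) auto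
    then show "\<bar>case_prod g q\<bar> \<le> (1 / d) * (1 / d) * 1" by (simp add: q)
    show "case_prod g q = 0" if "q \<notin> {a..b} \<times> {0..d'}"
    proof (cases "y \<in> {a..b}")
      case True
      then show ?thesis using that osc_eq_0[OF d(2), of s] by (auto simp: q g_def)
    next
      case False
      then show ?thesis using supp[of y] by (simp add: q g_def \<psi>_def)
    qed
  qed
  then have "(LBINT y. LBINT s. g y s) = (LBINT s. LBINT y. g y s)"
    by (rule lborel_pair.Fubini_integral[symmetric])
  also have "\<dots> = (LBINT s. osc d d' s * (LBINT y. osc d d' (\<mu> * y + h s) * \<psi> s y))"
    unfolding g_def mult.assoc by simp
  finally have I: "I = 1 / \<bar>p1\<bar> * (LBINT s. osc d d' s * (LBINT y. osc d d' (\<mu> * y + h s) * \<psi> s y))"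
    unfolding I_def inner by simp
  have \<psi>m: "\<psi> s \<in> borel_measurable borel" for s
  proof -
    have "(\<lambda>y. case_prod \<kappa> (- (p2 * y + c) / p1 + 1 / p1 * s, y)) \<in> borel_measurable borel"
      by measurable
    moreover have "\<psi> s = (\<lambda>y. case_prod \<kappa> (- (p2 * y + c) / p1 + 1 / p1 * s, y))" by (auto simp: \<psi>_def)
    ultimately show ?thesis by simp
  qed
  have \<psi>b: "\<bar>\<psi> s y\<bar> \<le> 1" for s y unfolding \<psi>_def by (rule bd)
  \<comment> \<open>At fixed s a change of y moves x by |p2| / |p1| times as much, which explains
    the factor (|p1| + |p2|) / |p1|.\<close>
  have \<psi>l: "\<bar>\<psi> s y - \<psi> s z\<bar> \<le> L * ((\<bar>p1\<bar> + \<bar>p2\<bar>) / \<bar>p1\<bar>) * \<bar>y - z\<bar>" for s y z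
  proof -
    have "\<bar>\<psi> s y - \<psi> s z\<bar> \<le> L * (\<bar>(- (p2 * y + c) / p1 + 1 / p1 * s) - (- (p2 * z + c) / p1 + 1 / p1 * s)\<bar> + \<bar>y - z\<bar>)"
      unfolding \<psi>_def by (rule lip)
    also have "(- (p2 * y + c) / p1 + 1 / p1 * s) - (- (p2 * z + c) / p1 + 1 / p1 * s) = - (p2 / p1 * (y - z))"
      using p1 by (simp add: field_simps)
    also have "\<bar>- (p2 / p1 * (y - z))\<bar> = \<bar>p2\<bar> / \<bar>p1\<bar> * \<bar>y - z\<bar>" by (simp add: abs_mult)
    finally show ?thesis using p1 by (simp add: add_divide_distrib distrib_left distrib_right)
  qed
  have 1: "\<bar>LBINT s. osc d d' s * (LBINT y. osc d d' (\<mu> * y + h s) * \<psi> s y)\<bar> \<le> 2 * (2 / \<bar>\<mu>\<bar>)"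
    by (rule osc_test_bound[OF d _ osc_affine_test_bound(1)[OF d \<mu>0 \<psi>m \<psi>b \<psi>l]]) simp
  have 2: "\<bar>LBINT s. osc d d' s * (LBINT y. osc d d' (\<mu> * y + h s) * \<psi> s y)\<bar>
     \<le> 2 * (2 / \<bar>\<mu>\<bar> * (L * ((\<bar>p1\<bar> + \<bar>p2\<bar>) / \<bar>p1\<bar>) * d' / \<bar>\<mu>\<bar>))"
    by (rule osc_test_bound[OF d _ osc_affine_test_bound(2)[OF d \<mu>0 \<psi>m \<psi>b \<psi>l]]) (use L0 d in simp)
  have "\<bar>I\<bar> \<le> 1 / \<bar>p1\<bar> * (2 * (2 / \<bar>\<mu>\<bar>))" unfolding I abs_mult using mult_left_mono[OF 1, of "1 / \<bar>p1\<bar>"] by simp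
  then show "\<bar>I\<bar> \<le> 4 / \<bar>m\<bar>" using p1 m by (simp add: \<mu>_def)
  have "\<bar>I\<bar> \<le> 1 / \<bar>p1\<bar> * (2 * (2 / \<bar>\<mu>\<bar> * (L * ((\<bar>p1\<bar> + \<bar>p2\<bar>) / \<bar>p1\<bar>) * d' / \<bar>\<mu>\<bar>)))"
    unfolding I abs_mult using mult_left_mono[OF 2, of "1 / \<bar>p1\<bar>"] by simp
  also have "\<dots> = 4 * L * d' * (\<bar>p1\<bar> + \<bar>p2\<bar>) / (\<bar>m\<bar> * \<bar>m\<bar>)"
    using p1 m(2) by (simp add: \<mu>_def field_simps)
  finally show "\<bar>I\<bar> \<le> 4 * L * d' * (\<bar>p1\<bar> + \<bar>p2\<bar>) / m^2" by (simp add: power2_eq_square)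
qed

section \<open>A Lipschitz weight and integration over the three coefficients\<close>

definition tent :: "real \<times> real \<times> real \<Rightarrow> real \<Rightarrow> real \<times> real \<times> real \<Rightarrow> real" where
  "tent c r \<alpha> = max 0 (1 - (\<bar>fst \<alpha> - fst c\<bar> + \<bar>fst (snd \<alpha>) - fst (snd c)\<bar> + \<bar>snd (snd \<alpha>) - snd (snd c)\<bar>) / r)"

lemma tent_continuous: "continuous_on UNIV (tent c r)"
  unfolding tent_def divide_inverse by (intro continuous_intros)

lemma tent_measurable [measurable]: "tent c r \<in> borel_measurable borel"
  by (rule borel_measurable_continuous_onI[OF tent_continuous])

lemma tent_nonneg: "tent c r \<alpha> \<ge> 0" by (simp add: tent_def)

lemma tent_le_1: "r > 0 \<Longrightarrow> tent c r \<alpha> \<le> 1" by (simp add: tent_def)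

lemma abs_tent_le_1: "r > 0 \<Longrightarrow> \<bar>tent c r \<alpha>\<bar> \<le> 1" using tent_nonneg[of c r \<alpha>] tent_le_1[of r c \<alpha>] by simp

lemma tent_support:
  assumes "r > 0" "tent c r (x, y, z) \<noteq> 0"
  shows "x \<in> {fst c - r..fst c + r}" "y \<in> {fst (snd c) - r..fst (snd c) + r}" "z \<in> {snd (snd c) - r..snd (snd c) + r}"
    "(x, y, z) \<in> cball c r"
proof -
  have *: "\<bar>x - fst c\<bar> + \<bar>y - fst (snd c)\<bar> + \<bar>z - snd (snd c)\<bar> < r"
    using assms by (auto simp: tent_def max_def field_simps split: if_splits)
  then show "x \<in> {fst c - r..fst c + r}" "y \<in> {fst (snd c) - r..fst (snd c) + r}" "z \<in> {snd (snd c) - r..snd (snd c) + r}"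
    by auto
  have "norm ((x, y, z) - c) \<le> norm (x - fst c) + norm ((y, z) - snd c)"
    using norm_Pair_le[of "x - fst c" "(y, z) - snd c"] by (simp add: minus_prod_def)
  also have "norm ((y, z) - snd c) \<le> norm (y - fst (snd c)) + norm (z - snd (snd c))"
    using norm_Pair_le[of "y - fst (snd c)" "z - snd (snd c)"] by (simp add: minus_prod_def)
  finally show "(x, y, z) \<in> cball c r" using * by (simp add: dist_norm norm_minus_commute)
qed

lemma tent_lipschitz:
  assumes "r > 0"
  shows "\<bar>tent c r (x, y, z) - tent c r (x', y', z')\<bar> \<le> 1 / r * (\<bar>x - x'\<bar> + \<bar>y - y'\<bar> + \<bar>z - z'\<bar>)"
proof -
  define s s' where "s = \<bar>x - fst c\<bar> + \<bar>y - fst (snd c)\<bar> + \<bar>z - snd (snd c)\<bar>"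
    and "s' = \<bar>x' - fst c\<bar> + \<bar>y' - fst (snd c)\<bar> + \<bar>z' - snd (snd c)\<bar>"
  have "\<bar>s - s'\<bar> \<le> \<bar>x - x'\<bar> + \<bar>y - y'\<bar> + \<bar>z - z'\<bar>" unfolding s_def s'_def by linarith
  then have "\<bar>s - s'\<bar> / r \<le> 1 / r * (\<bar>x - x'\<bar> + \<bar>y - y'\<bar> + \<bar>z - z'\<bar>)"
    using assms by (simp add: divide_right_mono)
  moreover have "\<bar>max 0 (1 - a) - max 0 (1 - b)\<bar> \<le> \<bar>a - b\<bar>" for a b :: real by linarith
  then have "\<bar>tent c r (x, y, z) - tent c r (x', y', z')\<bar> \<le> \<bar>s / r - s' / r\<bar>"
    unfolding tent_def s_def s'_def fst_conv snd_conv .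
  moreover have "\<bar>s / r - s' / r\<bar> = \<bar>s - s'\<bar> / r" using assms by (simp flip: diff_divide_distrib)
  ultimately show ?thesis by linarith
qed

lemma osc_inner_measurable [measurable]: "(\<lambda>\<alpha>. osc d d' (v \<bullet> \<alpha>)) \<in> borel_measurable borel"
  for v :: "real \<times> real \<times> real"
  by (rule measurable_compose[OF _ osc_measurable]) (intro borel_measurable_continuous_onI continuous_intros)

lemma osc_affine_nn_integral:
  assumes "0 < d" "0 < d'" "u \<noteq> 0"
  shows "(\<integral>\<^sup>+x. ennreal \<bar>osc d d' (u * x + k)\<bar> \<partial>lborel) \<le> ennreal (2 / \<bar>u\<bar>)"
proof -
  have "(\<integral>\<^sup>+x. ennreal \<bar>osc d d' (u * x + k)\<bar> \<partial>lborel)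
     = ennreal \<bar>1 / u\<bar> * (\<integral>\<^sup>+x. ennreal \<bar>osc d d' (u * (- k / u + 1 / u * x) + k)\<bar> \<partial>lborel)"
    by (rule nn_integral_real_affine) (use assms in auto)
  also have "(\<lambda>x. u * (- k / u + 1 / u * x) + k) = (\<lambda>x. x)" using assms by (auto simp: field_simps)
  then have "(\<integral>\<^sup>+x. ennreal \<bar>osc d d' (u * (- k / u + 1 / u * x) + k)\<bar> \<partial>lborel) = (\<integral>\<^sup>+x. ennreal \<bar>osc d d' x\<bar> \<partial>lborel)"
    by (metis (no_types, lifting))
  also have "\<dots> \<le> ennreal 2" by (rule osc_abs_nn_integral) (use assms in auto)
  finally have "(\<integral>\<^sup>+x. ennreal \<bar>osc d d' (u * x + k)\<bar> \<partial>lborel) \<le> ennreal \<bar>1 / u\<bar> * ennreal 2"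
    by (simp add: mult_left_mono)
  also have "\<dots> = ennreal (2 / \<bar>u\<bar>)" by (subst ennreal_mult[symmetric]) auto
  finally show ?thesis .
qed

lemma osc_plane_nn_integral:
  assumes d: "0 < d" "0 < d'" and ab: "a' \<le> b'" and u: "u \<noteq> 0"
  shows "(\<integral>\<^sup>+z. \<integral>\<^sup>+y. ennreal \<bar>osc d d' (u * y + (k + w * z))\<bar> * (indicator {a..b} y * indicator {a'..b'} z) \<partial>lborel \<partial>lborel)
    \<le> ennreal (2 / \<bar>u\<bar> * (b' - a'))"
proof -
  have "(\<integral>\<^sup>+z. \<integral>\<^sup>+y. ennreal \<bar>osc d d' (u * y + (k + w * z))\<bar> * (indicator {a..b} y * indicator {a'..b'} z) \<partial>lborel \<partial>lborel)
    \<le> (\<integral>\<^sup>+z. ennreal (2 / \<bar>u\<bar>) * indicator {a'..b'} z \<partial>lborel)"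
  proof (rule nn_integral_mono)
    fix z
    have "(\<integral>\<^sup>+y. ennreal \<bar>osc d d' (u * y + (k + w * z))\<bar> * (indicator {a..b} y * indicator {a'..b'} z) \<partial>lborel)
        \<le> (\<integral>\<^sup>+y. ennreal \<bar>osc d d' (u * y + (k + w * z))\<bar> * indicator {a'..b'} z \<partial>lborel)"
      by (intro nn_integral_mono) (auto simp: indicator_def)
    also have "\<dots> = (\<integral>\<^sup>+y. ennreal \<bar>osc d d' (u * y + (k + w * z))\<bar> \<partial>lborel) * indicator {a'..b'} z"
      by (rule nn_integral_multc) simp
    also have "\<dots> \<le> ennreal (2 / \<bar>u\<bar>) * indicator {a'..b'} z"
      by (intro mult_right_mono osc_affine_nn_integral d u) simp
    finally show "(\<integral>\<^sup>+y. ennreal \<bar>osc d d' (u * y + (k + w * z))\<bar> * (indicator {a..b} y * indicator {a'..b'} z) \<partial>lborel)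
        \<le> ennreal (2 / \<bar>u\<bar>) * indicator {a'..b'} z" .
  qed
  also have "\<dots> = ennreal (2 / \<bar>u\<bar> * (b' - a'))"
    using ab by (subst nn_integral_cmult) (auto simp flip: ennreal_mult)
  finally show ?thesis .
qed

text \<open>The variable with coefficient u is integrated first and gives 2 / |u|; the support of
  the tent leaves two intervals of length 2 r. The first coordinate is a separate case because the
  product space splits as x against (y, z).\<close>

lemma osc_tent_nn_integral:
  fixes v :: "real \<times> real \<times> real"
  assumes d: "0 < d" "0 < d'" and r: "r > 0"
    and u: "u \<in> {fst v, fst (snd v), snd (snd v)}" "u \<noteq> 0"
  shows "(\<integral>\<^sup>+\<alpha>. ennreal (\<bar>osc d d' (v \<bullet> \<alpha>)\<bar> * tent c r \<alpha>) \<partial>lborel) \<le> ennreal (8 * r^2 / \<bar>u\<bar>)"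
proof -
  define X Y Z where "X = {fst c - r..fst c + r}" and "Y = {fst (snd c) - r..fst (snd c) + r}"
    and "Z = {snd (snd c) - r..snd (snd c) + r}"
  obtain v1 v2 v3 where v: "v = (v1, v2, v3)" by (metis prod.exhaust)
  let ?F = "\<lambda>\<alpha>. ennreal (\<bar>osc d d' (v \<bullet> \<alpha>)\<bar> * tent c r \<alpha>)"
  have meas: "?F \<in> borel_measurable (lborel \<Otimes>\<^sub>M lborel)"
    unfolding lborel_prod by measurable
  have bd: "?F (x, y, z) \<le> ennreal \<bar>osc d d' (v1 * x + v2 * y + v3 * z)\<bar> * (indicator X x * indicator (Y \<times> Z) (y, z))" for x y z
  proof (cases "tent c r (x, y, z) = 0")
    case False
    note s = tent_support[OF r False]
    have "\<bar>osc d d' (v \<bullet> (x, y, z))\<bar> * tent c r (x, y, z) \<le> \<bar>osc d d' (v \<bullet> (x, y, z))\<bar>"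
      using tent_le_1[OF r] tent_nonneg by (intro mult_left_le) auto
    then show ?thesis using s by (simp add: X_def Y_def Z_def v inner_prod_def add.assoc ennreal_leI)
  qed simp
  have eq: "(\<integral>\<^sup>+\<alpha>. ?F \<alpha> \<partial>lborel) = integral\<^sup>N (lborel \<Otimes>\<^sub>M lborel) ?F" by (simp add: lborel_prod)
  have ES: "emeasure lborel X = ennreal (2 * r)" "emeasure lborel Y = ennreal (2 * r)" "emeasure lborel Z = ennreal (2 * r)"
    using r by (simp_all add: X_def Y_def Z_def)
  consider "u = v1" | "u = v2 \<or> u = v3" using u by (auto simp: v)
  then show ?thesis
  proof cases
    case 1
    have "(\<integral>\<^sup>+\<alpha>. ?F \<alpha> \<partial>lborel) = (\<integral>\<^sup>+p. \<integral>\<^sup>+x. ?F (x, p) \<partial>lborel \<partial>lborel)"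
      unfolding eq by (rule lborel_pair.nn_integral_snd[symmetric, OF meas])
    also have "\<dots> \<le> (\<integral>\<^sup>+p. ennreal (2 / \<bar>u\<bar>) * indicator (Y \<times> Z) p \<partial>lborel)"
    proof (rule nn_integral_mono)
      fix p :: "real \<times> real"
      obtain y z where p: "p = (y, z)" by (cases p)
      have "(\<integral>\<^sup>+x. ?F (x, p) \<partial>lborel) \<le> (\<integral>\<^sup>+x. ennreal \<bar>osc d d' (v1 * x + (v2 * y + v3 * z))\<bar> * indicator (Y \<times> Z) p \<partial>lborel)"
        using order_trans[OF bd[of _ y z]] by (intro nn_integral_mono) (auto simp: p indicator_def add.assoc)
      also have "\<dots> = (\<integral>\<^sup>+x. ennreal \<bar>osc d d' (v1 * x + (v2 * y + v3 * z))\<bar> \<partial>lborel) * indicator (Y \<times> Z) p"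
        by (rule nn_integral_multc) simp
      also have "\<dots> \<le> ennreal (2 / \<bar>u\<bar>) * indicator (Y \<times> Z) p"
        using osc_affine_nn_integral[OF d u(2)] 1 by (intro mult_right_mono) auto
      finally show "(\<integral>\<^sup>+x. ?F (x, p) \<partial>lborel) \<le> ennreal (2 / \<bar>u\<bar>) * indicator (Y \<times> Z) p" .
    qed
    also have "\<dots> = ennreal (2 / \<bar>u\<bar>) * emeasure lborel (Y \<times> Z)"
      by (rule nn_integral_cmult_indicator) (simp add: Y_def Z_def borel_Times)
    also have "emeasure lborel (Y \<times> Z) = ennreal (2 * r) * ennreal (2 * r)"
      unfolding lborel_prod[symmetric] by (subst lborel.emeasure_pair_measure_Times) (simp_all add: ES, simp_all add: Y_def Z_def)
    also have "ennreal (2 / \<bar>u\<bar>) * (ennreal (2 * r) * ennreal (2 * r)) = ennreal (8 * r^2 / \<bar>u\<bar>)"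
      using r by (simp add: power2_eq_square flip: ennreal_mult)
    finally show ?thesis .
  next
    case 2
    let ?f = "\<lambda>x p. ennreal \<bar>osc d d' (v1 * x + v2 * fst p + v3 * snd p)\<bar> * indicator (Y \<times> Z) p"
    have m: "?f x \<in> borel_measurable (lborel \<Otimes>\<^sub>M lborel)" for x unfolding Y_def Z_def by measurable
    have pl: "(\<integral>\<^sup>+p. ?f x p \<partial>lborel) \<le> ennreal (2 / \<bar>u\<bar> * (2 * r))" for x
    proof -
      have ind: "indicator (Y \<times> Z) (y, z) = (indicator Y y * indicator Z z :: ennreal)" for y z
        by (simp add: indicator_def)
      from 2 show ?thesis
      proof
        assume uv: "u = v2"
        have "(\<integral>\<^sup>+p. ?f x p \<partial>lborel) = (\<integral>\<^sup>+z. \<integral>\<^sup>+y. ?f x (y, z) \<partial>lborel \<partial>lborel)"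
          using lborel_pair.nn_integral_snd[OF m[of x]] by (simp add: lborel_prod)
        also have "\<dots> = (\<integral>\<^sup>+z. \<integral>\<^sup>+y. ennreal \<bar>osc d d' (v2 * y + (v1 * x + v3 * z))\<bar> * (indicator Y y * indicator Z z) \<partial>lborel \<partial>lborel)"
          by (simp only: ind fst_conv snd_conv add_ac)
        also have "\<dots> \<le> ennreal (2 / \<bar>v2\<bar> * (snd (snd c) + r - (snd (snd c) - r)))"
          unfolding Y_def Z_def by (rule osc_plane_nn_integral[OF d]) (use r u(2) uv in auto)
        finally show ?thesis by (simp add: uv)
      next
        assume uv: "u = v3"
        have "(\<integral>\<^sup>+p. ?f x p \<partial>lborel) = (\<integral>\<^sup>+y. \<integral>\<^sup>+z. ?f x (y, z) \<partial>lborel \<partial>lborel)"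
          using lborel.nn_integral_fst[OF m[of x]] by (simp add: lborel_prod)
        also have "\<dots> = (\<integral>\<^sup>+y. \<integral>\<^sup>+z. ennreal \<bar>osc d d' (v3 * z + (v1 * x + v2 * y))\<bar> * (indicator Z z * indicator Y y) \<partial>lborel \<partial>lborel)"
          by (simp only: ind fst_conv snd_conv add_ac mult_ac)
        also have "\<dots> \<le> ennreal (2 / \<bar>v3\<bar> * (fst (snd c) + r - (fst (snd c) - r)))"
          unfolding Y_def Z_def by (rule osc_plane_nn_integral[OF d]) (use r u(2) uv in auto)
        finally show ?thesis by (simp add: uv)
      qed
    qed
    have "(\<integral>\<^sup>+\<alpha>. ?F \<alpha> \<partial>lborel) = (\<integral>\<^sup>+x. \<integral>\<^sup>+p. ?F (x, p) \<partial>lborel \<partial>lborel)"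
      unfolding eq by (rule lborel.nn_integral_fst[symmetric, OF meas])
    also have "\<dots> \<le> (\<integral>\<^sup>+x. ennreal (2 / \<bar>u\<bar> * (2 * r)) * indicator X x \<partial>lborel)"
    proof (rule nn_integral_mono)
      fix x
      have "(\<integral>\<^sup>+p. ?F (x, p) \<partial>lborel)
          \<le> (\<integral>\<^sup>+p. ?f x p * indicator X x \<partial>lborel)"
      proof (rule nn_integral_mono)
        fix p :: "real \<times> real"
        show "?F (x, p) \<le> ?f x p * indicator X x"
          using bd[of x "fst p" "snd p"] by (simp only: prod.collapse mult_ac)
      qed
      also have "\<dots> = (\<integral>\<^sup>+p. ?f x p \<partial>lborel) * indicator X x"
        by (rule nn_integral_multc) (use m[of x] in \<open>simp add: lborel_prod\<close>)
      also have "\<dots> \<le> ennreal (2 / \<bar>u\<bar> * (2 * r)) * indicator X x" by (intro mult_right_mono pl) simp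
      finally show "(\<integral>\<^sup>+p. ?F (x, p) \<partial>lborel) \<le> ennreal (2 / \<bar>u\<bar> * (2 * r)) * indicator X x" .
    qed
    also have "\<dots> = ennreal (2 / \<bar>u\<bar> * (2 * r)) * emeasure lborel X"
      by (rule nn_integral_cmult_indicator) (simp add: X_def)
    also have "\<dots> = ennreal (8 * r^2 / \<bar>u\<bar>)"
      unfolding ES using r by (simp add: power2_eq_square flip: ennreal_mult)
    finally show ?thesis .
  qed
qed

lemma integrable_tent:
  fixes g :: "real \<times> real \<times> real \<Rightarrow> real"
  assumes [measurable]: "g \<in> borel_measurable borel" and r: "r > 0" and K: "\<And>\<alpha>. \<bar>g \<alpha>\<bar> \<le> K"
  shows "integrable lborel (\<lambda>\<alpha>. g \<alpha> * tent c r \<alpha>)"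
proof (rule integrableI_bounded_set[where A = "cball c r" and B = K])
  show "emeasure lborel (cball c r) < \<infinity>" by (rule emeasure_bounded_finite) simp
  have "\<bar>g \<alpha>\<bar> * \<bar>tent c r \<alpha>\<bar> \<le> K * 1" for \<alpha>
    using K abs_tent_le_1[OF r] order_trans[OF abs_ge_zero K] by (intro mult_mono) auto
  then show "AE \<alpha> in lborel. \<alpha> \<in> cball c r \<longrightarrow> norm (g \<alpha> * tent c r \<alpha>) \<le> K" by (simp add: abs_mult)
  show "AE \<alpha> in lborel. \<alpha> \<notin> cball c r \<longrightarrow> g \<alpha> * tent c r \<alpha> = 0"
  proof (intro AE_I2 impI)
    fix \<alpha> assume "\<alpha> \<notin> cball c r"
    then have "tent c r \<alpha> = 0" using tent_support(4)[OF r, of c "fst \<alpha>" "fst (snd \<alpha>)" "snd (snd \<alpha>)"] by auto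
    then show "g \<alpha> * tent c r \<alpha> = 0" by simp
  qed
qed auto

lemma osc_tent_integral:
  fixes v :: "real \<times> real \<times> real"
  assumes d: "0 < d" "0 < d'" and r: "r > 0"
    and u: "u \<in> {fst v, fst (snd v), snd (snd v)}" "u \<noteq> 0"
  shows "(LBINT \<alpha>. \<bar>osc d d' (v \<bullet> \<alpha>)\<bar> * tent c r \<alpha>) \<le> 8 * r^2 / \<bar>u\<bar>"
  by (rule integral_real_bounded[OF _ osc_tent_nn_integral[OF assms]]) simp

text \<open>In both orders the innermost variable is x, which \<open>osc_plane_bound\<close>
  eliminates; the middle one is y or z according to the minor in use.\<close>

lemma lborel_integral3:
  fixes g :: "real \<times> real \<times> real \<Rightarrow> real"
  assumes "integrable lborel g"
  shows "(LBINT \<alpha>. g \<alpha>) = (LBINT z. LBINT y. LBINT x. g (x, y, z))"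
    and "(LBINT \<alpha>. g \<alpha>) = (LBINT y. LBINT z. LBINT x. g (x, y, z))"
proof -
  define h where "h y z = (LBINT x. g (x, y, z))" for y z
  have 1: "integrable (lborel \<Otimes>\<^sub>M lborel) (case_prod (\<lambda>x p. g (x, p)))" using assms by (simp add: lborel_prod)
  have 2: "(LBINT \<alpha>. g \<alpha>) = (LBINT p. LBINT x. g (x, p))"
    using lborel_pair.integral_snd[OF 1] by (simp add: lborel_prod)
  have "integrable lborel (\<lambda>p. LBINT x. g (x, p))" using lborel_pair.integrable_snd[OF 1] by simp
  then have 3: "integrable (lborel \<Otimes>\<^sub>M lborel) (case_prod h)"
    by (simp add: lborel_prod h_def case_prod_beta')
  have 4: "(LBINT \<alpha>. g \<alpha>) = integral\<^sup>L (lborel \<Otimes>\<^sub>M lborel) (case_prod h)"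
    unfolding 2 by (simp add: lborel_prod h_def case_prod_beta')
  show "(LBINT \<alpha>. g \<alpha>) = (LBINT z. LBINT y. LBINT x. g (x, y, z))"
    using lborel_pair.integral_snd[OF 3] 4 by (simp add: h_def)
  show "(LBINT \<alpha>. g \<alpha>) = (LBINT y. LBINT z. LBINT x. g (x, y, z))"
    using lborel_pair.integral_fst'[OF 3] 4 by (simp add: h_def)
qed

text \<open>For the first bound one factor is replaced by its maximum 1 / d and the other is
  integrated. For the others the coordinate of \<alpha> outside the minor is frozen,
  \<open>osc_plane_bound\<close> is applied with Lipschitz constant 1 / r, and the support of the
  tent adds a factor 2 r.\<close>

lemma osc_covariance_bound:
  fixes v w c :: "real \<times> real \<times> real"
  assumes d: "0 < d" "d \<le> d'" and r: "r > 0"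
  defines "J \<equiv> (LBINT \<alpha>. osc d d' (v \<bullet> \<alpha>) * osc d d' (w \<bullet> \<alpha>) * tent c r \<alpha>)"
  shows "u \<in> {fst v, fst (snd v), snd (snd v)} \<Longrightarrow> u \<noteq> 0 \<Longrightarrow> \<bar>J\<bar> \<le> 8 * r^2 / (d * \<bar>u\<bar>)"
    and "fst v \<noteq> 0 \<Longrightarrow> (u, z) \<in> {(fst (snd v), fst (snd w)), (snd (snd v), snd (snd w))} \<Longrightarrow>
      m = fst v * z - u * fst w \<Longrightarrow> m \<noteq> 0 \<Longrightarrow> \<bar>J\<bar> \<le> 8 * r / \<bar>m\<bar> \<and> \<bar>J\<bar> \<le> 8 * d' * (\<bar>fst v\<bar> + \<bar>u\<bar>) / m^2"
proof -
  have oo: "\<bar>osc d d' s * osc d d' t\<bar> \<le> (1 / d) * (1 / d)" for s t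
    unfolding abs_mult using d by (intro mult_mono osc_bound) auto
  have int: "integrable lborel (\<lambda>\<alpha>. osc d d' (v \<bullet> \<alpha>) * osc d d' (w \<bullet> \<alpha>) * tent c r \<alpha>)"
    by (rule integrable_tent[OF _ r oo]) measurable
  show "\<bar>J\<bar> \<le> 8 * r^2 / (d * \<bar>u\<bar>)" if u: "u \<in> {fst v, fst (snd v), snd (snd v)}" "u \<noteq> 0"
  proof -
    have "\<bar>J\<bar> \<le> (LBINT \<alpha>. \<bar>osc d d' (v \<bullet> \<alpha>) * osc d d' (w \<bullet> \<alpha>) * tent c r \<alpha>\<bar>)"
      unfolding J_def by (rule integral_abs_bound)
    also have "\<dots> \<le> (LBINT \<alpha>. 1 / d * (\<bar>osc d d' (v \<bullet> \<alpha>)\<bar> * tent c r \<alpha>))"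
    proof (rule integral_mono)
      show "integrable lborel (\<lambda>\<alpha>. 1 / d * (\<bar>osc d d' (v \<bullet> \<alpha>)\<bar> * tent c r \<alpha>))"
        by (intro integrable_mult_right integrable_tent[OF _ r, of _ "1 / d"]) (use osc_bound[OF d] in auto)
      fix \<alpha>
      have "\<bar>osc d d' (w \<bullet> \<alpha>)\<bar> * (\<bar>osc d d' (v \<bullet> \<alpha>)\<bar> * tent c r \<alpha>) \<le> 1 / d * (\<bar>osc d d' (v \<bullet> \<alpha>)\<bar> * tent c r \<alpha>)"
        using osc_bound[OF d] tent_nonneg by (intro mult_right_mono) auto
      then show "\<bar>osc d d' (v \<bullet> \<alpha>) * osc d d' (w \<bullet> \<alpha>) * tent c r \<alpha>\<bar> \<le> 1 / d * (\<bar>osc d d' (v \<bullet> \<alpha>)\<bar> * tent c r \<alpha>)"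
        using tent_nonneg[of c r \<alpha>] by (simp add: abs_mult mult_ac)
    qed (use int in auto)
    also have "\<dots> = 1 / d * (LBINT \<alpha>. \<bar>osc d d' (v \<bullet> \<alpha>)\<bar> * tent c r \<alpha>)" by (rule integral_mult_right_zero)
    also have "\<dots> \<le> 1 / d * (8 * r^2 / \<bar>u\<bar>)"
      using osc_tent_integral[OF d(1) less_le_trans[OF d] r u] d by (intro mult_left_mono) auto
    finally show ?thesis by simp
  qed
  obtain v1 v2 v3 w1 w2 w3 where vw: "v = (v1, v2, v3)" "w = (w1, w2, w3)" by (metis prod.exhaust)
  have wrap: "\<bar>J\<bar> \<le> 8 * r / \<bar>m\<bar> \<and> \<bar>J\<bar> \<le> 8 * d' * (\<bar>v1\<bar> + \<bar>u\<bar>) / m^2"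
    if J: "J = (LBINT t. I t)" and v1: "v1 \<noteq> 0" and m: "m = v1 * z - u * w1" "m \<noteq> 0"
      and I: "\<And>t. I t = (LBINT y. LBINT x. osc d d' (v1 * x + u * y + u' * t) * osc d d' (w1 * x + z * y + z' * t) * K t x y)"
      and Km: "\<And>t. case_prod (K t) \<in> borel_measurable (borel \<Otimes>\<^sub>M borel)"
      and K1: "\<And>t x y. \<bar>K t x y\<bar> \<le> 1"
      and K2: "\<And>t x y. y \<notin> {a - r..a + r} \<Longrightarrow> K t x y = 0"
      and K3: "\<And>t x y. t \<notin> {b - r..b + r} \<Longrightarrow> K t x y = 0"
      and K4: "\<And>t x y x' y'. \<bar>K t x y - K t x' y'\<bar> \<le> 1 / r * (\<bar>x - x'\<bar> + \<bar>y - y'\<bar>)"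
    for I u z u' z' K a b
  proof -
    have B: "\<bar>I t\<bar> \<le> 4 / \<bar>m\<bar>" "\<bar>I t\<bar> \<le> 4 * (1 / r) * d' * (\<bar>v1\<bar> + \<bar>u\<bar>) / m^2" for t
      unfolding I using osc_plane_bound[OF d v1 m Km K1 K2 K4] by blast+
    have Z: "I t = 0" if "t \<notin> {b - r..b + r}" for t unfolding I K3[OF that] by simp
    have "\<bar>J\<bar> \<le> 4 / \<bar>m\<bar> * (b + r - (b - r))"
      unfolding J by (rule abs_integral_le_interval[OF B(1) Z]) (use r in auto)
    moreover have "\<bar>J\<bar> \<le> 4 * (1 / r) * d' * (\<bar>v1\<bar> + \<bar>u\<bar>) / m^2 * (b + r - (b - r))"
      unfolding J by (rule abs_integral_le_interval[OF B(2) Z]) (use r in auto)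
    ultimately show ?thesis using r by simp
  qed
  have cont1: "continuous_on UNIV (\<lambda>p. tent c r (fst p, snd p, t))" for t
    by (rule continuous_on_compose2[OF tent_continuous]) (intro continuous_intros, simp)
  have cont2: "continuous_on UNIV (\<lambda>p. tent c r (fst p, t, snd p))" for t
    by (rule continuous_on_compose2[OF tent_continuous]) (intro continuous_intros, simp)
  have Km: "case_prod (\<lambda>x y. tent c r (x, y, t)) \<in> borel_measurable (borel \<Otimes>\<^sub>M borel)"
    "case_prod (\<lambda>x y. tent c r (x, t, y)) \<in> borel_measurable (borel \<Otimes>\<^sub>M borel)" for t
    using borel_measurable_continuous_onI[OF cont1[of t]] borel_measurable_continuous_onI[OF cont2[of t]]
    by (simp_all add: borel_prod case_prod_beta')
  show "\<bar>J\<bar> \<le> 8 * r / \<bar>m\<bar> \<and> \<bar>J\<bar> \<le> 8 * d' * (\<bar>fst v\<bar> + \<bar>u\<bar>) / m^2"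
    if v0: "fst v \<noteq> 0" and uz: "(u, z) \<in> {(fst (snd v), fst (snd w)), (snd (snd v), snd (snd w))}"
      and m: "m = fst v * z - u * fst w" "m \<noteq> 0"
  proof -
    from uz consider "u = v2" "z = w2" | "u = v3" "z = w3" by (auto simp: vw)
    then show ?thesis
    proof cases
      case 1
      have "\<bar>J\<bar> \<le> 8 * r / \<bar>m\<bar> \<and> \<bar>J\<bar> \<le> 8 * d' * (\<bar>v1\<bar> + \<bar>v2\<bar>) / m^2"
      proof (rule wrap[where z = w2 and u' = v3 and z' = w3 and K = "\<lambda>t x y. tent c r (x, y, t)"
            and a = "fst (snd c)" and b = "snd (snd c)"])
        show "J = (LBINT t. (LBINT y. LBINT x. osc d d' (v1 * x + v2 * y + v3 * t) * osc d d' (w1 * x + w2 * y + w3 * t) * tent c r (x, y, t)))"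
          unfolding J_def lborel_integral3(1)[OF int] by (simp add: vw inner_prod_def add.assoc)
        show "\<bar>tent c r (x, y, t) - tent c r (x', y', t)\<bar> \<le> 1 / r * (\<bar>x - x'\<bar> + \<bar>y - y'\<bar>)" for x y x' y' t
          using tent_lipschitz[OF r, of c x y t x' y' t] by simp
        show "tent c r (x, y, t) = 0" if "y \<notin> {fst (snd c) - r..fst (snd c) + r}" for t x y
          using tent_support(2)[OF r] that by blast
        show "tent c r (x, y, t) = 0" if "t \<notin> {snd (snd c) - r..snd (snd c) + r}" for t x y
          using tent_support(3)[OF r] that by blast
        show "case_prod (\<lambda>x y. tent c r (x, y, t)) \<in> borel_measurable (borel \<Otimes>\<^sub>M borel)" for t by (rule Km)
        show "\<bar>tent c r (x, y, t)\<bar> \<le> 1" for x y t by (rule abs_tent_le_1[OF r])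
      qed (use v0 m 1 in \<open>auto simp: vw\<close>)
      then show ?thesis using 1 by (simp add: vw)
    next
      case 2
      have "\<bar>J\<bar> \<le> 8 * r / \<bar>m\<bar> \<and> \<bar>J\<bar> \<le> 8 * d' * (\<bar>v1\<bar> + \<bar>v3\<bar>) / m^2"
      proof (rule wrap[where z = w3 and u' = v2 and z' = w2 and K = "\<lambda>t x y. tent c r (x, t, y)"
            and a = "snd (snd c)" and b = "fst (snd c)"])
        show "J = (LBINT t. (LBINT y. LBINT x. osc d d' (v1 * x + v3 * y + v2 * t) * osc d d' (w1 * x + w3 * y + w2 * t) * tent c r (x, t, y)))"
          unfolding J_def lborel_integral3(2)[OF int] by (simp add: vw inner_prod_def add_ac)
        show "\<bar>tent c r (x, t, y) - tent c r (x', t, y')\<bar> \<le> 1 / r * (\<bar>x - x'\<bar> + \<bar>y - y'\<bar>)" for x y x' y' t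
          using tent_lipschitz[OF r, of c x t y x' t y'] by simp
        show "tent c r (x, t, y) = 0" if "y \<notin> {snd (snd c) - r..snd (snd c) + r}" for t x y
          using tent_support(3)[OF r] that by blast
        show "tent c r (x, t, y) = 0" if "t \<notin> {fst (snd c) - r..fst (snd c) + r}" for t x y
          using tent_support(2)[OF r] that by blast
        show "case_prod (\<lambda>x y. tent c r (x, t, y)) \<in> borel_measurable (borel \<Otimes>\<^sub>M borel)" for t by (rule Km)
        show "\<bar>tent c r (x, t, y)\<bar> \<le> 1" for x y t by (rule abs_tent_le_1[OF r])
      qed (use v0 m 2 in \<open>auto simp: vw\<close>)
      then show ?thesis using 2 by (simp add: vw)
    qed
  qed
qed

section \<open>The second moment over good vectors\<close>

definition coefs :: "(int \<times> int) \<times> (int \<times> int) \<Rightarrow> real \<times> real \<times> real" where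
  "coefs p = (coef1 p, coef2 p, coef3 p)"

lemma abs_coef_le:
  assumes "a \<in> sq_box X" "b \<in> sq_box X"
  shows "\<bar>coef1 (a, b)\<bar> \<le> X^2" "\<bar>coef2 (a, b)\<bar> \<le> X^2" "\<bar>coef3 (a, b)\<bar> \<le> X^2"
proof -
  have ab: "\<bar>real_of_int (fst a)\<bar> \<le> X" "\<bar>real_of_int (snd a)\<bar> \<le> X" "\<bar>real_of_int (fst b)\<bar> \<le> X" "\<bar>real_of_int (snd b)\<bar> \<le> X"
    using assms by (auto simp: sq_box_def)
  have *: "\<bar>s * t\<bar> \<le> X^2" if "\<bar>s\<bar> \<le> X" "\<bar>t\<bar> \<le> X" for s t :: real
    unfolding abs_mult power2_eq_square using that by (intro mult_mono) auto
  show "\<bar>coef1 (a, b)\<bar> \<le> X^2" "\<bar>coef3 (a, b)\<bar> \<le> X^2" using * ab by simp_all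
  show "\<bar>coef2 (a, b)\<bar> \<le> X^2" using *[OF ab(1) ab(4)] *[OF ab(2) ab(3)] by simp
qed

lemma good_second_moment:
  assumes X: "X \<ge> 1" and B: "B \<ge> 1" "1 + ln (2 * X^2) \<le> B"
    and A: "A \<subseteq> good_box X B \<times> good_box X B" and M: "M > 0" and d: "0 < d" "d \<le> d'" and r: "r > 0"
  shows "(LBINT \<alpha>. (\<Sum>p\<in>A. osc d d' (coefs p \<bullet> \<alpha>))^2 * tent c r \<alpha>)
    \<le> 50000 * (16 + 8 * r + 8 * r^2) * B ^ 11 * (X^2 / d + X ^ 3 + M + X ^ 10 * d' / M^2)"
proof -
  define J where "J p q = (LBINT \<alpha>. osc d d' (coefs p \<bullet> \<alpha>) * osc d d' (coefs q \<bullet> \<alpha>) * tent c r \<alpha>)" for p q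
  \<comment> \<open>One constant above 8 r^2, 8 r and 16; the last arises from 8 (|coef1 p| + |u|)
    <= 16 X^2.\<close>
  define K where "K = 16 + 8 * r + 8 * r^2"
  have d': "d' > 0" using d by simp
  have pos: "X > 0" "B > 0" using X B by auto
  have finA: "finite A" by (rule finite_subset[OF A]) simp
  have oo: "\<bar>osc d d' s * osc d d' t\<bar> \<le> (1 / d) * (1 / d)" for s t
    unfolding abs_mult using d by (intro mult_mono osc_bound) auto
  have int: "integrable lborel (\<lambda>\<alpha>. osc d d' (coefs p \<bullet> \<alpha>) * osc d d' (coefs q \<bullet> \<alpha>) * tent c r \<alpha>)" for p q
    by (rule integrable_tent[OF _ r oo]) measurable
  have "(LBINT \<alpha>. (\<Sum>p\<in>A. osc d d' (coefs p \<bullet> \<alpha>))^2 * tent c r \<alpha>)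
      = (LBINT \<alpha>. (\<Sum>p\<in>A. \<Sum>q\<in>A. osc d d' (coefs p \<bullet> \<alpha>) * osc d d' (coefs q \<bullet> \<alpha>) * tent c r \<alpha>))"
    by (simp only: power2_eq_square sum_product) (simp only: sum_distrib_right)
  also have "\<dots> = (\<Sum>p\<in>A. \<Sum>q\<in>A. J p q)"
    unfolding J_def using int by (simp add: Bochner_Integration.integral_sum)
  also have "\<dots> \<le> (\<Sum>p\<in>A. \<Sum>q\<in>A. \<bar>J p q\<bar>)" by (intro sum_mono) simp
  also have "\<dots> \<le> 50000 * K * B ^ 11 * (X^2 / d + X ^ 3 + M + X ^ 10 * d' / M^2)"
  proof (rule covariance_sum_le[OF X B A M d(1) d'])
    show "K \<ge> 0" using r by (simp add: K_def)
    have K: "16 \<le> K" "8 * r \<le> K" "8 * r^2 \<le> K" using r by (auto simp: K_def)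
    have c1: "X^2 / B^2 \<le> \<bar>coef1 p\<bar>" "0 < X^2 / B^2" if p: "p \<in> A" for p
    proof -
      obtain a b where ab: "p = (a, b)" "a \<in> good_box X B" "b \<in> good_box X B" using A p by auto
      have "0 \<le> X / B" using pos by simp
      then have "X / B * (X / B) \<le> \<bar>real_of_int (fst a)\<bar> * \<bar>real_of_int (fst b)\<bar>"
        using good_boxD(3)[OF ab(2) pos] good_boxD(3)[OF ab(3) pos] by (intro mult_mono) linarith+
      then show "X^2 / B^2 \<le> \<bar>coef1 p\<bar>" by (simp add: ab abs_mult power2_eq_square)
      show "0 < X^2 / B^2" using pos by simp
    qed
    show "\<bar>J p q\<bar> \<le> K * (B^2 / (d * X^2))" if pq: "p \<in> A" "q \<in> A" for p q
    proof -
      have "\<bar>J p q\<bar> \<le> 8 * r^2 / (d * \<bar>coef1 p\<bar>)"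
        unfolding J_def using c1[OF pq(1)] by (intro osc_covariance_bound(1)[OF d r]) (auto simp: coefs_def)
      also have "\<dots> \<le> K / (d * (X^2 / B^2))"
        using K c1[OF pq(1)] d r by (intro frac_le mult_left_mono mult_pos_pos) auto
      finally show ?thesis by simp
    qed
    fix p q m assume pq: "p \<in> A" "q \<in> A" and m: "m \<in> {minor2 p q, minor3 p q}" "m \<noteq> 0"
    obtain u z where uz: "(u, z) \<in> {(coef2 p, coef2 q), (coef3 p, coef3 q)}" "m = coef1 p * z - u * coef1 q"
      using m by (auto simp: minor2_def minor3_def)
    have "coef1 p \<noteq> 0" using c1[OF pq(1)] by auto
    then have b: "\<bar>J p q\<bar> \<le> 8 * r / \<bar>m\<bar> \<and> \<bar>J p q\<bar> \<le> 8 * d' * (\<bar>coef1 p\<bar> + \<bar>u\<bar>) / m^2"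
      unfolding J_def using osc_covariance_bound(2)[OF d r, of "coefs p" u z "coefs q" m c] uz m
      by (simp add: coefs_def)
    have "8 * r / \<bar>m\<bar> \<le> K * (1 / \<bar>m\<bar>)" using K by (simp add: divide_right_mono)
    with b show "\<bar>J p q\<bar> \<le> K * (1 / \<bar>m\<bar>)" by linarith
    have "p \<in> sq_box X \<times> sq_box X" using A pq good_box_subset by blast
    then have "\<bar>coef1 p\<bar> \<le> X^2" "\<bar>u\<bar> \<le> X^2" using abs_coef_le uz by (cases p, auto)+
    then have "8 * d' * (\<bar>coef1 p\<bar> + \<bar>u\<bar>) / m^2 \<le> 8 * d' * (X^2 + X^2) / m^2"
      using d' by (intro divide_right_mono mult_left_mono) auto
    also have "\<dots> = 16 * (d' * X^2 / m^2)" by simp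
    also have "\<dots> \<le> K * (d' * X^2 / m^2)" using K d' by (intro mult_right_mono) auto
    finally show "\<bar>J p q\<bar> \<le> K * (d' * X^2 / m^2)" using b by linarith
  qed
  finally show ?thesis by (simp add: K_def)
qed


section \<open>Removing degenerate vectors\<close>

definition sup_norm :: "int \<times> int \<Rightarrow> int" where
  "sup_norm a = max \<bar>fst a\<bar> \<bar>snd a\<bar>"

lemma sup_norm_pos: "a \<noteq> (0, 0) \<Longrightarrow> sup_norm a \<ge> 1"
  by (cases a) (auto simp: sup_norm_def)

lemma card_sup_norm_eq:
  assumes "k \<ge> 1"
  shows "finite {a. sup_norm a = k}" "real (card {a. sup_norm a = k}) \<le> 12 * of_int k"
proof -
  have sub: "{a. sup_norm a = k} \<subseteq> {-k, k} \<times> {-k..k} \<union> {-k..k} \<times> {-k, k}" (is "_ \<subseteq> ?A \<union> ?B")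
  proof
    fix a assume "a \<in> {a. sup_norm a = k}"
    then show "a \<in> ?A \<union> ?B"
      by (cases a) (auto simp: sup_norm_def max_def split: if_splits)
  qed
  then show "finite {a. sup_norm a = k}" by (rule finite_subset) auto
  have "card {a. sup_norm a = k} \<le> card (?A \<union> ?B)" by (rule card_mono[OF _ sub]) auto
  also have "\<dots> \<le> card ?A + card ?B" by (rule card_Un_le)
  also have "\<dots> = 4 * nat (2 * k + 1)" using assms by (simp add: card_cartesian_product)
  finally have "real (card {a. sup_norm a = k}) \<le> real (4 * nat (2 * k + 1))" by (simp only: of_nat_le_iff)
  also have "\<dots> \<le> 12 * of_int k" using assms by simp
  finally show "real (card {a. sup_norm a = k}) \<le> 12 * of_int k" .
qed

text \<open>The square of radius k carries at most 12 k vectors, so each integer level k <= X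
  contributes at most 12.\<close>

lemma sum_inverse_sup_norm_le:
  assumes S: "finite S" "\<And>a. a \<in> S \<Longrightarrow> a \<noteq> (0, 0) \<and> of_int (sup_norm a) \<le> X" and X: "X \<ge> 0"
  shows "(\<Sum>a\<in>S. 1 / real_of_int (sup_norm a)) \<le> 12 * X"
proof -
  have "(\<Sum>a\<in>S. 1 / real_of_int (sup_norm a)) = (\<Sum>k\<in>{1..\<lfloor>X\<rfloor>}. \<Sum>a\<in>{a\<in>S. sup_norm a = k}. 1 / real_of_int (sup_norm a))"
    using S sup_norm_pos by (intro sum.group[symmetric]) (auto simp: le_floor_iff)
  also have "\<dots> \<le> (\<Sum>k\<in>{1..\<lfloor>X\<rfloor>}. 12)"
  proof (rule sum_mono)
    fix k assume k: "k \<in> {1..\<lfloor>X\<rfloor>}"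
    have "(\<Sum>a\<in>{a\<in>S. sup_norm a = k}. 1 / real_of_int (sup_norm a)) = real (card {a\<in>S. sup_norm a = k}) * (1 / of_int k)"
      by simp
    also have "\<dots> \<le> (12 * of_int k) * (1 / of_int k)"
    proof (rule mult_right_mono)
      have "card {a\<in>S. sup_norm a = k} \<le> card {a. sup_norm a = k}"
        using k card_sup_norm_eq(1)[of k] by (intro card_mono) auto
      then show "real (card {a\<in>S. sup_norm a = k}) \<le> 12 * of_int k"
        using k card_sup_norm_eq(2)[of k] by simp
    qed (use k in auto)
    finally show "(\<Sum>a\<in>{a\<in>S. sup_norm a = k}. 1 / real_of_int (sup_norm a)) \<le> 12" using k by simp
  qed
  also have "\<dots> \<le> 12 * X" using X by (simp add: of_nat_nat of_int_floor_le)
  finally show ?thesis .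
qed

text \<open>Serves sparse sets: vectors of norm at most Z are bounded as if all of them were
  present, and each of the others costs at most 1 / Z.\<close>

lemma sum_inverse_sup_norm_split:
  assumes S: "finite S" "\<And>a. a \<in> S \<Longrightarrow> a \<noteq> (0, 0)" and Z: "Z > 0" and N: "real (card S) \<le> N"
  shows "(\<Sum>a\<in>S. 1 / real_of_int (sup_norm a)) \<le> 12 * Z + N / Z"
proof -
  let ?S1 = "{a\<in>S. of_int (sup_norm a) \<le> Z}" and ?S2 = "{a\<in>S. \<not> of_int (sup_norm a) \<le> Z}"
  have "S = ?S1 \<union> ?S2" by auto
  then have "(\<Sum>a\<in>S. 1 / real_of_int (sup_norm a)) = (\<Sum>a\<in>?S1 \<union> ?S2. 1 / real_of_int (sup_norm a))" by simp
  also have "\<dots> = (\<Sum>a\<in>?S1. 1 / real_of_int (sup_norm a)) + (\<Sum>a\<in>?S2. 1 / real_of_int (sup_norm a))"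
    by (rule sum.union_disjoint) (use S in auto)
  also have "(\<Sum>a\<in>?S1. 1 / real_of_int (sup_norm a)) \<le> 12 * Z"
    by (rule sum_inverse_sup_norm_le) (use S Z in auto)
  also have "(\<Sum>a\<in>?S2. 1 / real_of_int (sup_norm a)) \<le> (\<Sum>a\<in>?S2. 1 / Z)"
    using Z by (intro sum_mono frac_le) auto
  also have "\<dots> = real (card ?S2) * (1 / Z)" by simp
  also have "\<dots> \<le> N * (1 / Z)"
  proof (rule mult_right_mono)
    have "card ?S2 \<le> card S" using S by (intro card_mono) auto
    then show "real (card ?S2) \<le> N" using N by linarith
  qed (use Z in simp)
  finally show ?thesis by simp
qed

text \<open>Telescopes after 1 / (k + 1)^2 <= 1 / k - 1 / (k + 1).\<close>

lemma sum_inverse_squares_le: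
  "n \<ge> 1 \<Longrightarrow> (\<Sum>g\<in>{n<..N}. 1 / (real g)^2) \<le> 1 / real n"
proof -
  assume n: "n \<ge> 1"
  have "(\<Sum>g\<in>{n<..n + k}. 1 / (real g)^2) \<le> 1 / real n - 1 / real (n + k)" for k
  proof (induction k)
    case (Suc k)
    have "{n<..n + Suc k} = insert (Suc (n + k)) {n<..n + k}" by auto
    then have "(\<Sum>g\<in>{n<..n + Suc k}. 1 / (real g)^2) = 1 / (real (Suc (n + k)))^2 + (\<Sum>g\<in>{n<..n + k}. 1 / (real g)^2)" by simp
    also have "1 / (real (Suc (n + k)))^2 \<le> 1 / (real (n + k) * real (Suc (n + k)))"
      using n unfolding power2_eq_square by (intro frac_le mult_right_mono mult_pos_pos) auto
    also have "\<dots> = 1 / real (n + k) - 1 / real (n + Suc k)" using n by (simp add: field_simps)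
    finally show ?case using Suc by linarith
  qed simp
  from this[of "N - n"] show ?thesis
    using n by (cases "n \<le> N") (auto intro: order_trans)
qed

lemma card_strip:
  assumes X: "X \<ge> 1" and B: "1 \<le> B" "B \<le> X"
  shows "real (card {a \<in> sq_box X. \<bar>of_int (fst a)\<bar> < X / B}) \<le> 9 * X^2 / B"
    "real (card {a \<in> sq_box X. \<bar>of_int (snd a)\<bar> < X / B}) \<le> 9 * X^2 / B"
proof -
  let ?I = "{n::int. \<bar>of_int n\<bar> \<le> X / B}" and ?K = "{n::int. \<bar>of_int n\<bar> \<le> X}"
  have XB: "X / B \<ge> 1" using X B by simp
  have I: "finite ?I" "real (card ?I) \<le> 3 * X / B"
    using int_abs_le[of "X / B"] XB by auto
  have K: "finite ?K" "real (card ?K) \<le> 3 * X"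
    using int_abs_le[of X] X by auto
  have "card {a \<in> sq_box X. \<bar>of_int (fst a)\<bar> < X / B} \<le> card (?I \<times> ?K)"
    using I K by (intro card_mono) (auto simp: sq_box_def)
  moreover have "card {a \<in> sq_box X. \<bar>of_int (snd a)\<bar> < X / B} \<le> card (?K \<times> ?I)"
    using I K by (intro card_mono) (auto simp: sq_box_def)
  moreover have "real (card ?I) * real (card ?K) \<le> (3 * X / B) * (3 * X)"
    using I K X B by (intro mult_mono) auto
  ultimately show "real (card {a \<in> sq_box X. \<bar>of_int (fst a)\<bar> < X / B}) \<le> 9 * X^2 / B"
    "real (card {a \<in> sq_box X. \<bar>of_int (snd a)\<bar> < X / B}) \<le> 9 * X^2 / B"
    by (simp_all add: card_cartesian_product power2_eq_square mult.commute flip: of_nat_mult)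
qed

text \<open>Union bound over the gcd g: the box contains at most (3 X / g)^2 vectors divisible by g,
  and the sum of 1 / g^2 beyond the floor of B is at most 2 / B. A nonzero vector of the box has g
  <= X, which makes the union finite.\<close>

lemma card_large_gcd:
  assumes X: "X \<ge> 1" and B: "1 \<le> B"
  shows "real (card {a \<in> sq_box X. a \<noteq> (0, 0) \<and> of_int (gcd (fst a) (snd a)) > B}) \<le> 18 * X^2 / B"
proof -
  define n N where "n = nat \<lfloor>B\<rfloor>" and "N = nat \<lfloor>X\<rfloor>"
  have "\<lfloor>B\<rfloor> \<ge> 1" using B by (simp add: le_floor_iff)
  then have n1: "n \<ge> 1" "real n = real_of_int \<lfloor>B\<rfloor>" using B by (auto simp: n_def le_nat_iff le_floor_iff)
  moreover have "B < real_of_int \<lfloor>B\<rfloor> + 1" by linarith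
  ultimately have n: "n \<ge> 1" "B / 2 \<le> real n" by linarith+
  define T where "T g = {a \<in> sq_box X. int g dvd fst a \<and> int g dvd snd a}" for g
  have cardT: "real (card (T g)) \<le> 9 * X^2 * (1 / (real g)^2)" if g: "g \<in> {n<..N}" for g
  proof -
    have g0: "g > 0" "real g \<le> X" using g X by (auto simp: N_def le_nat_iff le_floor_iff)
    let ?I = "{n::int. \<bar>of_int n\<bar> \<le> X / real g}"
    have "T g \<subseteq> (\<lambda>(s, t). (int g * s, int g * t)) ` (?I \<times> ?I)"
    proof
      fix a assume a: "a \<in> T g"
      then obtain s t where st: "fst a = int g * s" "snd a = int g * t" by (auto simp: T_def dvd_def)
      have "\<bar>real_of_int s\<bar> \<le> X / real g" "\<bar>real_of_int t\<bar> \<le> X / real g"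
        using a st g0 by (auto simp: T_def sq_box_def abs_mult field_simps)
      then show "a \<in> (\<lambda>(s, t). (int g * s, int g * t)) ` (?I \<times> ?I)"
        using st by (intro image_eqI[where x = "(s, t)"]) (auto simp: prod_eq_iff)
    qed
    moreover have fin: "finite ?I" using g0 X by (intro int_abs_le) auto
    ultimately have "card (T g) \<le> card (?I \<times> ?I)" using surj_card_le[of "?I \<times> ?I" "T g"] by auto
    also have "\<dots> = card ?I * card ?I" by (rule card_cartesian_product)
    finally have "real (card (T g)) \<le> real (card ?I) * real (card ?I)" by (metis of_nat_le_iff of_nat_mult)
    also have "\<dots> \<le> (3 * X / real g) * (3 * X / real g)"
    proof -
      have "real (card ?I) \<le> 2 * (X / real g) + 1" using g0 X by (intro int_abs_le) auto
      also have "\<dots> \<le> 3 * X / real g" using g0 by (simp add: field_simps)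
      finally show ?thesis using X by (intro mult_mono) auto
    qed
    finally show ?thesis by (simp add: power2_eq_square)
  qed
  have "{a \<in> sq_box X. a \<noteq> (0, 0) \<and> of_int (gcd (fst a) (snd a)) > B} \<subseteq> (\<Union>g\<in>{n<..N}. T g)"
  proof
    fix a assume a: "a \<in> {a \<in> sq_box X. a \<noteq> (0, 0) \<and> of_int (gcd (fst a) (snd a)) > B}"
    define g where "g = nat (gcd (fst a) (snd a))"
    have g: "int g = gcd (fst a) (snd a)" by (simp add: g_def)
    have "real n \<le> B" using B by (simp add: n_def)
    then have "real n < real_of_int (int g)" using a g by auto
    then have "n < g" by simp
    moreover have "real g \<le> X"
    proof -
      obtain x where x: "x \<noteq> 0" "x = fst a \<or> x = snd a" using a by (cases a) auto
      have "int g \<le> \<bar>x\<bar>" using x g by (auto intro!: zdvd_imp_le simp: dvd_abs_iff)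
      then have "real g \<le> real_of_int \<bar>x\<bar>" by linarith
      also have "\<dots> \<le> X" using x a by (auto simp: sq_box_def)
      finally show ?thesis .
    qed
    then have "g \<le> N" using X by (simp add: N_def le_nat_iff le_floor_iff)
    moreover have "a \<in> T g" using a g by (auto simp: T_def)
    ultimately show "a \<in> (\<Union>g\<in>{n<..N}. T g)" by auto
  qed
  then have "card {a \<in> sq_box X. a \<noteq> (0, 0) \<and> of_int (gcd (fst a) (snd a)) > B} \<le> card (\<Union>g\<in>{n<..N}. T g)"
    by (rule card_mono[rotated]) (auto simp: T_def)
  also have "\<dots> \<le> (\<Sum>g\<in>{n<..N}. card (T g))" by (rule card_UN_le) simp
  finally have "real (card {a \<in> sq_box X. a \<noteq> (0, 0) \<and> of_int (gcd (fst a) (snd a)) > B}) \<le> real (\<Sum>g\<in>{n<..N}. card (T g))"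
    by (rule of_nat_mono)
  also have "\<dots> = (\<Sum>g\<in>{n<..N}. real (card (T g)))" by (rule of_nat_sum)
  also have "\<dots> \<le> (\<Sum>g\<in>{n<..N}. 9 * X^2 * (1 / (real g)^2))" by (intro sum_mono cardT)
  also have "\<dots> = 9 * X^2 * (\<Sum>g\<in>{n<..N}. 1 / (real g)^2)" by (simp only: sum_distrib_left)
  also have "\<dots> \<le> 9 * X^2 * (1 / real n)" by (intro mult_left_mono sum_inverse_squares_le n) simp
  also have "\<dots> \<le> 9 * X^2 * (2 / B)"
  proof -
    have "1 / real n \<le> 1 / (B / 2)" using n B by (intro frac_le) auto
    then show ?thesis by (intro mult_left_mono) auto
  qed
  finally show ?thesis by simp
qed

lemma card_not_good:
  assumes X: "X \<ge> 1" and B: "1 \<le> B" "B \<le> X"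
  shows "real (card (sq_box X - {(0, 0)} - good_box X B)) \<le> 36 * X^2 / B"
proof -
  let ?A = "{a \<in> sq_box X. \<bar>of_int (fst a)\<bar> < X / B}" and ?B = "{a \<in> sq_box X. \<bar>of_int (snd a)\<bar> < X / B}"
    and ?C = "{a \<in> sq_box X. a \<noteq> (0, 0) \<and> of_int (gcd (fst a) (snd a)) > B}"
  have "sq_box X - {(0, 0)} - good_box X B \<subseteq> ?A \<union> (?B \<union> ?C)" by (auto simp: good_box_def)
  then have "card (sq_box X - {(0, 0)} - good_box X B) \<le> card (?A \<union> (?B \<union> ?C))" by (rule card_mono[rotated]) auto
  also have "\<dots> \<le> card ?A + (card ?B + card ?C)" by (meson card_Un_le add_left_mono order_trans)
  finally have "real (card (sq_box X - {(0, 0)} - good_box X B)) \<le> real (card ?A) + (real (card ?B) + real (card ?C))"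
    by linarith
  also have "\<dots> \<le> 9 * X^2 / B + (9 * X^2 / B + 18 * X^2 / B)"
    by (intro add_mono card_strip[OF X B] card_large_gcd[OF X B(1)])
  finally show ?thesis by simp
qed

text \<open>If x z and y w are both below t |x w|, then |y z| <= t^2 |x w|, so the middle term is at
  least (1 - t^2) / 2 times |x w|. This exceeds t |x w| for t < sqrt 2 - 1, and 3/8 is such a
  t.\<close>

lemma max_abs_product_coeffs:
  fixes x y z w :: real
  shows "3 / 8 * \<bar>x * w\<bar> \<le> \<bar>x * z\<bar> \<or> 3 / 8 * \<bar>x * w\<bar> \<le> \<bar>y * w\<bar> \<or> 3 / 8 * \<bar>x * w\<bar> \<le> \<bar>(x * w + y * z) / 2\<bar>"
proof (rule ccontr)
  assume "\<not> ?thesis"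
  then have n0: "\<bar>x * z\<bar> < 3 / 8 * \<bar>x * w\<bar>" "\<bar>y * w\<bar> < 3 / 8 * \<bar>x * w\<bar>" "\<bar>(x * w + y * z) / 2\<bar> < 3 / 8 * \<bar>x * w\<bar>"
    by (simp_all only: de_Morgan_disj not_le)
  note n = n0(1)[unfolded abs_mult] n0(2)[unfolded abs_mult] n0(3)
  have xw: "\<bar>x\<bar> > 0" "\<bar>w\<bar> > 0" using n0(1) by auto
  have "\<bar>z\<bar> \<le> 3 / 8 * \<bar>w\<bar>" "\<bar>y\<bar> \<le> 3 / 8 * \<bar>x\<bar>"
    using n(1,2) xw by (auto simp: field_simps dest!: mult_left_less_imp_less intro!: less_imp_le)
  then have "\<bar>y\<bar> * \<bar>z\<bar> \<le> (3 / 8 * \<bar>x\<bar>) * (3 / 8 * \<bar>w\<bar>)" by (intro mult_mono) auto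
  then have "\<bar>y * z\<bar> \<le> 9 / 64 * \<bar>x * w\<bar>" by (simp add: abs_mult)
  moreover have "\<bar>x * w\<bar> > 0" using xw by (simp add: abs_mult)
  moreover have False if "\<bar>q\<bar> \<le> 9 / 64 * \<bar>p\<bar>" "\<bar>p\<bar> > 0" "\<bar>(p + q) / 2\<bar> < 3 / 8 * \<bar>p\<bar>" for p q :: real
    using that by (auto simp: abs_if split: if_splits)
  ultimately show False using n(3) by blast
qed

text \<open>Over all vectors, not only the good ones, some coordinate of the coefficient vector has
  to be comparable to the product of the norms.\<close>

lemma ex_large_coef:
  "\<exists>u \<in> {coef1 (a, b), coef2 (a, b), coef3 (a, b)}. 3 / 8 * (of_int (sup_norm a) * of_int (sup_norm b)) \<le> \<bar>u\<bar>"
proof -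
  obtain a1 a2 b1 b2 where ab: "a = (a1, a2)" "b = (b1, b2)" by (cases a, cases b)
  consider "\<bar>a1\<bar> \<ge> \<bar>a2\<bar>" "\<bar>b1\<bar> \<ge> \<bar>b2\<bar>" | "\<bar>a2\<bar> \<ge> \<bar>a1\<bar>" "\<bar>b2\<bar> \<ge> \<bar>b1\<bar>"
    | "\<bar>a1\<bar> \<ge> \<bar>a2\<bar>" "\<bar>b2\<bar> \<ge> \<bar>b1\<bar>" | "\<bar>a2\<bar> \<ge> \<bar>a1\<bar>" "\<bar>b1\<bar> \<ge> \<bar>b2\<bar>" by linarith
  then show ?thesis
  proof cases
    case 1
    then have "sup_norm a = \<bar>a1\<bar>" "sup_norm b = \<bar>b1\<bar>" by (auto simp: sup_norm_def ab)
    then show ?thesis by (simp add: ab abs_mult)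
  next
    case 2
    then have "sup_norm a = \<bar>a2\<bar>" "sup_norm b = \<bar>b2\<bar>" by (auto simp: sup_norm_def ab)
    then show ?thesis by (simp add: ab abs_mult)
  next
    case 3
    then have "sup_norm a = \<bar>a1\<bar>" "sup_norm b = \<bar>b2\<bar>" by (auto simp: sup_norm_def ab)
    then show ?thesis using max_abs_product_coeffs[of "of_int a1" "of_int b2" "of_int b1" "of_int a2"]
      by (simp add: ab abs_mult) argo
  next
    case 4
    then have "sup_norm a = \<bar>a2\<bar>" "sup_norm b = \<bar>b1\<bar>" by (auto simp: sup_norm_def ab)
    then show ?thesis using max_abs_product_coeffs[of "of_int b1" "of_int a2" "of_int a1" "of_int b2"]
      by (simp add: ab abs_mult mult.commute add.commute) argo
  qed
qed

text \<open>A first moment suffices because one of the two vectors is not good and lies in the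
  sparse set \<open>U\<close>. By \<open>ex_large_coef\<close> each integral is O(r^2) over the
  product of the norms, so the double sum factors, and \<open>U\<close> contributes X / \<beta>^2 in
  place of X.\<close>

lemma bad_first_moment:
  assumes X: "X \<ge> 1" and \<beta>: "\<beta> \<ge> 1" "\<beta> ^ 4 \<le> X"
    and A: "A \<subseteq> (sq_box X - {(0, 0)}) \<times> (sq_box X - {(0, 0)}) - good_box X (\<beta> ^ 4) \<times> good_box X (\<beta> ^ 4)"
    and d: "0 < d" "0 < d'" and r: "r > 0"
  shows "(\<Sum>p\<in>A. LBINT \<alpha>. \<bar>osc d d' (coefs p \<bullet> \<alpha>)\<bar> * tent c r \<alpha>) \<le> 24576 * r^2 * X^2 / \<beta>^2"
proof -
  define S where "S = sq_box X - {(0, 0)}"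
  define U where "U = S - good_box X (\<beta> ^ 4)"
  define f where "f a = 1 / real_of_int (sup_norm a)" for a
  have fin: "finite S" "finite U" by (auto simp: S_def U_def)
  have f0: "f a \<ge> 0" for a by (auto simp: f_def sup_norm_def)
  have B1: "1 \<le> \<beta> ^ 4" using \<beta> by simp
  have sS: "sum f S \<le> 12 * X"
    unfolding f_def using X fin
    by (intro sum_inverse_sup_norm_le) (auto simp: S_def sq_box_def sup_norm_def)
  have sU: "sum f U \<le> 48 * X / \<beta>^2"
  proof -
    \<comment> \<open>At most 36 X^2 / \<beta>^4 vectors are not good, so the cut Z = X / \<beta>^2
      balances the two parts.\<close>
    have "sum f U \<le> 12 * (X / \<beta>^2) + (36 * X^2 / \<beta> ^ 4) / (X / \<beta>^2)"
      unfolding f_def using card_not_good[OF X B1 \<beta>(2)] X \<beta> fin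
      by (intro sum_inverse_sup_norm_split) (auto simp: U_def S_def)
    also have "\<dots> = 48 * X / \<beta>^2" using X \<beta> by (simp add: field_simps eval_nat_numeral)
    finally show ?thesis .
  qed
  have each: "(LBINT \<alpha>. \<bar>osc d d' (coefs p \<bullet> \<alpha>)\<bar> * tent c r \<alpha>) \<le> 64 / 3 * r^2 * (f (fst p) * f (snd p))"
    if p: "p \<in> A" for p
  proof -
    obtain a b where ab: "p = (a, b)" "a \<noteq> (0, 0)" "b \<noteq> (0, 0)" using p A by (cases p) auto
    define n where "n = real_of_int (sup_norm a) * real_of_int (sup_norm b)"
    have n: "n > 0" unfolding n_def using sup_norm_pos[OF ab(2)] sup_norm_pos[OF ab(3)] by simp
    obtain u where u: "u \<in> {coef1 p, coef2 p, coef3 p}" "3 / 8 * n \<le> \<bar>u\<bar>"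
      using ex_large_coef[of a b] unfolding ab n_def by blast
    have "u \<noteq> 0" using u n by auto
    then have "(LBINT \<alpha>. \<bar>osc d d' (coefs p \<bullet> \<alpha>)\<bar> * tent c r \<alpha>) \<le> 8 * r^2 / \<bar>u\<bar>"
      using u(1) by (intro osc_tent_integral[OF d r]) (auto simp: coefs_def)
    also have "\<dots> \<le> 8 * r^2 / (3 / 8 * n)" using u n by (intro divide_left_mono mult_pos_pos) auto
    also have "\<dots> = 64 / 3 * r^2 * (f (fst p) * f (snd p))" by (simp add: ab f_def n_def)
    finally show ?thesis .
  qed
  have sub: "A \<subseteq> U \<times> S \<union> S \<times> U" using A by (auto simp: U_def S_def)
  have "(\<Sum>p\<in>A. LBINT \<alpha>. \<bar>osc d d' (coefs p \<bullet> \<alpha>)\<bar> * tent c r \<alpha>)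
      \<le> (\<Sum>p\<in>A. 64 / 3 * r^2 * (f (fst p) * f (snd p)))" by (intro sum_mono each)
  also have "\<dots> \<le> (\<Sum>p\<in>U \<times> S \<union> S \<times> U. 64 / 3 * r^2 * (f (fst p) * f (snd p)))"
    using fin f0 sub by (intro sum_mono2) auto
  also have "\<dots> \<le> (\<Sum>p\<in>U \<times> S. 64 / 3 * r^2 * (f (fst p) * f (snd p))) + (\<Sum>p\<in>S \<times> U. 64 / 3 * r^2 * (f (fst p) * f (snd p)))"
    using fin f0 by (subst sum.union_inter[symmetric]) (auto intro!: sum_nonneg)
  also have "\<dots> = 128 / 3 * r^2 * (sum f U * sum f S)"
  proof -
    have "(\<Sum>p\<in>P \<times> Q. 64 / 3 * r^2 * (f (fst p) * f (snd p))) = 64 / 3 * r^2 * (sum f P * sum f Q)" for P Q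
      by (simp only: sum_product sum.cartesian_product' fst_conv snd_conv) (simp only: sum_distrib_left)
    then show ?thesis by (simp add: mult.commute)
  qed
  also have "\<dots> \<le> 128 / 3 * r^2 * ((48 * X / \<beta>^2) * (12 * X))"
    using f0 X by (intro mult_left_mono mult_mono sU sS) (auto intro: sum_nonneg)
  also have "\<dots> = 24576 * r^2 * X^2 / \<beta>^2" by (simp add: power2_eq_square)
  finally show ?thesis .
qed

text \<open>First summand: Markov's inequality for the pairs that are not good, with 49152 = 2 *
  24576. Second: Chebyshev's inequality for the good pairs, with 100000 = 2 * 50000 and \<beta>^46 =
  \<beta>^2 (\<beta>^4)^11, where \<beta>^2 stems from the threshold X^2 / \<beta> and B =
  \<beta>^4. The factors 2 arise because the tent is only known to be at least 1/2 on the
  event.\<close>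

definition deviation_bound :: "real \<Rightarrow> real \<Rightarrow> real \<Rightarrow> real \<Rightarrow> real \<Rightarrow> real \<Rightarrow> real" where
  "deviation_bound r \<beta> X M d d' = 49152 * r^2 / \<beta> +
     100000 * (16 + 8 * r + 8 * r^2) * \<beta> ^ 46 * (X^2 / d + X ^ 3 + M + X ^ 10 * d' / M^2) / X ^ 4"

lemma osc_sum_deviation:
  fixes c :: "real \<times> real \<times> real"
  assumes X: "X \<ge> 1" and \<beta>: "\<beta> \<ge> 1" "\<beta> ^ 4 \<le> X" "1 + ln (2 * X^2) \<le> \<beta> ^ 4"
    and A: "A \<subseteq> (sq_box X - {(0, 0)}) \<times> (sq_box X - {(0, 0)})" and M: "M > 0"
    and d: "0 < d" "d \<le> d'" and r: "r > 0"
  defines "E \<equiv> {\<alpha>. tent c r \<alpha> \<ge> 1 / 2 \<and> \<bar>\<Sum>p\<in>A. osc d d' (coefs p \<bullet> \<alpha>)\<bar> > 2 * X^2 / \<beta>}"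
  shows "E \<in> sets borel" "emeasure lborel E < \<infinity>"
    "measure lborel E \<le> deviation_bound r \<beta> X M d d'"
proof -
  let ?f = "\<lambda>p \<alpha>. osc d d' (coefs p \<bullet> \<alpha>)"
  define G where "G = good_box X (\<beta> ^ 4)"
  define A1 where "A1 = A \<inter> G \<times> G"
  define A2 where "A2 = A - G \<times> G"
  have finA: "finite A" by (rule finite_subset[OF A]) auto
  have fin: "finite A1" "finite A2" using finA by (auto simp: A1_def A2_def)
  have d': "d' > 0" using d by simp
  have pos: "X > 0" "\<beta> > 0" using X \<beta> by auto
  have split: "(\<Sum>p\<in>A. ?f p \<alpha>) = (\<Sum>p\<in>A1. ?f p \<alpha>) + (\<Sum>p\<in>A2. ?f p \<alpha>)" for \<alpha>
    unfolding A1_def A2_def by (rule sum.Int_Diff[OF finA])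
  show E: "E \<in> sets borel" unfolding E_def by measurable
  have "E \<subseteq> cball c r"
  proof
    fix \<alpha> assume "\<alpha> \<in> E"
    then have "tent c r (fst \<alpha>, fst (snd \<alpha>), snd (snd \<alpha>)) \<noteq> 0" by (auto simp: E_def)
    from tent_support(4)[OF r this] show "\<alpha> \<in> cball c r" by simp
  qed
  then have "emeasure lborel E \<le> emeasure lborel (cball c r)" by (intro emeasure_mono) auto
  also have "\<dots> < \<infinity>" by (rule emeasure_bounded_finite) simp
  finally show Efin: "emeasure lborel E < \<infinity>" .
  define g1 where "g1 \<alpha> = (\<Sum>p\<in>A1. ?f p \<alpha>)^2 * tent c r \<alpha>" for \<alpha>
  define g2 where "g2 \<alpha> = (\<Sum>p\<in>A2. \<bar>?f p \<alpha>\<bar> * tent c r \<alpha>)" for \<alpha>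
  have b1: "\<bar>(\<Sum>p\<in>A1. ?f p \<alpha>)^2\<bar> \<le> (real (card A1) * (1 / d))^2" for \<alpha>
  proof -
    have "\<bar>\<Sum>p\<in>A1. ?f p \<alpha>\<bar> \<le> (\<Sum>p\<in>A1. 1 / d)"
      using osc_bound[OF d] by (intro order_trans[OF sum_abs] sum_mono)
    then show ?thesis by (simp add: power2_le_iff_abs_le)
  qed
  have int1: "integrable lborel g1" unfolding g1_def by (rule integrable_tent[OF _ r b1]) measurable
  have int2': "integrable lborel (\<lambda>\<alpha>. \<bar>?f p \<alpha>\<bar> * tent c r \<alpha>)" for p
    by (rule integrable_tent[OF _ r, of _ "1 / d"]) (use osc_bound[OF d] in auto)
  have int2: "integrable lborel g2" unfolding g2_def using int2' by simp
  have I1: "(LBINT \<alpha>. g1 \<alpha>) \<le> 50000 * (16 + 8 * r + 8 * r^2) * (\<beta> ^ 4) ^ 11 * (X^2 / d + X ^ 3 + M + X ^ 10 * d' / M^2)"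
    unfolding g1_def by (rule good_second_moment[OF X one_le_power[OF \<beta>(1)] \<beta>(3) _ M d r]) (auto simp: A1_def G_def)
  have I2: "(LBINT \<alpha>. g2 \<alpha>) \<le> 24576 * r^2 * X^2 / \<beta>^2"
  proof -
    have "(LBINT \<alpha>. g2 \<alpha>) = (\<Sum>p\<in>A2. LBINT \<alpha>. \<bar>?f p \<alpha>\<bar> * tent c r \<alpha>)"
      unfolding g2_def using int2' by (rule Bochner_Integration.integral_sum)
    also have "\<dots> \<le> 24576 * r^2 * X^2 / \<beta>^2"
      by (rule bad_first_moment[OF X \<beta>(1,2) _ d(1) d' r]) (use A in \<open>auto simp: A2_def G_def\<close>)
    finally show ?thesis .
  qed
  define K Q where "K = 16 + 8 * r + 8 * r^2" and "Q = X^2 / d + X ^ 3 + M + X ^ 10 * d' / M^2"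
  define k where "k = \<beta> / X^2"
  have k: "k > 0" using pos by (simp add: k_def)
  \<comment> \<open>On the event one of the two partial sums is at least X^2 / \<beta> in absolute
    value, hence at least 1 after scaling by \<open>k\<close>; the good part enters squared, the
    other one linearly.\<close>
  have pw: "indicator E \<alpha> \<le> 2 * k^2 * g1 \<alpha> + 2 * k * g2 \<alpha>" for \<alpha>
  proof (cases "\<alpha> \<in> E")
    case True
    then have t: "tent c r \<alpha> \<ge> 1 / 2" and s: "\<bar>(\<Sum>p\<in>A1. ?f p \<alpha>) + (\<Sum>p\<in>A2. ?f p \<alpha>)\<bar> > 2 * (X^2 / \<beta>)"
      by (auto simp: E_def split)
    define s1 s2 where "s1 = \<bar>\<Sum>p\<in>A1. ?f p \<alpha>\<bar>" and "s2 = \<bar>\<Sum>p\<in>A2. ?f p \<alpha>\<bar>"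
    have k1: "k * (X^2 / \<beta>) = 1" using pos by (simp add: k_def)
    have g2: "g2 \<alpha> = (\<Sum>p\<in>A2. \<bar>?f p \<alpha>\<bar>) * tent c r \<alpha>" by (simp add: g2_def sum_distrib_right)
    have g20: "g2 \<alpha> \<ge> s2 * (1 / 2)" unfolding g2 s2_def using t by (intro mult_mono sum_abs) (auto intro: sum_nonneg)
    have g10: "g1 \<alpha> \<ge> s1^2 * (1 / 2)" unfolding g1_def s1_def power2_abs by (rule mult_left_mono[OF t]) simp
    have "s1 + s2 > 2 * (X^2 / \<beta>)" using s unfolding s1_def s2_def by linarith
    then consider "s1 \<ge> X^2 / \<beta>" | "s2 \<ge> X^2 / \<beta>" by linarith
    then have "1 \<le> (k * s1)^2 + k * s2"
    proof cases
      case 1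
      then have "k * (X^2 / \<beta>) \<le> k * s1" using k by (intro mult_left_mono) auto
      then have "1 \<le> (k * s1)^2" unfolding k1 by simp
      moreover have "0 \<le> k * s2" using k by (simp add: s2_def)
      ultimately show ?thesis by linarith
    next
      case 2
      then have "k * (X^2 / \<beta>) \<le> k * s2" using k by (intro mult_left_mono) auto
      then have "1 \<le> k * s2" unfolding k1 .
      moreover have "0 \<le> (k * s1)^2" by simp
      ultimately show ?thesis by linarith
    qed
    also have "\<dots> = 2 * k^2 * (s1^2 * (1 / 2)) + 2 * k * (s2 * (1 / 2))" by (simp add: power_mult_distrib)
    also have "\<dots> \<le> 2 * k^2 * g1 \<alpha> + 2 * k * g2 \<alpha>"
      by (intro add_mono mult_left_mono g10 g20) (use k in simp_all)
    finally show ?thesis using True by simp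
  next
    case False
    have "g1 \<alpha> \<ge> 0" "g2 \<alpha> \<ge> 0" unfolding g1_def g2_def
      by (intro mult_nonneg_nonneg sum_nonneg zero_le_power2 abs_ge_zero tent_nonneg)+
    then show ?thesis using False k by simp
  qed
  have "measure lborel E = (LBINT \<alpha>. indicator E \<alpha>)" using E by simp
  also have "\<dots> \<le> (LBINT \<alpha>. 2 * k^2 * g1 \<alpha> + 2 * k * g2 \<alpha>)"
    by (intro integral_mono pw integrable_real_indicator Bochner_Integration.integrable_add integrable_mult_right int1 int2)
      (use E Efin in simp_all)
  also have "\<dots> = 2 * k^2 * (LBINT \<alpha>. g1 \<alpha>) + 2 * k * (LBINT \<alpha>. g2 \<alpha>)"
    using int1 int2 by simp
  also have "\<dots> \<le> 2 * k^2 * (50000 * K * (\<beta> ^ 4) ^ 11 * Q) + 2 * k * (24576 * r^2 * X^2 / \<beta>^2)"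
    unfolding K_def Q_def by (intro add_mono mult_left_mono I1 I2) (use k in simp_all)
  also have "2 * k * (24576 * r^2 * X^2 / \<beta>^2) = 49152 * r^2 / \<beta>"
    using pos by (simp add: k_def power2_eq_square)
  also have "2 * k^2 * (50000 * K * (\<beta> ^ 4) ^ 11 * Q) = 100000 * K * (\<beta> ^ 2 * \<beta> ^ 44) * Q / X ^ 4"
    by (simp add: k_def power_divide power_mult[symmetric])
  also have "\<beta> ^ 2 * \<beta> ^ 44 = \<beta> ^ 46" by (simp flip: power_add)
  finally show "measure lborel E \<le> deviation_bound r \<beta> X M d d'"
    unfolding K_def Q_def deviation_bound_def by (simp only: add.commute)
qed


section \<open>Lattice points in ellipses\<close>

lemma form_domain_pos:
  assumes "(a1, a2, a3) \<in> form_domain"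
  shows "a1 > 0" "4 * a1 * a3 - a2^2 > 0" "form_scale (a1, a2, a3) > 0"
proof -
  have h: "0 \<le> a2" "a2 \<le> a1" "a1 \<le> a3" "a1 > 0" using assms by (auto simp: form_domain_def)
  have "a2 * a2 \<le> a1 * a3" using h by (intro mult_mono) auto
  moreover have "0 < a1 * a3" using h by simp
  ultimately show "4 * a1 * a3 - a2^2 > 0" by (simp add: power2_eq_square)
  then show "form_scale (a1, a2, a3) > 0" by simp
qed (use assms in \<open>auto simp: form_domain_def\<close>)

lemma form_scale_pos: "\<alpha> \<in> form_domain \<Longrightarrow> form_scale \<alpha> > 0"
  using form_domain_pos(3) by (cases \<alpha>) blast

text \<open>\<open>T\<close> is triangular, so two substitutions in one variable, first in x and
  then in y, produce the Jacobian a k and reduce the ellipse to a disc.\<close>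

lemma ellipse_measure:
  fixes a b k s :: real
  assumes a: "a > 0" and k: "k > 0" and s: "s \<ge> 0"
  defines "T \<equiv> \<lambda>p::real \<times> real. (a * fst p + b * snd p, k * snd p)"
  shows "{p. norm (T p) \<le> s} \<in> sets borel" "emeasure lborel {p. norm (T p) \<le> s} = ennreal (pi * s^2 / (a * k))"
proof -
  have cont: "continuous_on UNIV T" unfolding T_def by (intro continuous_intros)
  show meas: "{p. norm (T p) \<le> s} \<in> sets borel"
    by (intro borel_closed closed_Collect_le continuous_intros cont)
  let ?f = "\<lambda>p. indicator (cball (0 :: real \<times> real) s) p :: ennreal"
  have fm: "?f \<in> borel_measurable (lborel \<Otimes>\<^sub>M lborel)" unfolding lborel_prod
    by (intro borel_measurable_indicator) (simp add: borel_closed)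
  have fm': "(\<lambda>u. ?f (u, w)) \<in> borel_measurable borel" "(\<lambda>w. ?f (u, w)) \<in> borel_measurable borel" for u w
    using measurable_Pair1[OF fm, of w] measurable_Pair2[OF fm, of u] by (simp_all add: comp_def)
  have fsnd: "(\<lambda>w. \<integral>\<^sup>+u. ?f (u, w) \<partial>lborel) \<in> borel_measurable lborel"
    by (rule lborel.borel_measurable_nn_integral[OF measurable_pair_swap[OF fm]])
  have ind: "indicator {p. norm (T p) \<le> s} p = ?f (T p)" for p by (simp add: indicator_def)
  have gm: "(\<lambda>p. ?f (T p)) \<in> borel_measurable (lborel \<Otimes>\<^sub>M lborel)"
    unfolding ind[symmetric] lborel_prod using meas by simp
  have "emeasure lborel {p. norm (T p) \<le> s} = (\<integral>\<^sup>+p. ?f (T p) \<partial>lborel)"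
    unfolding ind[symmetric] using meas by simp
  also have "\<dots> = (\<integral>\<^sup>+y. \<integral>\<^sup>+x. ?f (T (x, y)) \<partial>lborel \<partial>lborel)"
    using lborel_pair.nn_integral_snd[OF gm] by (simp add: lborel_prod)
  also have "\<dots> = (\<integral>\<^sup>+y. ennreal (1 / a) * (\<integral>\<^sup>+u. ?f (u, k * y) \<partial>lborel) \<partial>lborel)"
  proof (rule nn_integral_cong)
    fix y
    have "(\<lambda>u. a * (- (b * y) / a + 1 / a * u) + b * y) = (\<lambda>u. u)" using a by (auto simp: field_simps)
    then have e: "?f (T (- (b * y) / a + 1 / a * u, y)) = ?f (u, k * y)" for u
      unfolding T_def fst_conv snd_conv by (metis (no_types, lifting))
    have "(\<lambda>x. ?f (T (x, y))) \<in> borel_measurable borel"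
      using measurable_Pair1[OF gm, of y] by (simp add: comp_def)
    then have "(\<integral>\<^sup>+x. ?f (T (x, y)) \<partial>lborel) = ennreal \<bar>1 / a\<bar> * (\<integral>\<^sup>+u. ?f (T (- (b * y) / a + 1 / a * u, y)) \<partial>lborel)"
      by (rule nn_integral_real_affine) (use a in simp)
    then show "(\<integral>\<^sup>+x. ?f (T (x, y)) \<partial>lborel) = ennreal (1 / a) * (\<integral>\<^sup>+u. ?f (u, k * y) \<partial>lborel)"
      unfolding e using a by simp
  qed
  also have "\<dots> = ennreal (1 / k) * (\<integral>\<^sup>+w. ennreal (1 / a) * (\<integral>\<^sup>+u. ?f (u, w) \<partial>lborel) \<partial>lborel)"
  proof -
    have m: "(\<lambda>w. ennreal (1 / a) * (\<integral>\<^sup>+u. ?f (u, w) \<partial>lborel)) \<in> borel_measurable borel"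
    proof -
      have "(\<lambda>w. \<integral>\<^sup>+u. ?f (u, w) \<partial>lborel) \<in> borel_measurable lborel"
        by (rule fsnd)
      then show ?thesis by (simp add: borel_measurable_times_ennreal)
    qed
    have m': "(\<lambda>y. ennreal (1 / a) * (\<integral>\<^sup>+u. ?f (u, k * y) \<partial>lborel)) \<in> borel_measurable borel"
      using measurable_compose[OF _ m, of "\<lambda>y. k * y" borel] by simp
    have "(\<integral>\<^sup>+y. ennreal (1 / a) * (\<integral>\<^sup>+u. ?f (u, k * y) \<partial>lborel) \<partial>lborel)
       = ennreal \<bar>1 / k\<bar> * (\<integral>\<^sup>+w. ennreal (1 / a) * (\<integral>\<^sup>+u. ?f (u, k * (0 + 1 / k * w)) \<partial>lborel) \<partial>lborel)"
      by (rule nn_integral_real_affine[OF m']) (use k in simp)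
    then show ?thesis using k by simp
  qed
  also have "(\<integral>\<^sup>+w. ennreal (1 / a) * (\<integral>\<^sup>+u. ?f (u, w) \<partial>lborel) \<partial>lborel)
      = ennreal (1 / a) * (\<integral>\<^sup>+w. \<integral>\<^sup>+u. ?f (u, w) \<partial>lborel \<partial>lborel)"
    by (rule nn_integral_cmult) (rule fsnd)
  also have "(\<integral>\<^sup>+w. \<integral>\<^sup>+u. ?f (u, w) \<partial>lborel \<partial>lborel) = emeasure lborel (cball (0 :: real \<times> real) s)"
    using lborel_pair.nn_integral_snd[OF fm] by (simp add: lborel_prod)
  also have "\<dots> = ennreal (pi * s^2)"
    using emeasure_cball[OF s, of "0 :: real \<times> real"] by (simp add: unit_ball_vol_2 power2_eq_square)
  also have "ennreal (1 / k) * (ennreal (1 / a) * ennreal (pi * s^2)) = ennreal (pi * s^2 / (a * k))"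
    using a k by (simp flip: ennreal_mult add: mult_ac)
  finally show "emeasure lborel {p. norm (T p) \<le> s} = ennreal (pi * s^2 / (a * k))" .
qed

text \<open>Gauss's device: each lattice point owns the half-open unit square above and to the right
  of it, which turns a count into an area.\<close>

lemma emeasure_floor_preimage:
  fixes L :: "(int \<times> int) set"
  assumes "finite L"
  shows "{p. (\<lfloor>fst p\<rfloor>, \<lfloor>snd p\<rfloor>) \<in> L} \<in> sets (borel :: (real \<times> real) measure)"
    "emeasure lborel {p :: real \<times> real. (\<lfloor>fst p\<rfloor>, \<lfloor>snd p\<rfloor>) \<in> L} = ennreal (real (card L))"
proof -
  define Q :: "int \<times> int \<Rightarrow> (real \<times> real) set" where
    "Q x = {of_int (fst x)..<of_int (fst x) + 1} \<times> {of_int (snd x)..<of_int (snd x) + 1}" for x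
  have Q: "p \<in> Q x \<longleftrightarrow> (\<lfloor>fst p\<rfloor>, \<lfloor>snd p\<rfloor>) = x" for p x
    by (cases p; cases x) (auto simp: Q_def floor_eq_iff)
  have Qs: "Q x \<in> sets borel" for x unfolding Q_def by (intro borel_Times) auto
  have Qm: "emeasure lborel (Q x) = 1" for x
    unfolding Q_def lborel_prod[symmetric] by (subst lborel.emeasure_pair_measure_Times) auto
  have eq: "{p :: real \<times> real. (\<lfloor>fst p\<rfloor>, \<lfloor>snd p\<rfloor>) \<in> L} = (\<Union>x\<in>L. Q x)" using Q by auto
  show "{p. (\<lfloor>fst p\<rfloor>, \<lfloor>snd p\<rfloor>) \<in> L} \<in> sets (borel :: (real \<times> real) measure)" unfolding eq by (intro sets.finite_UN assms Qs)
  have "(\<Sum>x\<in>L. emeasure lborel (Q x)) = emeasure lborel (\<Union>x\<in>L. Q x)"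
    using assms Qs Q by (intro sum_emeasure) (auto simp: disjoint_family_on_def)
  then show "emeasure lborel {p :: real \<times> real. (\<lfloor>fst p\<rfloor>, \<lfloor>snd p\<rfloor>) \<in> L} = ennreal (real (card L))"
    unfolding eq by (simp add: Qm ennreal_of_nat_eq_real_of_nat)
qed

abbreviation sublevel :: "real \<times> real \<times> real \<Rightarrow> real \<Rightarrow> (int \<times> int) set" where
  "sublevel \<alpha> E \<equiv> {x \<in> half_lattice. qform \<alpha> x \<le> E}"

definition half_count :: "real \<times> real \<times> real \<Rightarrow> real \<Rightarrow> nat" where
  "half_count \<alpha> E = card (sublevel \<alpha> E)"

lemma finite_sublevel:
  assumes "\<alpha> \<in> form_domain"
  shows "finite (sublevel \<alpha> E)"
proof -
  have "form_scale \<alpha> > 0" using assms by (rule form_scale_pos)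
  then have "qform \<alpha> x / form_scale \<alpha> \<le> E / form_scale \<alpha> \<longleftrightarrow> qform \<alpha> x \<le> E" for x
    by (simp add: divide_le_cancel)
  then show ?thesis using finite_qform_le[OF assms, of "E / form_scale \<alpha>"] by simp
qed

lemma qform_minus: "qform \<alpha> (- fst x, - snd x) = qform \<alpha> x"
  by (cases \<alpha>; cases x) simp

text \<open>The half lattice contains exactly one of x and -x for every nonzero x; the additional 1
  is the origin.\<close>

lemma lattice_count_eq:
  assumes \<alpha>: "\<alpha> \<in> form_domain" and E: "E \<ge> 0"
  shows "finite {x. qform \<alpha> x \<le> E}" "card {x. qform \<alpha> x \<le> E} = 2 * half_count \<alpha> E + 1"
proof -
  let ?H = "sublevel \<alpha> E" and ?m = "\<lambda>x::int \<times> int. (- fst x, - snd x)"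
  have q0: "qform \<alpha> (0, 0) = 0" by (cases \<alpha>) simp
  have eq: "{x. qform \<alpha> x \<le> E} = ?H \<union> (?m ` ?H \<union> {(0, 0)})"
  proof (intro equalityI subsetI)
    fix x assume x: "x \<in> {x. qform \<alpha> x \<le> E}"
    obtain m n where mn: "x = (m, n)" by (cases x)
    have "m > 0 \<or> m = 0 \<and> n > 0 \<or> - m > 0 \<or> - m = 0 \<and> - n > 0 \<or> m = 0 \<and> n = 0" by linarith
    then consider "x \<in> half_lattice" | "?m x \<in> half_lattice" | "x = (0, 0)"
      unfolding mn half_lattice_def by auto
    then show "x \<in> ?H \<union> (?m ` ?H \<union> {(0, 0)})"
    proof cases
      case 2
      then have "x = ?m (?m x)" "?m x \<in> ?H" using x qform_minus[of \<alpha> x] by auto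
      then show ?thesis by blast
    qed (use x in auto)
  next
    fix x assume "x \<in> ?H \<union> (?m ` ?H \<union> {(0, 0)})"
    then show "x \<in> {x. qform \<alpha> x \<le> E}" using E q0 qform_minus[of \<alpha>] by auto
  qed
  have fin: "finite ?H" by (rule finite_sublevel[OF \<alpha>])
  then show "finite {x. qform \<alpha> x \<le> E}" unfolding eq by simp
  have "card (?m ` ?H) = card ?H" by (rule card_image) (auto simp: inj_on_def)
  moreover have "?H \<inter> (?m ` ?H \<union> {(0, 0)}) = {}" "?m ` ?H \<inter> {(0, 0)} = {}"
    by (auto simp: half_lattice_def)
  ultimately show "card {x. qform \<alpha> x \<le> E} = 2 * half_count \<alpha> E + 1"
    unfolding eq half_count_def using fin by (simp add: card_Un_disjoint)
qed

text \<open>Completing the square writes the form as |T x|^2 with \<open>T\<close> triangular.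
  Rounding a point to its lattice corner changes |T p| by at most \<open>c\<close>, so the union of
  unit squares lies between the ellipses of radii sqrt E - c and sqrt E + c. Since A k = pi D / 2,
  the ellipse has area 2 E / D, and the half lattice takes half of it.\<close>

lemma half_count_asymp:
  assumes \<alpha>: "\<alpha> \<in> form_domain"
  shows "\<exists>C\<ge>0. \<forall>E\<ge>0. \<bar>real (half_count \<alpha> E) - E / form_scale \<alpha>\<bar> \<le> C * (sqrt E + 1)"
proof -
  obtain a1 a2 a3 where a: "\<alpha> = (a1, a2, a3)" by (cases \<alpha>)
  note pos = form_domain_pos[OF \<alpha>[unfolded a]]
  define A k b where "A = sqrt a1" and "k = sqrt (4 * a1 * a3 - a2^2) / (2 * sqrt a1)" and "b = a2 / (2 * sqrt a1)"
  define T where "T = (\<lambda>p::real \<times> real. (A * fst p + b * snd p, k * snd p))"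
  have Ak: "A > 0" "k > 0" using pos by (auto simp: A_def k_def)
  have A2: "A^2 = a1" using pos by (simp add: A_def)
  have b2: "2 * A * b = a2" using pos by (simp add: A_def b_def)
  have bk2: "b^2 + k^2 = a3"
    using pos by (simp add: b_def k_def power_divide power_mult_distrib field_simps)
  have Tq: "(norm (T (of_int (fst x), of_int (snd x))))^2 = qform \<alpha> x" for x
  proof -
    obtain m n where x: "x = (m, n)" by (cases x)
    have "(norm (T (of_int m, of_int n)))^2 = (A * of_int m + b * of_int n)^2 + (k * of_int n)^2"
      by (simp add: T_def norm_prod_def)
    also have "\<dots> = A^2 * (of_int m)^2 + (2 * A * b) * of_int m * of_int n + (b^2 + k^2) * (of_int n)^2"
      by (simp add: power2_eq_square algebra_simps)
    finally show ?thesis by (simp add: x a A2 b2 bk2)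
  qed
  define c where "c = A + \<bar>b\<bar> + k"
  have c: "c > 0" using Ak by (simp add: c_def)
  have Tdiff: "\<bar>norm (T p) - norm (T (of_int \<lfloor>fst p\<rfloor>, of_int \<lfloor>snd p\<rfloor>))\<bar> \<le> c" for p
  proof -
    obtain x y where p: "p = (x, y)" by (cases p)
    have f: "\<bar>frac x\<bar> \<le> 1" "\<bar>frac y\<bar> \<le> 1" by (auto simp: frac_lt_1 less_imp_le)
    have "T p - T (of_int \<lfloor>x\<rfloor>, of_int \<lfloor>y\<rfloor>) = (A * frac x + b * frac y, k * frac y)"
      by (simp add: T_def p frac_def algebra_simps)
    then have "\<bar>norm (T p) - norm (T (of_int \<lfloor>x\<rfloor>, of_int \<lfloor>y\<rfloor>))\<bar> \<le> norm (A * frac x + b * frac y, k * frac y)"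
      using norm_triangle_ineq3[of "T p" "T (of_int \<lfloor>x\<rfloor>, of_int \<lfloor>y\<rfloor>)"] by simp
    also have "\<dots> \<le> \<bar>A * frac x + b * frac y\<bar> + \<bar>k * frac y\<bar>"
      using norm_Pair_le[of "A * frac x + b * frac y" "k * frac y"] by simp
    also have "\<dots> \<le> (\<bar>A\<bar> * \<bar>frac x\<bar> + \<bar>b\<bar> * \<bar>frac y\<bar>) + \<bar>k\<bar> * \<bar>frac y\<bar>"
      unfolding abs_mult[symmetric] by (intro add_mono abs_triangle_ineq order_refl)
    also have "\<dots> \<le> (\<bar>A\<bar> * 1 + \<bar>b\<bar> * 1) + \<bar>k\<bar> * 1" using f by (intro add_mono mult_left_mono) auto
    also have "\<dots> = c" using Ak by (simp add: c_def)
    finally show ?thesis by (simp add: p)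
  qed
  have Ak': "A * k = form_scale \<alpha> * pi / 2" using pos by (simp add: A_def k_def a)
  define D where "D = form_scale \<alpha>"
  have D: "D > 0" using pos by (simp add: D_def a)
  have area: "pi * s^2 / (A * k) = 2 * s^2 / D" for s using D by (simp add: Ak' D_def)
  define C where "C = (c^2 + 2 * c) / D + 1"
  have bound: "\<bar>real (half_count \<alpha> E) - E / D\<bar> \<le> C * (sqrt E + 1)" if E: "E \<ge> 0" for E
  proof -
    let ?L = "{x. qform \<alpha> x \<le> E}"
    let ?U = "{p :: real \<times> real. (\<lfloor>fst p\<rfloor>, \<lfloor>snd p\<rfloor>) \<in> ?L}"
    note L = lattice_count_eq[OF \<alpha> E]
    note U = emeasure_floor_preimage[OF L(1)]
    define t where "t = sqrt E"
    have t: "t \<ge> 0" "t^2 = E" using E by (auto simp: t_def)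
    have mem: "p \<in> ?U \<longleftrightarrow> norm (T (of_int \<lfloor>fst p\<rfloor>, of_int \<lfloor>snd p\<rfloor>)) \<le> t" for p
    proof -
      have "p \<in> ?U \<longleftrightarrow> (norm (T (of_int \<lfloor>fst p\<rfloor>, of_int \<lfloor>snd p\<rfloor>)))^2 \<le> t^2"
        using Tq[of "(\<lfloor>fst p\<rfloor>, \<lfloor>snd p\<rfloor>)"] by (simp add: t)
      also have "\<dots> \<longleftrightarrow> norm (T (of_int \<lfloor>fst p\<rfloor>, of_int \<lfloor>snd p\<rfloor>)) \<le> t" by (rule power_mono_iff) (use t in auto)
      finally show ?thesis .
    qed
    have EM: "{p. norm (T p) \<le> s} \<in> sets borel" "emeasure lborel {p. norm (T p) \<le> s} = ennreal (2 * s^2 / D)" if "s \<ge> 0" for s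
      using ellipse_measure[OF Ak that, of b] area[of s] unfolding T_def by auto
    have "?U \<subseteq> {p. norm (T p) \<le> t + c}" using mem Tdiff by (smt (verit, best) mem_Collect_eq subsetI)
    then have "ennreal (real (card ?L)) \<le> ennreal (2 * (t + c)^2 / D)"
      using emeasure_mono[of ?U "{p. norm (T p) \<le> t + c}" lborel] EM[of "t + c"] U(2) t c by simp
    then have up: "real (card ?L) \<le> 2 * (t + c)^2 / D" using D by (simp add: ennreal_le_iff)
    have lo: "2 * (t^2 - 2 * c * t) / D \<le> real (card ?L)"
    proof (cases "t \<ge> c")
      case True
      have "{p. norm (T p) \<le> t - c} \<subseteq> ?U" using mem Tdiff by (smt (verit, best) mem_Collect_eq subsetI)
      then have "ennreal (2 * (t - c)^2 / D) \<le> ennreal (real (card ?L))"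
        using emeasure_mono[of "{p. norm (T p) \<le> t - c}" ?U lborel] EM[of "t - c"] U True by simp
      then have "2 * (t - c)^2 / D \<le> real (card ?L)" by (simp add: ennreal_le_iff)
      moreover have "2 * (t^2 - 2 * c * t) / D \<le> 2 * (t - c)^2 / D"
        using D by (intro divide_right_mono) (auto simp: power2_diff)
      ultimately show ?thesis by linarith
    next
      case False
      \<comment> \<open>For sqrt E < c there is no inner ellipse, but then the claimed lower bound
        is not positive.\<close>
      then have "t * t \<le> 2 * c * t" using t c by (intro mult_right_mono) auto
      then have "2 * (t^2 - 2 * c * t) / D \<le> 0" using D by (simp add: power2_eq_square divide_le_0_iff)
      then show ?thesis by linarith
    qed
    have card: "real (card ?L) = 2 * real (half_count \<alpha> E) + 1" unfolding L(2) by simp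
    have "real (half_count \<alpha> E) - E / D \<le> (2 * c * t + c^2) / D"
    proof -
      have "2 * real (half_count \<alpha> E) \<le> 2 * ((t + c)^2 / D)" using up card by simp
      then have "real (half_count \<alpha> E) \<le> (t + c)^2 / D" by simp
      also have "(t + c)^2 / D = E / D + (2 * c * t + c^2) / D"
        unfolding t(2)[symmetric] add_divide_distrib[symmetric] by (simp add: power2_sum algebra_simps)
      finally show ?thesis by simp
    qed
    moreover have "E / D - real (half_count \<alpha> E) \<le> 2 * c * t / D + 1"
    proof -
      have "2 * ((t^2 - 2 * c * t) / D) \<le> 2 * real (half_count \<alpha> E) + 1" using lo card by simp
      moreover have "(t^2 - 2 * c * t) / D = E / D - 2 * c * t / D" by (simp add: t diff_divide_distrib)
      ultimately show ?thesis by linarith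
    qed
    moreover have "(2 * c * t + c^2) / D \<le> C * (t + 1)" "2 * c * t / D + 1 \<le> C * (t + 1)"
    proof -
      have nn: "0 \<le> c^2 / D * t" "0 \<le> 2 * c / D" "0 \<le> t" "0 \<le> c^2 / D" using t c D by auto
      have CC: "C * (t + 1) = c^2 / D * t + 2 * c * t / D + t + c^2 / D + 2 * c / D + 1"
        by (simp add: C_def algebra_simps add_divide_distrib)
      show "(2 * c * t + c^2) / D \<le> C * (t + 1)" unfolding CC add_divide_distrib using nn by linarith
      show "2 * c * t / D + 1 \<le> C * (t + 1)" unfolding CC using nn by linarith
    qed
    ultimately show ?thesis unfolding t_def by linarith
  qed
  have "C \<ge> 0" using c D by (simp add: C_def)
  with bound show ?thesis unfolding D_def by blast
qed


section \<open>Pair counts\<close>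

text \<open>Pairs are ordered, so two vectors with equal values count twice, as in
  \<open>pair_correlation\<close>. The set \<open>R\<close> is kept apart from \<alpha> because it
  will be a sublevel set of another form.\<close>

definition close_pairs :: "real \<times> real \<times> real \<Rightarrow> (int \<times> int) set \<Rightarrow> real \<Rightarrow> ((int \<times> int) \<times> (int \<times> int)) set" where
  "close_pairs \<alpha> R \<delta> = {(x, y). x \<in> R \<and> y \<in> R \<and> x \<noteq> y \<and> 0 \<le> qform \<alpha> x - qform \<alpha> y \<and> qform \<alpha> x - qform \<alpha> y \<le> \<delta>}"

lemma finite_close_pairs: "finite R \<Longrightarrow> finite (close_pairs \<alpha> R \<delta>)"
  by (rule finite_subset[of _ "R \<times> R"]) (auto simp: close_pairs_def)

lemma close_pairs_mono: "R \<subseteq> S \<Longrightarrow> \<delta> \<le> \<epsilon> \<Longrightarrow> close_pairs \<alpha> R \<delta> \<subseteq> close_pairs \<alpha> S \<epsilon>"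
  by (auto simp: close_pairs_def)

lemma card_close_pairs_mono:
  "R \<subseteq> S \<Longrightarrow> \<delta> \<le> \<epsilon> \<Longrightarrow> finite S \<Longrightarrow> card (close_pairs \<alpha> R \<delta>) \<le> card (close_pairs \<alpha> S \<epsilon>)"
  by (intro card_mono finite_close_pairs close_pairs_mono)

lemma pair_correlation_eq:
  assumes \<alpha>: "\<alpha> \<in> form_domain"
  shows "pair_correlation \<alpha> N {0..\<Delta>} =
    real (card (close_pairs \<alpha> (sublevel \<alpha> (N * form_scale \<alpha>)) (\<Delta> * form_scale \<alpha>))) / N"
proof -
  define D where "D = form_scale \<alpha>"
  have D: "D > 0" unfolding D_def by (rule form_scale_pos[OF \<alpha>])
  obtain b where b: "bij_betw b UNIV half_lattice" "\<And>j. spectrum \<alpha> j = qform \<alpha> (b j) / D"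
    using lists_increasingly_spectrum[OF \<alpha>, of "spectrum \<alpha>"] unfolding lists_increasingly_def D_def by blast
  have inj: "inj b" and rng: "range b = half_lattice" using b(1) by (auto simp: bij_betw_def)
  let ?J = "{(j, k). spectrum \<alpha> j \<le> N \<and> spectrum \<alpha> k \<le> N \<and> j \<noteq> k \<and> spectrum \<alpha> j - spectrum \<alpha> k \<in> {0..\<Delta>}}"
  have mem: "spectrum \<alpha> j \<le> N \<longleftrightarrow> qform \<alpha> (b j) \<le> N * D" for j
    using D by (simp add: b(2) divide_le_eq)
  have diff: "spectrum \<alpha> j - spectrum \<alpha> k \<in> {0..\<Delta>} \<longleftrightarrow>
      0 \<le> qform \<alpha> (b j) - qform \<alpha> (b k) \<and> qform \<alpha> (b j) - qform \<alpha> (b k) \<le> \<Delta> * D" for j k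
    using D by (simp add: b(2) diff_divide_distrib[symmetric] divide_le_eq zero_le_divide_iff)
  have "close_pairs \<alpha> (sublevel \<alpha> (N * D)) (\<Delta> * D) = map_prod b b ` ?J"
  proof (intro equalityI subsetI)
    fix p assume "p \<in> close_pairs \<alpha> (sublevel \<alpha> (N * D)) (\<Delta> * D)"
    then obtain x y where p: "p = (x, y)" "x \<in> half_lattice" "y \<in> half_lattice" "qform \<alpha> x \<le> N * D" "qform \<alpha> y \<le> N * D"
      "x \<noteq> y" "0 \<le> qform \<alpha> x - qform \<alpha> y" "qform \<alpha> x - qform \<alpha> y \<le> \<Delta> * D" by (auto simp: close_pairs_def)
    obtain j k where jk: "x = b j" "y = b k" using p rng by blast
    have "(j, k) \<in> ?J" using p unfolding jk by (simp only: mem_Collect_eq case_prod_conv mem diff) auto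
    then show "p \<in> map_prod b b ` ?J" unfolding p(1) jk by force
  next
    fix p assume "p \<in> map_prod b b ` ?J"
    then obtain j k where jk: "p = (b j, b k)" "(j, k) \<in> ?J" by auto
    then show "p \<in> close_pairs \<alpha> (sublevel \<alpha> (N * D)) (\<Delta> * D)"
      using rng inj unfolding close_pairs_def mem_Collect_eq case_prod_conv mem diff by (auto dest: injD)
  qed
  moreover have "card (map_prod b b ` ?J) = card ?J"
    by (rule card_image) (use inj in \<open>auto simp: inj_on_def dest: injD\<close>)
  ultimately show ?thesis by (simp add: pair_correlation_def D_def)
qed

definition pair_map :: "(int \<times> int) \<times> (int \<times> int) \<Rightarrow> (int \<times> int) \<times> (int \<times> int)" where
  "pair_map p = (fst p - snd p, fst p + snd p)"

lemma inj_pair_map: "inj pair_map"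
  by (auto simp: inj_def pair_map_def prod_eq_iff)

lemma coefs_pair_map: "coefs (pair_map (x, y)) \<bullet> \<alpha> = qform \<alpha> x - qform \<alpha> y"
  by (cases \<alpha>; cases x; cases y)
    (simp add: coefs_def pair_map_def inner_prod_def power2_eq_square algebra_simps add_divide_distrib diff_divide_distrib)

text \<open>The half lattice is closed under addition and omits the origin, so x + y cannot
  vanish.\<close>

lemma pair_map_ne_0:
  assumes "x \<in> half_lattice" "y \<in> half_lattice" "x \<noteq> y"
  shows "fst (pair_map (x, y)) \<noteq> (0, 0)" "snd (pair_map (x, y)) \<noteq> (0, 0)"
  using assms by (auto simp: half_lattice_def pair_map_def prod_eq_iff)

lemma sum_osc_pairs:
  assumes R: "finite R" and d: "\<delta> > 0" "\<delta>' > 0"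
  shows "(\<Sum>p\<in>pair_map ` {(x, y). x \<in> R \<and> y \<in> R \<and> x \<noteq> y}. osc \<delta> \<delta>' (coefs p \<bullet> \<alpha>)) =
    real (card (close_pairs \<alpha> R \<delta>)) / \<delta> - real (card (close_pairs \<alpha> R \<delta>')) / \<delta>'"
proof -
  let ?P = "{(x, y). x \<in> R \<and> y \<in> R \<and> x \<noteq> y}"
  have fin: "finite ?P" by (rule finite_subset[of _ "R \<times> R"]) (use R in auto)
  have cnt: "(\<Sum>p\<in>?P. indicator {0..e} (coefs (pair_map p) \<bullet> \<alpha>)) = real (card (close_pairs \<alpha> R e))" for e
  proof -
    have "(\<Sum>p\<in>?P. indicator {0..e} (coefs (pair_map p) \<bullet> \<alpha>)) = (\<Sum>p\<in>?P. of_bool (coefs (pair_map p) \<bullet> \<alpha> \<in> {0..e}) :: real)"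
      by (simp add: indicator_def)
    also have "\<dots> = real (card {p \<in> ?P. coefs (pair_map p) \<bullet> \<alpha> \<in> {0..e}})"
      using fin by (simp add: sum.If_cases of_bool_def Int_def)
    also have "{p \<in> ?P. coefs (pair_map p) \<bullet> \<alpha> \<in> {0..e}} = close_pairs \<alpha> R e"
      by (auto simp: close_pairs_def coefs_pair_map)
    finally show ?thesis .
  qed
  have "(\<Sum>p\<in>pair_map ` ?P. osc \<delta> \<delta>' (coefs p \<bullet> \<alpha>)) = (\<Sum>p\<in>?P. osc \<delta> \<delta>' (coefs (pair_map p) \<bullet> \<alpha>))"
    using inj_pair_map by (subst sum.reindex) (auto intro: inj_on_subset)
  also have "\<dots> = (\<Sum>p\<in>?P. indicator {0..\<delta>} (coefs (pair_map p) \<bullet> \<alpha>)) / \<delta> - (\<Sum>p\<in>?P. indicator {0..\<delta>'} (coefs (pair_map p) \<bullet> \<alpha>)) / \<delta>'"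
    by (simp only: osc_def sum_subtractf sum_divide_distrib)
  finally show ?thesis by (simp only: cnt)
qed

text \<open>The box of size X / 2 for \<open>R\<close> places both x - y and x + y in the box of
  size X, where the deviation bound for linear forms applies.\<close>

lemma close_pairs_deviation:
  fixes c :: "real \<times> real \<times> real"
  assumes X: "X \<ge> 1" and \<beta>: "\<beta> \<ge> 1" "\<beta> ^ 4 \<le> X" "1 + ln (2 * X^2) \<le> \<beta> ^ 4"
    and R: "R \<subseteq> half_lattice" "R \<subseteq> sq_box (X / 2)" and M: "M > 0"
    and d: "0 < \<delta>" "\<delta> \<le> \<delta>'" and r: "r > 0"
  defines "E \<equiv> {\<alpha>. tent c r \<alpha> \<ge> 1 / 2 \<and>
    \<bar>real (card (close_pairs \<alpha> R \<delta>)) / \<delta> - real (card (close_pairs \<alpha> R \<delta>')) / \<delta>'\<bar> > 2 * X^2 / \<beta>}"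
  shows "E \<in> sets borel" "emeasure lborel E < \<infinity>"
    "measure lborel E \<le> deviation_bound r \<beta> X M \<delta> \<delta>'"
proof -
  let ?A = "pair_map ` {(x, y). x \<in> R \<and> y \<in> R \<and> x \<noteq> y}"
  have fin: "finite R" by (rule finite_subset[OF R(2)]) simp
  have A: "?A \<subseteq> (sq_box X - {(0, 0)}) \<times> (sq_box X - {(0, 0)})"
  proof
    fix p assume "p \<in> ?A"
    then obtain x y where p: "p = pair_map (x, y)" "x \<in> R" "y \<in> R" "x \<noteq> y" by auto
    have h: "\<bar>real_of_int (fst x)\<bar> \<le> X / 2" "\<bar>real_of_int (snd x)\<bar> \<le> X / 2" "\<bar>real_of_int (fst y)\<bar> \<le> X / 2" "\<bar>real_of_int (snd y)\<bar> \<le> X / 2"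
      using p R(2) by (auto simp: sq_box_def)
    have "x - y \<in> sq_box X" "x + y \<in> sq_box X" unfolding sq_box_def using h by auto
    then show "p \<in> (sq_box X - {(0, 0)}) \<times> (sq_box X - {(0, 0)})"
      using pair_map_ne_0[of x y] p R(1) by (auto simp: pair_map_def)
  qed
  have "\<delta>' > 0" using d by simp
  note eq = sum_osc_pairs[OF fin d(1) this]
  note dev = osc_sum_deviation[OF X \<beta> A M d r, of c, unfolded eq, folded E_def]
  show "E \<in> sets borel" "emeasure lborel E < \<infinity>"
    "measure lborel E \<le> deviation_bound r \<beta> X M \<delta> \<delta>'"
    by (rule dev)+
qed

lemma qform_lower_bound:
  assumes "(a1, a2, a3) \<in> form_domain"
  shows "a1 / 2 * ((of_int m)^2 + (of_int n)^2) \<le> qform (a1, a2, a3) (m, n)"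
proof -
  have h: "0 \<le> a2" "a2 \<le> a1" "a1 \<le> a3" "a1 > 0" using assms by (auto simp: form_domain_def)
  define s t where "s = real_of_int m" and "t = real_of_int n"
  have am: "2 * \<bar>s * t\<bar> \<le> s^2 + t^2"
    using sum_squares_bound[of "\<bar>s\<bar>" "\<bar>t\<bar>"] by (simp add: abs_mult)
  have "- (a2 * (s * t)) \<le> a2 * \<bar>s * t\<bar>"
    using mult_left_mono[OF abs_ge_minus_self[of "s * t"] h(1)] by simp
  also have "\<dots> \<le> a1 * \<bar>s * t\<bar>" using h by (intro mult_right_mono) auto
  also have "\<dots> \<le> a1 * ((s^2 + t^2) / 2)" using h am by (intro mult_left_mono) auto
  finally have "- (a2 * (s * t)) \<le> a1 * ((s^2 + t^2) / 2)" .
  moreover have "a1 * t^2 \<le> a3 * t^2" using h by (intro mult_right_mono) auto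
  ultimately show ?thesis by (simp add: s_def t_def algebra_simps)
qed

lemma qform_sandwich:
  assumes c: "c \<in> form_domain" and \<rho>: "\<rho> > 1"
  shows "\<exists>r>0. \<forall>\<alpha>. tent c r \<alpha> \<noteq> 0 \<longrightarrow> (\<forall>x. qform c x \<le> \<rho> * qform \<alpha> x \<and> qform \<alpha> x \<le> \<rho> * qform c x)"
proof -
  obtain c1 c2 c3 where c': "c = (c1, c2, c3)" by (cases c)
  have c1: "c1 > 0" using form_domain_pos(1)[OF c[unfolded c']] .
  \<comment> \<open>With the lower bound c1 / 2 (m^2 + n^2) for q_c, this radius makes the two forms
    differ by at most 2/3 (1 - 1 / \<rho>) q_c. Since 1 - 1 / \<rho> <= \<rho> - 1, this relative
    error serves both inequalities.\<close>
  define r where "r = c1 * (1 - 1 / \<rho>) / 3"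
  have r: "r > 0" using c1 \<rho> by (simp add: r_def)
  have "qform c x \<le> \<rho> * qform \<alpha> x \<and> qform \<alpha> x \<le> \<rho> * qform c x" if nz: "tent c r \<alpha> \<noteq> 0" for \<alpha> x
  proof -
    obtain a1 a2 a3 where a: "\<alpha> = (a1, a2, a3)" by (cases \<alpha>)
    obtain m n where x: "x = (m, n)" by (cases x)
    define s t where "s = real_of_int m" and "t = real_of_int n"
    define e where "e = \<bar>a1 - c1\<bar> + \<bar>a2 - c2\<bar> + \<bar>a3 - c3\<bar>"
    have e: "e \<le> r" using nz r by (auto simp: tent_def a c' e_def max_def field_simps split: if_splits)
    have "2 * \<bar>s * t\<bar> \<le> s^2 + t^2"
      using sum_squares_bound[of "\<bar>s\<bar>" "\<bar>t\<bar>"] by (simp add: abs_mult)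
    then have am: "\<bar>s * t\<bar> \<le> s^2 + t^2" using abs_ge_zero[of "s * t"] by linarith
    have "\<bar>qform \<alpha> x - qform c x\<bar> = \<bar>(a1 - c1) * s^2 + (a2 - c2) * (s * t) + (a3 - c3) * t^2\<bar>"
      by (simp add: a c' x s_def t_def algebra_simps)
    also have "\<dots> \<le> \<bar>a1 - c1\<bar> * \<bar>s^2\<bar> + \<bar>a2 - c2\<bar> * \<bar>s * t\<bar> + \<bar>a3 - c3\<bar> * \<bar>t^2\<bar>"
      unfolding abs_mult[symmetric] by (intro order_trans[OF abs_triangle_ineq] add_mono order_refl)
    also have "\<dots> \<le> \<bar>a1 - c1\<bar> * (s^2 + t^2) + \<bar>a2 - c2\<bar> * (s^2 + t^2) + \<bar>a3 - c3\<bar> * (s^2 + t^2)"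
      using am by (intro add_mono mult_left_mono) auto
    also have "\<dots> = e * (s^2 + t^2)" by (simp add: e_def distrib_right)
    also have "\<dots> \<le> r * (s^2 + t^2)" using e by (intro mult_right_mono) auto
    also have "\<dots> = 2 / 3 * (1 - 1 / \<rho>) * (c1 / 2 * (s^2 + t^2))" by (simp add: r_def)
    also have "\<dots> \<le> 2 / 3 * (1 - 1 / \<rho>) * qform c x"
    proof (rule mult_left_mono)
      show "c1 / 2 * (s^2 + t^2) \<le> qform c x"
        using qform_lower_bound[OF c[unfolded c'], of m n] unfolding c' x s_def t_def .
      show "0 \<le> 2 / 3 * (1 - 1 / \<rho>)" using \<rho> by (simp add: field_simps)
    qed
    finally have d: "\<bar>qform \<alpha> x - qform c x\<bar> \<le> 2 / 3 * (1 - 1 / \<rho>) * qform c x" .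
    have "0 \<le> c1 / 2 * (s^2 + t^2)" using c1 by simp
    then have q0: "0 \<le> qform c x"
      using qform_lower_bound[OF c[unfolded c'], of m n] by (simp add: c' x s_def t_def)
    have "0 \<le> 1 - 1 / \<rho>" using \<rho> by (simp add: field_simps)
    then have "2 / 3 * (1 - 1 / \<rho>) \<le> 1 * (1 - 1 / \<rho>)" by (rule mult_right_mono[rotated]) simp
    then have "2 / 3 * (1 - 1 / \<rho>) * qform c x \<le> (1 - 1 / \<rho>) * qform c x"
      by (intro mult_right_mono q0) simp
    with d have d: "\<bar>qform \<alpha> x - qform c x\<bar> \<le> (1 - 1 / \<rho>) * qform c x" by linarith
    then have "qform c x / \<rho> \<le> qform \<alpha> x" by (simp add: left_diff_distrib)
    then have 1: "qform c x \<le> \<rho> * qform \<alpha> x" using \<rho> by (simp add: divide_le_eq mult.commute)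
    have "1 - 1 / \<rho> \<le> \<rho> - 1"
    proof -
      have "0 \<le> (\<rho> - 1)^2 / \<rho>" using \<rho> by simp
      also have "(\<rho> - 1)^2 / \<rho> = \<rho> - 1 - (1 - 1 / \<rho>)" using \<rho> by (simp add: field_simps power2_eq_square)
      finally show ?thesis by simp
    qed
    then have "(1 - 1 / \<rho>) * qform c x \<le> (\<rho> - 1) * qform c x" using q0 by (rule mult_right_mono)
    then have "qform \<alpha> x \<le> \<rho> * qform c x" using d by (simp add: left_diff_distrib)
    with 1 show ?thesis by blast
  qed
  with r show ?thesis by blast
qed

text \<open>After division by X^4 each of the four terms is at most T^(-\<eta>): the first by the
  lower bound on \<delta>, the second with exponent -1/2, the last two with exponent -1/8, M having
  been chosen to equalise them. Then \<beta>^46 = T^(46 \<eta> / 48) still leaves T^(-2 \<eta> /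
  48).\<close>

lemma deviation_rate:
  fixes \<kappa> T \<eta> r :: real
  assumes \<kappa>: "\<kappa> \<ge> 1" and T: "T \<ge> 1" and \<eta>: "0 < \<eta>" "\<eta> \<le> 1 / 8" and \<delta>: "T powr (-1 + \<eta>) \<le> \<delta>" and r: "r > 0"
  defines "X \<equiv> \<kappa> * sqrt T" and "\<beta> \<equiv> T powr (\<eta> / 48)" and "M \<equiv> (\<kappa> * sqrt T) powr (15 / 4)"
  shows "deviation_bound r \<beta> X M \<delta> (T powr (5 / 8))
    \<le> (49152 * r^2 + 400000 * (16 + 8 * r + 8 * r^2)) * T powr (- (\<eta> / 48))"
proof -
  have T0: "T > 0" using T by simp
  have sT: "sqrt T = T powr (1 / 2)" using T0 by (simp add: powr_half_sqrt)
  have X: "X \<ge> T powr (1 / 2)" "X > 0" "X \<ge> 1"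
  proof -
    have "1 * sqrt T \<le> X" unfolding X_def using \<kappa> T by (intro mult_right_mono) auto
    then show "X \<ge> T powr (1 / 2)" by (simp add: sT)
    show "X > 0" unfolding X_def using \<kappa> T0 by simp
    have "1 \<le> sqrt T" using T by simp
    then show "X \<ge> 1" using \<open>1 * sqrt T \<le> X\<close> by linarith
  qed
  have neg: "X powr (- a) \<le> T powr (- (a / 2))" if "a \<ge> 0" for a
  proof -
    have "X powr (- a) \<le> (T powr (1 / 2)) powr (- a)" using X T0 that by (intro powr_mono2') auto
    then show ?thesis by (simp add: powr_powr)
  qed
  have Tm: "T powr (- a) \<le> T powr (- \<eta>)" if "\<eta> \<le> a" for a
    using T that by (intro powr_mono) auto
  have X4: "X ^ 4 = X powr 4" using X by (simp add: powr_numeral)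
  have \<delta>0: "\<delta> > 0" using \<delta> T0 by (auto intro: less_le_trans[rotated])
  have 1: "X^2 / \<delta> / X ^ 4 \<le> T powr (- \<eta>)"
  proof -
    have "X^2 / \<delta> / X ^ 4 = 1 / (\<delta> * X^2)" using X \<delta>0 by (simp add: field_simps eval_nat_numeral)
    also have "\<dots> \<le> 1 / (T powr (-1 + \<eta>) * T powr 1)"
    proof (intro divide_left_mono mult_mono \<delta>)
      have "(T powr (1 / 2))^2 \<le> X^2" using X by (intro power_mono) auto
      also have "(T powr (1 / 2))^2 = T powr 1" by (simp add: power2_eq_square flip: powr_add)
      finally show "T powr 1 \<le> X^2" .
    qed (use \<delta>0 X T0 in auto)
    also have "T powr (-1 + \<eta>) * T powr 1 = T powr \<eta>" by (subst powr_add[symmetric]) simp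
    finally show ?thesis by (simp add: powr_minus_divide)
  qed
  have 2: "X ^ 3 / X ^ 4 \<le> T powr (- \<eta>)"
  proof -
    have "X ^ 3 / X ^ 4 = X powr (- 1)" using X by (simp add: field_simps eval_nat_numeral powr_minus_divide)
    also have "\<dots> \<le> T powr (- (1 / 2))" by (rule neg) simp
    also have "\<dots> \<le> T powr (- \<eta>)" by (rule Tm) (use \<eta> in simp)
    finally show ?thesis .
  qed
  have 3: "M / X ^ 4 \<le> T powr (- \<eta>)"
  proof -
    have "M / X ^ 4 = X powr (- (1 / 4))" unfolding M_def X_def[symmetric] X4 by (simp flip: powr_diff)
    also have "\<dots> \<le> T powr (- (1 / 4 / 2))" by (rule neg) simp
    also have "\<dots> \<le> T powr (- \<eta>)" by (rule Tm) (use \<eta> in simp)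
    finally show ?thesis .
  qed
  have 4: "X ^ 10 * T powr (5 / 8) / M^2 / X ^ 4 \<le> T powr (- \<eta>)"
  proof -
    have "M^2 = X powr (15 / 2)" unfolding M_def X_def[symmetric] by (simp add: power2_eq_square flip: powr_add)
    moreover have "X ^ 10 = X powr 10" using X by (simp add: powr_numeral)
    ultimately have "X ^ 10 * T powr (5 / 8) / M^2 / X ^ 4 = (X powr 10 / X powr (15 / 2) / X powr 4) * T powr (5 / 8)"
      unfolding X4 by simp
    also have "X powr 10 / X powr (15 / 2) / X powr 4 = X powr (- (3 / 2))" by (simp flip: powr_diff)
    also have "X powr (- (3 / 2)) * T powr (5 / 8) \<le> T powr (- (3 / 2 / 2)) * T powr (5 / 8)"
      by (intro mult_right_mono neg) auto
    also have "\<dots> = T powr (- (1 / 8))" by (simp flip: powr_add)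
    also have "\<dots> \<le> T powr (- \<eta>)" by (rule Tm) (use \<eta> in simp)
    finally show ?thesis .
  qed
  have sum: "(X^2 / \<delta> + X ^ 3 + M + X ^ 10 * T powr (5 / 8) / M^2) / X ^ 4 \<le> 4 * T powr (- \<eta>)"
    unfolding add_divide_distrib using 1 2 3 4 by linarith
  have "\<beta> ^ 46 = T powr (46 * \<eta> / 48)" unfolding \<beta>_def using T0 by (subst powr_power) simp_all
  then have "\<beta> ^ 46 * (4 * T powr (- \<eta>)) = 4 * T powr (- (2 * \<eta> / 48))" by (simp flip: powr_add)
  also have "\<dots> \<le> 4 * T powr (- (\<eta> / 48))" using T \<eta> by (intro mult_left_mono powr_mono) auto
  finally have b: "\<beta> ^ 46 * (4 * T powr (- \<eta>)) \<le> 4 * T powr (- (\<eta> / 48))" .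
  define L S where "L = 16 + 8 * r + 8 * r^2" and "S = X^2 / \<delta> + X ^ 3 + M + X ^ 10 * T powr (5 / 8) / M^2"
  have "\<beta> ^ 46 * (S / X ^ 4) \<le> \<beta> ^ 46 * (4 * T powr (- \<eta>))"
    unfolding S_def by (rule mult_left_mono[OF sum]) (simp add: \<beta>_def)
  with b have "100000 * L * (\<beta> ^ 46 * (S / X ^ 4)) \<le> 100000 * L * (4 * T powr (- (\<eta> / 48)))"
    by (intro mult_left_mono) (use r in \<open>auto simp: L_def\<close>)
  moreover have "49152 * r^2 / \<beta> = 49152 * r^2 * T powr (- (\<eta> / 48))" by (simp add: \<beta>_def powr_minus_divide)
  moreover have "100000 * L * \<beta> ^ 46 * S / X ^ 4 = 100000 * L * (\<beta> ^ 46 * (S / X ^ 4))" by simp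
  moreover have "(49152 * r^2 + 400000 * L) * T powr (- (\<eta> / 48))
      = 49152 * r^2 * T powr (- (\<eta> / 48)) + 100000 * L * (4 * T powr (- (\<eta> / 48)))" by (simp add: distrib_right)
  ultimately have "49152 * r^2 / \<beta> + 100000 * L * \<beta> ^ 46 * S / X ^ 4 \<le> (49152 * r^2 + 400000 * L) * T powr (- (\<eta> / 48))"
    by linarith
  then show ?thesis unfolding L_def S_def deviation_bound_def .
qed

section \<open>Almost sure agreement of the fine and coarse scales\<close>

lemma half_lattice_sublevel_box:
  assumes c: "c \<in> form_domain"
  shows "\<exists>\<kappa>\<ge>1. \<forall>T\<ge>0. sublevel c T \<subseteq> sq_box (\<kappa> * sqrt T / 2)"
proof -
  obtain c1 c2 c3 where c': "c = (c1, c2, c3)" by (cases c)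
  have c1: "c1 > 0" using form_domain_pos(1)[OF c[unfolded c']] .
  define \<kappa> where "\<kappa> = 1 + 2 * sqrt (2 / c1)"
  have "sublevel c T \<subseteq> sq_box (\<kappa> * sqrt T / 2)" if T: "T \<ge> 0" for T
  proof
    fix x assume x: "x \<in> sublevel c T"
    obtain m n where mn: "x = (m, n)" by (cases x)
    have "c1 / 2 * ((of_int m)^2 + (of_int n)^2) \<le> T"
      using qform_lower_bound[OF c[unfolded c'], of m n] x by (simp add: c' mn)
    then have s: "(of_int m)^2 + (of_int n)^2 \<le> 2 / c1 * T" using c1 by (simp add: field_simps)
    have "\<bar>y\<bar> \<le> \<kappa> * sqrt T / 2" if "y^2 \<le> 2 / c1 * T" for y :: real
    proof -
      have "\<bar>y\<bar> \<le> sqrt (2 / c1 * T)" using that by (simp add: real_le_rsqrt)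
      also have "\<dots> = sqrt (2 / c1) * sqrt T" by (rule real_sqrt_mult)
      also have "\<dots> \<le> \<kappa> / 2 * sqrt T" using T by (intro mult_right_mono) (auto simp: \<kappa>_def)
      finally show ?thesis by simp
    qed
    moreover have "(of_int m)^2 \<le> 2 / c1 * T" "(of_int n)^2 \<le> 2 / c1 * T"
      using s zero_le_power2[of "real_of_int m"] zero_le_power2[of "real_of_int n"] by linarith+
    ultimately show "x \<in> sq_box (\<kappa> * sqrt T / 2)" by (simp add: sq_box_def mn)
  qed
  moreover have "\<kappa> \<ge> 1" using c1 by (simp add: \<kappa>_def)
  ultimately show ?thesis by blast
qed

text \<open>Normalised counts at the scales $\rho^{-i}$ and $T^{5/8}$, in the fixed region
  $q_c \le T = \rho^j$, which must not depend on $\alpha$ for the second moment to be expanded.\<close>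

definition scales_agree :: "real \<times> real \<times> real \<Rightarrow> real \<Rightarrow> real \<Rightarrow> real \<times> real \<times> real \<Rightarrow> bool" where
  "scales_agree c \<eta> \<rho> \<alpha> \<longleftrightarrow> (\<forall>e>0. \<forall>\<^sub>F j in sequentially. \<forall>i. (\<rho> ^ j) powr (-1 + \<eta>) \<le> (1 / \<rho>) ^ i \<longrightarrow>
    \<bar>real (card (close_pairs \<alpha> (sublevel c (\<rho> ^ j)) ((1 / \<rho>) ^ i))) / (1 / \<rho>) ^ i
      - real (card (close_pairs \<alpha> (sublevel c (\<rho> ^ j)) ((\<rho> ^ j) powr (5 / 8)))) / (\<rho> ^ j) powr (5 / 8)\<bar> \<le> e * \<rho> ^ j)"

text \<open>For T = \<rho>^j only the scales with i <= j are admissible, because (1 / \<rho>)^j = 1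
  / T. A union bound over them gives exceptional sets of measure at most K (j + 1) q^j, which is
  summable, and the threshold 2 X^2 / \<beta> is o(T).\<close>

lemma scales_agree_AE:
  fixes c :: "real \<times> real \<times> real" and \<rho> \<eta> r :: real
  assumes c: "c \<in> form_domain" and \<rho>: "\<rho> > 1" and \<eta>: "0 < \<eta>" "\<eta> \<le> 1 / 8" and r: "r > 0"
  shows "AE \<alpha> in lborel. tent c r \<alpha> \<ge> 1 / 2 \<longrightarrow> scales_agree c \<eta> \<rho> \<alpha>"
proof -
  obtain \<kappa> where \<kappa>: "\<kappa> \<ge> 1" "\<And>T. T \<ge> 0 \<Longrightarrow> sublevel c T \<subseteq> sq_box (\<kappa> * sqrt T / 2)"
    using half_lattice_sublevel_box[OF c] by blast
  define T where "T j = \<rho> ^ j" for j :: nat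
  define \<delta> where "\<delta> i = (1 / \<rho>) ^ i" for i :: nat
  define X where "X j = \<kappa> * sqrt (T j)" for j
  define \<beta> where "\<beta> j = T j powr (\<eta> / 48)" for j
  define dev where "dev \<alpha> i j = \<bar>real (card (close_pairs \<alpha> (sublevel c (T j)) (\<delta> i))) / \<delta> i
        - real (card (close_pairs \<alpha> (sublevel c (T j)) (T j powr (5 / 8)))) / T j powr (5 / 8)\<bar>" for \<alpha> i j
  define E where "E i j = {\<alpha>. tent c r \<alpha> \<ge> 1 / 2 \<and> dev \<alpha> i j > 2 * (X j)^2 / \<beta> j}" for i j
  define good where "good j \<longleftrightarrow> \<beta> j ^ 4 \<le> X j \<and> 1 + ln (2 * (X j)^2) \<le> \<beta> j ^ 4" for j
  define I where "I j = {i. i \<le> j \<and> T j powr (-1 + \<eta>) \<le> \<delta> i}" for j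
  \<comment> \<open>The size conditions on \<beta> are guaranteed only for large j; taking the empty
    set otherwise makes the measure bound valid for every j.\<close>
  define bad where "bad j = (if good j then \<Union>i\<in>I j. E i j else {})" for j
  define K where "K = 49152 * r^2 + 400000 * (16 + 8 * r + 8 * r^2)"
  define q where "q = \<rho> powr (- (\<eta> / 48))"
  have T1: "T j \<ge> 1" for j unfolding T_def using \<rho> by simp
  have X1: "X j \<ge> 1" for j
  proof -
    have "1 * 1 \<le> X j" unfolding X_def using \<kappa>(1) T1[of j] by (intro mult_mono) auto
    then show ?thesis by simp
  qed
  have \<delta>0: "\<delta> i > 0" "\<delta> i \<le> 1" for i using \<rho> by (auto simp: \<delta>_def intro!: power_le_one)
  have Tlim: "filterlim T at_top sequentially"
    unfolding T_def using \<rho> by real_asymp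
  have finI: "finite (I j)" for j unfolding I_def by simp
  have Eprops: "E i j \<in> sets borel \<and> emeasure lborel (E i j) < \<infinity> \<and> measure lborel (E i j) \<le> K * q ^ j"
    if g: "good j" and i: "i \<in> I j" for i j
  proof -
    have R: "sublevel c (T j) \<subseteq> half_lattice" "sublevel c (T j) \<subseteq> sq_box (X j / 2)"
      unfolding X_def T_def using \<kappa>(2)[of "\<rho> ^ j"] \<rho> by auto
    have b: "\<beta> j \<ge> 1" unfolding \<beta>_def using T1 \<eta> by (intro ge_one_powr_ge_zero) auto
    have d: "\<delta> i \<le> T j powr (5 / 8)" using \<delta>0(2)[of i] ge_one_powr_ge_zero[OF T1[of j], of "5 / 8"] by linarith
    have M: "(\<kappa> * sqrt (T j)) powr (15 / 4) > 0" using \<kappa>(1) T1[of j] by simp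
    note dv = close_pairs_deviation[OF X1 b _ _ R M \<delta>0(1) d r, of c, folded dev_def E_def]
    have g1: "\<beta> j ^ 4 \<le> X j" and g2: "1 + ln (2 * (X j)^2) \<le> \<beta> j ^ 4" using g by (auto simp: good_def)
    have i': "T j powr (-1 + \<eta>) \<le> \<delta> i" using i by (simp add: I_def)
    have "measure lborel (E i j) \<le> K * T j powr (- (\<eta> / 48))"
      using dv(3)[OF g1 g2] deviation_rate[OF \<kappa>(1) T1 \<eta> i' r]
      unfolding K_def X_def \<beta>_def by simp
    also have "T j powr (- (\<eta> / 48)) = q ^ j"
    proof -
      have "T j = \<rho> powr real j" using \<rho> by (simp add: T_def powr_realpow)
      moreover have "q ^ j = q powr real j" using \<rho> by (simp add: q_def powr_realpow)
      ultimately show ?thesis by (simp add: q_def powr_powr mult.commute)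
    qed
    finally show ?thesis using dv(1,2)[OF g1 g2] by simp
  qed
  have bad_sets: "bad j \<in> sets lborel" for j
    unfolding bad_def using Eprops finI[of j] by (auto intro!: sets.finite_UN)
  have bad_meas: "emeasure lborel (bad j) < \<infinity> \<and> measure lborel (bad j) \<le> K * (real (Suc j) * q ^ j)" for j
  proof (cases "good j")
    case True
    have K0: "0 \<le> K * q ^ j" using r by (simp add: K_def q_def)
    have fm: "E i j \<in> fmeasurable lborel" if "i \<in> I j" for i
      using Eprops[OF True that] by (simp add: fmeasurable_def)
    have "bad j \<in> fmeasurable lborel" unfolding bad_def using True finI fm by auto
    then have 1: "emeasure lborel (bad j) < \<infinity>" by (simp add: fmeasurable_def)
    have "measure lborel (bad j) \<le> (\<Sum>i\<in>I j. measure lborel (E i j))"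
      unfolding bad_def using True measure_UNION_le[OF finI, of j "\<lambda>i. E i j" lborel] fm by (simp add: fmeasurable_def)
    also have "\<dots> \<le> (\<Sum>i\<in>I j. K * q ^ j)" using Eprops[OF True] by (intro sum_mono) auto
    also have "\<dots> = real (card (I j)) * (K * q ^ j)" by simp
    also have "\<dots> \<le> real (Suc j) * (K * q ^ j)"
    proof (rule mult_right_mono[OF _ K0])
      have "card (I j) \<le> card {..j}" by (rule card_mono) (auto simp: I_def)
      then show "real (card (I j)) \<le> real (Suc j)" by simp
    qed
    finally show ?thesis using 1 by (simp add: mult_ac)
  qed (use r in \<open>simp add: bad_def K_def q_def\<close>)
  have summ: "summable (\<lambda>j. measure lborel (bad j))"
  proof (rule summable_comparison_test')
    have "norm q < 1" using \<rho> \<eta> by (simp add: q_def powr_less_one)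
    then have "summable (\<lambda>j. real (Suc j) * q ^ j)" using geometric_deriv_sums[of q] by (auto simp: sums_iff)
    then show "summable (\<lambda>j. K * (real (Suc j) * q ^ j))" by (rule summable_mult)
    show "norm (measure lborel (bad j)) \<le> K * (real (Suc j) * q ^ j)" for j using bad_meas[of j] by simp
  qed
  have AE: "AE \<alpha> in lborel. \<forall>\<^sub>F j in sequentially. \<alpha> \<in> space lborel - bad j"
    by (rule borel_cantelli_AE1[OF bad_sets _ summ]) (use bad_meas in auto)
  have good_ev: "\<forall>\<^sub>F j in sequentially. good j"
  proof -
    have "\<forall>\<^sub>F t in at_top. (t powr (\<eta> / 48)) ^ 4 \<le> \<kappa> * sqrt t"
      using eventually_ge_at_top[of 1]
    proof eventually_elim
      case (elim t)
      have "(t powr (\<eta> / 48)) ^ 4 = t powr (4 * \<eta> / 48)" using elim by (simp add: powr_power mult.commute)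
      also have "\<dots> \<le> t powr (1 / 2)" using elim \<eta> by (intro powr_mono) auto
      also have "\<dots> = 1 * sqrt t" using elim by (simp add: powr_half_sqrt)
      also have "\<dots> \<le> \<kappa> * sqrt t" using \<kappa>(1) elim by (intro mult_right_mono) auto
      finally show ?case .
    qed
    moreover have "\<forall>\<^sub>F t in at_top. 1 + ln (2 * (\<kappa> * sqrt t)^2) \<le> (t powr (\<eta> / 48)) ^ 4"
      using \<eta> \<kappa>(1) by real_asymp
    ultimately have "\<forall>\<^sub>F t in at_top. (t powr (\<eta> / 48)) ^ 4 \<le> \<kappa> * sqrt t \<and> 1 + ln (2 * (\<kappa> * sqrt t)^2) \<le> (t powr (\<eta> / 48)) ^ 4"
      by (rule eventually_conj)
    from eventually_compose_filterlim[OF this Tlim] show ?thesis unfolding good_def X_def \<beta>_def .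
  qed
  have small: "\<forall>\<^sub>F j in sequentially. 2 * (X j)^2 / \<beta> j \<le> e * T j" if e: "e > 0" for e
  proof -
    have "\<forall>\<^sub>F t in at_top. 2 * \<kappa>^2 / e \<le> t powr (\<eta> / 48)"
      using \<eta> by real_asymp
    from eventually_compose_filterlim[OF this Tlim] show ?thesis
    proof eventually_elim
      case (elim j)
      have "\<beta> j > 0" using T1[of j] by (simp add: \<beta>_def)
      have "2 * \<kappa>^2 \<le> e * \<beta> j" using elim e by (simp add: \<beta>_def divide_le_eq mult.commute)
      then have "2 * \<kappa>^2 * T j \<le> e * \<beta> j * T j" using T1[of j] by (intro mult_right_mono) auto
      moreover have "(X j)^2 = \<kappa>^2 * T j" using T1[of j] by (simp add: X_def power_mult_distrib)
      ultimately show ?case using \<open>\<beta> j > 0\<close> by (simp add: divide_le_eq mult_ac)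
    qed
  qed
  have allowed: "i \<le> j" if "T j powr (-1 + \<eta>) \<le> \<delta> i" for i j
  proof (rule ccontr)
    assume "\<not> i \<le> j"
    then have "\<delta> i < \<delta> j" unfolding \<delta>_def using \<rho> by (intro power_strict_decreasing) auto
    also have "\<delta> j = T j powr (-1)" using T1[of j] by (simp add: \<delta>_def T_def power_one_over powr_minus_divide)
    also have "\<dots> \<le> T j powr (-1 + \<eta>)" using T1[of j] \<eta> by (intro powr_mono) auto
    finally show False using that by simp
  qed
  from AE show ?thesis
  proof eventually_elim
    case (elim \<alpha>)
    show ?case
      unfolding scales_agree_def T_def[symmetric] \<delta>_def[symmetric] dev_def[symmetric]
    proof (intro impI allI)
      fix e :: real assume t: "tent c r \<alpha> \<ge> 1 / 2" and e: "e > 0"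
      from elim good_ev small[OF e]
      show "\<forall>\<^sub>F j in sequentially. \<forall>i. T j powr (-1 + \<eta>) \<le> \<delta> i \<longrightarrow> dev \<alpha> i j \<le> e * T j"
      proof eventually_elim
        case (elim j)
        show ?case
        proof (intro allI impI)
          fix i assume i: "T j powr (-1 + \<eta>) \<le> \<delta> i"
          then have "i \<in> I j" using allowed by (simp add: I_def)
          then have "\<alpha> \<notin> E i j" using elim(1,2) by (auto simp: bad_def)
          then have "dev \<alpha> i j \<le> 2 * (X j)^2 / \<beta> j" using t by (auto simp: E_def)
          then show "dev \<alpha> i j \<le> e * T j" using elim(3) by linarith
        qed
      qed
    qed
  qed
qed


section \<open>The coarse scale\<close>

lemma qform_pos:
  assumes "\<alpha> \<in> form_domain" "x \<in> half_lattice"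
  shows "qform \<alpha> x > 0"
proof -
  obtain a1 a2 a3 where a: "\<alpha> = (a1, a2, a3)" by (cases \<alpha>)
  obtain m n where x: "x = (m, n)" by (cases x)
  have "(of_int m :: real)^2 + (of_int n)^2 > 0"
    using assms(2) by (auto simp: x half_lattice_def sum_power2_gt_zero_iff)
  moreover have "a1 > 0" using form_domain_pos(1) assms(1) a by blast
  ultimately have "0 < a1 / 2 * ((of_int m)^2 + (of_int n)^2)" by simp
  then show ?thesis using qform_lower_bound[of a1 a2 a3 m n] assms(1) by (simp add: a x)
qed

lemma card_annulus:
  assumes \<alpha>: "\<alpha> \<in> form_domain" and "s \<le> t"
  shows "card {x \<in> half_lattice. s < qform \<alpha> x \<and> qform \<alpha> x \<le> t} = half_count \<alpha> t - half_count \<alpha> s"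
    "half_count \<alpha> s \<le> half_count \<alpha> t"
proof -
  have eq: "{x \<in> half_lattice. s < qform \<alpha> x \<and> qform \<alpha> x \<le> t} = sublevel \<alpha> t - sublevel \<alpha> s"
    by auto
  show "card {x \<in> half_lattice. s < qform \<alpha> x \<and> qform \<alpha> x \<le> t} = half_count \<alpha> t - half_count \<alpha> s"
    unfolding eq half_count_def using assms(2) finite_sublevel[OF \<alpha>] by (intro card_Diff_subset) auto
  show "half_count \<alpha> s \<le> half_count \<alpha> t"
    unfolding half_count_def using assms(2) finite_sublevel[OF \<alpha>] by (intro card_mono) auto
qed

context
  fixes \<alpha> :: "real \<times> real \<times> real" and C :: real
  assumes \<alpha>: "\<alpha> \<in> form_domain" and C: "C \<ge> 0"
    and half_count: "\<And>E. E \<ge> 0 \<Longrightarrow> \<bar>real (half_count \<alpha> E) - E / form_scale \<alpha>\<bar> \<le> C * (sqrt E + 1)"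
begin

lemma half_count_error: "0 \<le> E \<Longrightarrow> E \<le> E' \<Longrightarrow> \<bar>real (half_count \<alpha> E) - E / form_scale \<alpha>\<bar> \<le> C * (sqrt E' + 1)"
  using half_count[of E] C by (smt (verit) mult_left_mono real_sqrt_le_mono)

text \<open>For fixed y the vector x lies in an annulus. Lowering its excluded inner edge by 1
  admits q(x) = q(y), and \<open>max 0\<close> keeps the edge in the range of the lattice count. The
  extra 1 is negligible against the coarse width T^(5/8).\<close>

lemma close_pairs_card_le:
  assumes E: "E \<ge> 0" and d: "d \<ge> 0" and R: "R \<subseteq> sublevel \<alpha> E"
  shows "real (card (close_pairs \<alpha> R d)) \<le>
    (E / form_scale \<alpha> + C * (sqrt E + 1)) * ((d + 1) / form_scale \<alpha> + 2 * C * (sqrt (E + d) + 1))"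
proof -
  define D where "D = form_scale \<alpha>"
  have D: "D > 0" using form_scale_pos[OF \<alpha>] by (simp add: D_def)
  let ?S = "sublevel \<alpha> E"
  let ?F = "\<lambda>y. {x \<in> half_lattice. max 0 (qform \<alpha> y - 1) < qform \<alpha> x \<and> qform \<alpha> x \<le> qform \<alpha> y + d}"
  define w where "w = (d + 1) / D + 2 * C * (sqrt (E + d) + 1)"
  have finS: "finite ?S" by (rule finite_sublevel[OF \<alpha>])
  have finF: "finite (?F y)" for y
    by (rule finite_subset[OF _ finite_sublevel[OF \<alpha>, of "qform \<alpha> y + d"]]) auto
  have Fy: "real (card (?F y)) \<le> w" if y: "y \<in> ?S" for y
  proof -
    have q: "0 < qform \<alpha> y" "qform \<alpha> y \<le> E" using y qform_pos[OF \<alpha>] by auto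
    define s t where "s = max 0 (qform \<alpha> y - 1)" and "t = qform \<alpha> y + d"
    have st: "0 \<le> s" "s \<le> t" "t \<le> E + d" "s \<le> E + d" "t - s \<le> d + 1" using q d by (auto simp: s_def t_def)
    have "real (card (?F y)) = real (half_count \<alpha> t) - real (half_count \<alpha> s)"
      using card_annulus[OF \<alpha> st(2)] by (simp add: s_def t_def of_nat_diff)
    also have "\<dots> \<le> (t / D + C * (sqrt (E + d) + 1)) - (s / D - C * (sqrt (E + d) + 1))"
      using half_count_error[of t "E + d"] half_count_error[of s "E + d"] st unfolding D_def by linarith
    also have "\<dots> = (t - s) / D + 2 * C * (sqrt (E + d) + 1)" by (simp add: diff_divide_distrib)
    also have "\<dots> \<le> w" unfolding w_def using st D by (intro add_mono divide_right_mono) auto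
    finally show ?thesis .
  qed
  have "close_pairs \<alpha> R d \<subseteq> prod.swap ` (Sigma ?S ?F)"
  proof
    fix p assume "p \<in> close_pairs \<alpha> R d"
    then obtain x y where p: "p = (x, y)" "x \<in> R" "y \<in> R" "0 \<le> qform \<alpha> x - qform \<alpha> y" "qform \<alpha> x - qform \<alpha> y \<le> d"
      by (auto simp: close_pairs_def)
    have "x \<in> ?S" "y \<in> ?S" using p R by auto
    then have "x \<in> ?F y" using p qform_pos[OF \<alpha>, of x] by auto
    then have "(y, x) \<in> Sigma ?S ?F" using \<open>y \<in> ?S\<close> by blast
    then show "p \<in> prod.swap ` (Sigma ?S ?F)" unfolding p(1) by (rule rev_image_eqI) simp
  qed
  then have "card (close_pairs \<alpha> R d) \<le> card (Sigma ?S ?F)"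
    using finS finF by (intro surj_card_le) auto
  also have "\<dots> = (\<Sum>y\<in>?S. card (?F y))" using finS finF by (intro card_SigmaI) auto
  finally have "real (card (close_pairs \<alpha> R d)) \<le> real (\<Sum>y\<in>?S. card (?F y))" by (rule of_nat_mono)
  also have "\<dots> = (\<Sum>y\<in>?S. real (card (?F y)))" by (rule of_nat_sum)
  also have "\<dots> \<le> (\<Sum>y\<in>?S. w)" by (intro sum_mono Fy)
  also have "\<dots> = real (half_count \<alpha> E) * w" by (simp add: half_count_def)
  also have "\<dots> \<le> (E / D + C * (sqrt E + 1)) * w"
    using half_count[OF E] D C E d unfolding D_def[symmetric] w_def by (intro mult_right_mono) (auto intro!: add_nonneg_nonneg)
  finally show ?thesis by (simp add: w_def D_def)
qed

text \<open>Restricting y to values at most U - d keeps the whole annulus above it inside the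
  sublevel U, and the strict inequality q(y) < q(x) makes the two vectors distinct.\<close>

lemma close_pairs_card_ge:
  assumes d: "0 \<le> d" "d \<le> U" and R: "finite R" "sublevel \<alpha> U \<subseteq> R"
    and pos: "0 \<le> d / form_scale \<alpha> - 2 * C * (sqrt U + 1)"
  shows "((U - d) / form_scale \<alpha> - C * (sqrt U + 1)) * (d / form_scale \<alpha> - 2 * C * (sqrt U + 1))
    \<le> real (card (close_pairs \<alpha> R d))"
proof -
  define D where "D = form_scale \<alpha>"
  have D: "D > 0" using form_scale_pos[OF \<alpha>] by (simp add: D_def)
  let ?S = "sublevel \<alpha> (U - d)"
  let ?F = "\<lambda>y. {x \<in> half_lattice. qform \<alpha> y < qform \<alpha> x \<and> qform \<alpha> x \<le> qform \<alpha> y + d}"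
  define w where "w = d / D - 2 * C * (sqrt U + 1)"
  have finS: "finite ?S" by (rule finite_sublevel[OF \<alpha>])
  have finF: "finite (?F y)" for y
    by (rule finite_subset[OF _ finite_sublevel[OF \<alpha>, of "qform \<alpha> y + d"]]) auto
  have Fy: "w \<le> real (card (?F y))" if y: "y \<in> ?S" for y
  proof -
    have q: "0 < qform \<alpha> y" "qform \<alpha> y \<le> U - d" using y qform_pos[OF \<alpha>] by auto
    define s t where "s = qform \<alpha> y" and "t = qform \<alpha> y + d"
    have st: "0 \<le> s" "s \<le> t" "t \<le> U" "s \<le> U" "t - s = d" using q d by (auto simp: s_def t_def)
    have "w = (t / D - C * (sqrt U + 1)) - (s / D + C * (sqrt U + 1))"
      unfolding w_def st(5)[symmetric] by (simp add: diff_divide_distrib)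
    also have "\<dots> \<le> real (half_count \<alpha> t) - real (half_count \<alpha> s)"
      using half_count_error[of t U] half_count_error[of s U] st unfolding D_def by linarith
    also have "\<dots> = real (card (?F y))"
      using card_annulus[OF \<alpha> st(2)] by (simp add: s_def t_def of_nat_diff)
    finally show ?thesis .
  qed
  have "((U - d) / D - C * (sqrt U + 1)) * w \<le> real (half_count \<alpha> (U - d)) * w"
    using half_count_error[of "U - d" U] d pos unfolding D_def w_def by (intro mult_right_mono) linarith+
  also have "\<dots> = (\<Sum>y\<in>?S. w)" by (simp add: half_count_def)
  also have "\<dots> \<le> (\<Sum>y\<in>?S. real (card (?F y)))" by (intro sum_mono Fy)
  also have "\<dots> = real (\<Sum>y\<in>?S. card (?F y))" by (rule of_nat_sum[symmetric])
  also have "(\<Sum>y\<in>?S. card (?F y)) = card (Sigma ?S ?F)" using finS finF by (intro card_SigmaI[symmetric]) auto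
  also have "card (Sigma ?S ?F) = card (prod.swap ` Sigma ?S ?F)" by (rule card_image[symmetric]) simp
  also have "\<dots> \<le> card (close_pairs \<alpha> R d)"
    using R d by (intro card_mono finite_close_pairs) (auto simp: close_pairs_def)
  finally show ?thesis by (simp add: w_def D_def)
qed

end

text \<open>T^(5/8) dominates the sqrt T errors in the second factor, so only (\<rho> T / D)
  (T^(5/8) / D) survives.\<close>

lemma coarse_upper_limit:
  fixes C D \<rho> :: real
  assumes "C > 0" "D > 0" "\<rho> > 1"
  shows "((\<lambda>T. (\<rho> * T / D + C * (sqrt (\<rho> * T) + 1)) * ((T powr (5 / 8) + 1) / D + 2 * C * (sqrt (\<rho> * T + T powr (5 / 8)) + 1))
      / T powr (5 / 8) / T) \<longlongrightarrow> \<rho> / D^2) at_top"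
proof -
  have eq: "\<rho> / D^2 = \<rho> * inverse D * inverse D" by (simp add: power2_eq_square divide_inverse)
  show ?thesis unfolding eq using assms by real_asymp
qed

lemma coarse_lower_limit:
  fixes C D \<rho> :: real
  assumes "C > 0" "D > 0" "\<rho> > 1"
  shows "((\<lambda>T. ((T / \<rho> - T powr (5 / 8)) / D - C * (sqrt (T / \<rho>) + 1)) * (T powr (5 / 8) / D - 2 * C * (sqrt (T / \<rho>) + 1))
      / T powr (5 / 8) / T) \<longlongrightarrow> 1 / (\<rho> * D^2)) at_top" (is ?A)
    "\<forall>\<^sub>F T in at_top. 0 \<le> T powr (5 / 8) / D - 2 * C * (sqrt (T / \<rho>) + 1)"
    "\<forall>\<^sub>F T in at_top. T powr (5 / 8) \<le> T / \<rho>"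
proof -
  have eq: "1 / (\<rho> * D^2) = inverse \<rho> * inverse D * inverse D" by (simp add: power2_eq_square divide_inverse)
  show ?A unfolding eq using assms by real_asymp
qed (use assms in real_asymp)+


section \<open>Transfer to the pair correlation function\<close>

lemma ex_power_between:
  fixes \<rho> V :: real
  assumes "\<rho> > 1" "V \<ge> 1"
  shows "\<exists>j. V \<le> \<rho> ^ j \<and> \<rho> ^ j \<le> \<rho> * V"
proof -
  obtain n where n: "V < \<rho> ^ n" using real_arch_pow[OF assms(1)] by blast
  define j where "j = (LEAST j. V \<le> \<rho> ^ j)"
  have j: "V \<le> \<rho> ^ j" unfolding j_def by (rule LeastI[of _ n]) (use n in simp)
  have "\<rho> ^ j \<le> \<rho> * V"
  proof (cases j)
    case 0
    have "1 * 1 \<le> \<rho> * V" using assms by (intro mult_mono) auto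
    then show ?thesis using 0 by simp
  next
    case (Suc k)
    then have "\<not> V \<le> \<rho> ^ k" using not_less_Least[of k "\<lambda>j. V \<le> \<rho> ^ j"] by (simp add: j_def)
    then show ?thesis using Suc assms by simp
  qed
  with j show ?thesis by blast
qed

text \<open>The expected count is d T / D^2 with D = \<open>form_scale \<alpha>\<close>: about T / D
  vectors, each with about d / D partners. Of the two factors \<rho> allowed on each side, one pays
  for comparing q_c with q_\<alpha> and one for the vanishing errors.\<close>

definition grid_bounds :: "real \<times> real \<times> real \<Rightarrow> real \<Rightarrow> real \<Rightarrow> real \<times> real \<times> real \<Rightarrow> nat \<Rightarrow> bool" where
  "grid_bounds c \<eta> \<rho> \<alpha> j \<longleftrightarrow> (\<forall>i. (\<rho> ^ j) powr (-1 + \<eta>) \<le> (1 / \<rho>) ^ i \<longrightarrow>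
    (1 / \<rho>) ^ i * \<rho> ^ j / (\<rho>^2 * (form_scale \<alpha>)^2) \<le> real (card (close_pairs \<alpha> (sublevel c (\<rho> ^ j)) ((1 / \<rho>) ^ i))) \<and>
    real (card (close_pairs \<alpha> (sublevel c (\<rho> ^ j)) ((1 / \<rho>) ^ i))) \<le> (1 / \<rho>) ^ i * \<rho> ^ j * \<rho>^2 / (form_scale \<alpha>)^2)"

lemma eventually_grid_bounds:
  fixes c \<alpha> :: "real \<times> real \<times> real" and \<rho> \<eta> :: real
  assumes c: "c \<in> form_domain" and \<alpha>: "\<alpha> \<in> form_domain" and \<rho>: "\<rho> > 1"
    and sw: "\<And>x. qform c x \<le> \<rho> * qform \<alpha> x" "\<And>x. qform \<alpha> x \<le> \<rho> * qform c x"
    and agree: "scales_agree c \<eta> \<rho> \<alpha>"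
  shows "\<forall>\<^sub>F j in sequentially. grid_bounds c \<eta> \<rho> \<alpha> j"
proof -
  define R where "R j = sublevel c (\<rho> ^ j)" for j
  define D where "D = form_scale \<alpha>"
  note dev = agree[unfolded scales_agree_def, folded R_def, rule_format]
  obtain C0 where C0: "C0 \<ge> 0" "\<And>E. E \<ge> 0 \<Longrightarrow> \<bar>real (half_count \<alpha> E) - E / D\<bar> \<le> C0 * (sqrt E + 1)"
    using half_count_asymp[OF \<alpha>] unfolding D_def by blast
  \<comment> \<open>The limit lemmas for the coarse scale ask for a strictly positive
    constant.\<close>
  define C where "C = C0 + 1"
  have C: "C > 0" "C \<ge> 0" using C0 by (auto simp: C_def)
  have hc: "\<bar>real (half_count \<alpha> E) - E / form_scale \<alpha>\<bar> \<le> C * (sqrt E + 1)" if "E \<ge> 0" for E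
    using C0(2)[OF that] that mult_right_mono[of C0 C "sqrt E + 1"] unfolding D_def C_def by simp
  have D: "D > 0" unfolding D_def by (rule form_scale_pos[OF \<alpha>])
  have Tlim: "filterlim (\<lambda>j. \<rho> ^ j) at_top sequentially" using \<rho> by real_asymp
  define S where "S j = real (card (close_pairs \<alpha> (R j) ((\<rho> ^ j) powr (5 / 8)))) / (\<rho> ^ j) powr (5 / 8)" for j
  have T0: "\<rho> ^ j > 0" for j using \<rho> by simp
  have finR: "finite (R j)" for j unfolding R_def by (rule finite_sublevel[OF c])
  \<comment> \<open>\<open>e1\<close> and \<open>e2\<close> are half the gaps from \<rho> to
    \<rho>^2 and from 1 / \<rho>^2 to 1 / \<rho>, divided by D^2: one half is spent on the coarse
    limit, the other on the agreement of scales.\<close>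
  define e1 where "e1 = (\<rho>^2 - \<rho>) / (2 * D^2)"
  define e2 where "e2 = (1 / \<rho> - 1 / \<rho>^2) / (2 * D^2)"
  have "\<rho> * 1 < \<rho> * \<rho>" using \<rho> by (intro mult_strict_left_mono) auto
  then have \<rho>2: "\<rho> < \<rho>^2" by (simp add: power2_eq_square)
  then have "1 / \<rho>^2 < 1 / \<rho>" using \<rho> by (intro divide_strict_left_mono) auto
  with \<rho>2 have e: "e1 > 0" "e2 > 0" using D by (auto simp: e1_def e2_def)
  have up: "\<forall>\<^sub>F j in sequentially. S j \<le> (\<rho> / D^2 + e1) * \<rho> ^ j"
  proof -
    have "\<forall>\<^sub>F T in at_top. (\<rho> * T / D + C * (sqrt (\<rho> * T) + 1)) * ((T powr (5 / 8) + 1) / D + 2 * C * (sqrt (\<rho> * T + T powr (5 / 8)) + 1))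
      / T powr (5 / 8) / T < \<rho> / D^2 + e1"
      by (rule order_tendstoD(2)[OF coarse_upper_limit[OF C(1) D \<rho>]]) (use e in simp)
    from eventually_compose_filterlim[OF this Tlim] show ?thesis
    proof eventually_elim
      case (elim j)
      define T where "T = \<rho> ^ j"
      have T: "T > 0" unfolding T_def by (rule T0)
      have sub: "R j \<subseteq> sublevel \<alpha> (\<rho> * T)"
      proof
        fix x assume x: "x \<in> R j"
        have "qform \<alpha> x \<le> \<rho> * qform c x" by (rule sw)
        also have "\<dots> \<le> \<rho> * T" using x \<rho> by (intro mult_left_mono) (auto simp: R_def T_def)
        finally show "x \<in> sublevel \<alpha> (\<rho> * T)" using x by (simp add: R_def)
      qed
      have "0 \<le> \<rho> * T" using T \<rho> by simp
      from close_pairs_card_le[OF \<alpha> C(2) hc this _ sub, of "T powr (5 / 8)"]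
      have "S j / T \<le> (\<rho> * T / D + C * (sqrt (\<rho> * T) + 1)) * ((T powr (5 / 8) + 1) / D + 2 * C * (sqrt (\<rho> * T + T powr (5 / 8)) + 1))
          / T powr (5 / 8) / T"
        unfolding S_def T_def[symmetric] D_def using T by (intro divide_right_mono) auto
      also have "\<dots> < \<rho> / D^2 + e1" using elim unfolding T_def .
      finally show ?case using T unfolding T_def[symmetric] by (simp add: divide_less_eq less_imp_le)
    qed
  qed
  have lo: "\<forall>\<^sub>F j in sequentially. (1 / (\<rho> * D^2) - e2) * \<rho> ^ j \<le> S j"
  proof -
    have "\<forall>\<^sub>F T in at_top. 1 / (\<rho> * D^2) - e2 < ((T / \<rho> - T powr (5 / 8)) / D - C * (sqrt (T / \<rho>) + 1)) * (T powr (5 / 8) / D - 2 * C * (sqrt (T / \<rho>) + 1))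
      / T powr (5 / 8) / T"
      by (rule order_tendstoD(1)[OF coarse_lower_limit(1)[OF C(1) D \<rho>]]) (use e in simp)
    from eventually_compose_filterlim[OF this Tlim]
      eventually_compose_filterlim[OF coarse_lower_limit(2)[OF C(1) D \<rho>] Tlim]
      eventually_compose_filterlim[OF coarse_lower_limit(3)[OF C(1) D \<rho>] Tlim] show ?thesis
    proof eventually_elim
      case (elim j)
      define T where "T = \<rho> ^ j"
      have T: "T > 0" unfolding T_def by (rule T0)
      have sub: "sublevel \<alpha> (T / \<rho>) \<subseteq> R j"
      proof
        fix x assume x: "x \<in> sublevel \<alpha> (T / \<rho>)"
        have "qform c x \<le> \<rho> * qform \<alpha> x" by (rule sw)
        also have "\<dots> \<le> \<rho> * (T / \<rho>)" using x \<rho> by (intro mult_left_mono) auto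
        finally show "x \<in> R j" using x \<rho> by (simp add: R_def T_def)
      qed
      have "((T / \<rho> - T powr (5 / 8)) / D - C * (sqrt (T / \<rho>) + 1)) * (T powr (5 / 8) / D - 2 * C * (sqrt (T / \<rho>) + 1))
          \<le> real (card (close_pairs \<alpha> (R j) (T powr (5 / 8))))"
        using close_pairs_card_ge[OF \<alpha> C(2) hc _ _ finR sub, of "T powr (5 / 8)"] elim(2,3) unfolding T_def[symmetric] D_def by simp
      then have "((T / \<rho> - T powr (5 / 8)) / D - C * (sqrt (T / \<rho>) + 1)) * (T powr (5 / 8) / D - 2 * C * (sqrt (T / \<rho>) + 1))
          / T powr (5 / 8) / T \<le> S j / T"
        unfolding S_def T_def[symmetric] using T by (intro divide_right_mono) auto
      with elim(1) have "1 / (\<rho> * D^2) - e2 < S j / T" unfolding T_def by linarith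
      then show ?case using T unfolding T_def[symmetric] by (simp add: less_divide_eq less_imp_le)
    qed
  qed
  from up lo dev[OF e(1)] dev[OF e(2)] show ?thesis
  proof eventually_elim
    case (elim j)
    show ?case
      unfolding grid_bounds_def R_def[symmetric] D_def[symmetric]
    proof (intro allI impI)
      fix i assume i: "(\<rho> ^ j) powr (-1 + \<eta>) \<le> (1 / \<rho>) ^ i"
      define d N T where "d = (1 / \<rho>) ^ i" and "N = real (card (close_pairs \<alpha> (R j) ((1 / \<rho>) ^ i)))" and "T = \<rho> ^ j"
      have d: "d > 0" using \<rho> by (simp add: d_def)
      have "\<bar>N / d - S j\<bar> \<le> e1 * T" "\<bar>N / d - S j\<bar> \<le> e2 * T"
        using elim(3,4) i unfolding N_def d_def S_def T_def by blast+
      then have "N / d \<le> (\<rho> / D^2 + e1) * T + e1 * T" "(1 / (\<rho> * D^2) - e2) * T - e2 * T \<le> N / d"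
        using elim(1,2) unfolding T_def by linarith+
      moreover have "(\<rho> / D^2 + e1) * T + e1 * T = (\<rho> / D^2 + 2 * e1) * T" by (simp add: algebra_simps)
      moreover have "(1 / (\<rho> * D^2) - e2) * T - e2 * T = (1 / (\<rho> * D^2) - 2 * e2) * T" by (simp add: algebra_simps)
      moreover have "\<rho> / D^2 + 2 * e1 = \<rho>^2 / D^2" using D by (simp add: e1_def field_simps)
      moreover have "1 / (\<rho> * D^2) - 2 * e2 = 1 / (\<rho>^2 * D^2)" using D \<rho> by (simp add: e2_def field_simps)
      ultimately have "N / d \<le> \<rho>^2 / D^2 * T" "1 / (\<rho>^2 * D^2) * T \<le> N / d" by simp_all
      then have "N \<le> \<rho>^2 / D^2 * T * d" "1 / (\<rho>^2 * D^2) * T * d \<le> N" by (simp_all only: pos_divide_le_eq[OF d] pos_le_divide_eq[OF d])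
      then have "d * T / (\<rho>^2 * D^2) \<le> N \<and> N \<le> d * T * \<rho>^2 / D^2" by (simp add: mult_ac)
      then show "(1 / \<rho>) ^ i * \<rho> ^ j / (\<rho>^2 * D^2) \<le> real (card (close_pairs \<alpha> (R j) ((1 / \<rho>) ^ i))) \<and>
        real (card (close_pairs \<alpha> (R j) ((1 / \<rho>) ^ i))) \<le> (1 / \<rho>) ^ i * \<rho> ^ j * \<rho>^2 / D^2"
        unfolding d_def N_def T_def .
    qed
  qed
qed

text \<open>Both parameters are rounded to powers of \<rho>, and the count is monotone in each. Of
  the five factors \<rho>, two come from rounding, one from passing between sublevel sets of c and
  \<alpha>, two from \<open>grid_bounds\<close>. The exponents 2 \<eta> in place of \<eta> leave
  room to absorb the constants D and \<rho>.\<close>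

lemma pair_correlation_bounds:
  fixes c \<alpha> :: "real \<times> real \<times> real" and \<rho> \<eta> :: real
  assumes c: "c \<in> form_domain" and \<alpha>: "\<alpha> \<in> form_domain" and \<rho>: "\<rho> > 1" and \<eta>: "0 < \<eta>" "\<eta> < 1"
    and sw: "\<And>x. qform c x \<le> \<rho> * qform \<alpha> x" "\<And>x. qform \<alpha> x \<le> \<rho> * qform c x"
    and grid: "\<forall>\<^sub>F j in sequentially. grid_bounds c \<eta> \<rho> \<alpha> j"
  shows "\<forall>\<^sub>F N in at_top. \<forall>\<Delta>\<in>{N powr (-1 + 2 * \<eta>)..N powr (- (2 * \<eta>))}.
    \<Delta> / \<rho> ^ 5 \<le> pair_correlation \<alpha> N {0..\<Delta>} \<and> pair_correlation \<alpha> N {0..\<Delta>} \<le> \<rho> ^ 5 * \<Delta>"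
proof -
  define R where "R j = sublevel c (\<rho> ^ j)" for j
  define D where "D = form_scale \<alpha>"
  obtain j0 where "\<And>j. j \<ge> j0 \<Longrightarrow> grid_bounds c \<eta> \<rho> \<alpha> j"
    using grid unfolding eventually_sequentially by blast
  note j0 = this[unfolded grid_bounds_def, folded R_def D_def, rule_format]
  have D: "D > 0" unfolding D_def by (rule form_scale_pos[OF \<alpha>])
  have finR: "finite (R j)" for j unfolding R_def by (rule finite_sublevel[OF c])
  \<comment> \<open>N D = \<rho>^2 N A leaves, in the lower bound, one factor \<rho> for rounding
    and one for passing from q_c to q_\<alpha>. The upper bound starts from \<rho>^3 N A = \<rho> N
    D instead.\<close>
  define A where "A = D / \<rho>^2"
  have A: "A > 0" using D \<rho> by (simp add: A_def)
  have a: "\<forall>\<^sub>F N in at_top. N * A \<ge> \<rho> ^ j0" using A by real_asymp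
  \<comment> \<open>Ensures \<rho> \<Delta> D <= 1, so that the scale can be rounded to (1 /
    \<rho>)^i with a natural number i.\<close>
  have b: "\<forall>\<^sub>F N in at_top. N powr (- (2 * \<eta>)) * D * \<rho> \<le> 1"
    using \<eta> by real_asymp
  have cc: "\<forall>\<^sub>F N in at_top. (N * A) powr (-1 + \<eta>) \<le> D / \<rho> * N powr (-1 + 2 * \<eta>)"
  proof -
    have "\<forall>\<^sub>F N in at_top. A powr (-1 + \<eta>) / (D / \<rho>) \<le> N powr \<eta>" using \<eta> by real_asymp
    then show ?thesis using eventually_gt_at_top[of 0]
    proof eventually_elim
      case (elim N)
      have "(N * A) powr (-1 + \<eta>) = N powr (-1 + \<eta>) * A powr (-1 + \<eta>)" using elim A by (simp add: powr_mult)
      also have "\<dots> \<le> N powr (-1 + \<eta>) * (N powr \<eta> * (D / \<rho>))"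
      proof (rule mult_left_mono)
        have "D / \<rho> > 0" using D \<rho> by simp
        then show "A powr (-1 + \<eta>) \<le> N powr \<eta> * (D / \<rho>)" using elim(1) by (simp only: pos_divide_le_eq)
      qed simp
      also have "\<dots> = D / \<rho> * (N powr (-1 + \<eta>) * N powr \<eta>)" by simp
      also have "N powr (-1 + \<eta>) * N powr \<eta> = N powr (-1 + 2 * \<eta>)" by (simp flip: powr_add)
      finally show ?case .
    qed
  qed
  from a b cc eventually_gt_at_top[of 0] show ?thesis
  proof eventually_elim
    case (elim N)
    show ?case
    proof
      fix \<Delta> assume \<Delta>: "\<Delta> \<in> {N powr (-1 + 2 * \<eta>)..N powr (- (2 * \<eta>))}"
      have N: "N > 0" using elim by simp
      have \<Delta>0: "\<Delta> > 0" using \<Delta> N by (auto intro: less_le_trans[rotated])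
      have "\<Delta> * (D * \<rho>) \<le> N powr (- (2 * \<eta>)) * (D * \<rho>)" using \<Delta> D \<rho> by (intro mult_right_mono) auto
      then have small: "\<rho> * (\<Delta> * D) \<le> 1" using elim(2) by (simp add: mult_ac)
      have small': "\<Delta> * D \<le> 1"
      proof -
        have "1 * (\<Delta> * D) \<le> \<rho> * (\<Delta> * D)" using \<rho> \<Delta>0 D by (intro mult_right_mono) auto
        then show ?thesis using small by linarith
      qed
      have NA: "1 \<le> N * A" using elim(1) \<rho> one_le_power[of \<rho> j0] by linarith
      have allowed: "(\<rho> ^ j) powr (-1 + \<eta>) \<le> (1 / \<rho>) ^ i \<and> j \<ge> j0"
        if j: "N * A \<le> \<rho> ^ j" and i: "\<Delta> * D / \<rho> \<le> (1 / \<rho>) ^ i" for i j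
      proof
        have "(\<rho> ^ j) powr (-1 + \<eta>) \<le> (N * A) powr (-1 + \<eta>)" using j NA \<eta> by (intro powr_mono2') auto
        also have "\<dots> \<le> D / \<rho> * N powr (-1 + 2 * \<eta>)" by (rule elim(3))
        also have "\<dots> \<le> D / \<rho> * \<Delta>" using \<Delta> D \<rho> by (intro mult_left_mono) auto
        also have "\<dots> \<le> (1 / \<rho>) ^ i" using i by (simp add: mult.commute)
        finally show "(\<rho> ^ j) powr (-1 + \<eta>) \<le> (1 / \<rho>) ^ i" .
        have "\<rho> ^ j0 \<le> \<rho> ^ j" using elim(1) j by linarith
        then show "j \<ge> j0" using \<rho> by (simp add: power_increasing_iff)
      qed
      define Q where "Q = real (card (close_pairs \<alpha> (sublevel \<alpha> (N * D)) (\<Delta> * D)))"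
      have finQ: "finite (sublevel \<alpha> (N * D))" by (rule finite_sublevel[OF \<alpha>])
      have PQ: "pair_correlation \<alpha> N {0..\<Delta>} = Q / N" unfolding pair_correlation_eq[OF \<alpha>] Q_def D_def ..
      have ND: "N * D = \<rho>^2 * (N * A)" using \<rho> by (simp add: A_def)
      have inv: "(1 / \<rho>) ^ i = 1 / \<rho> ^ i" for i by (simp add: power_one_over)
      have upper: "Q \<le> \<rho> ^ 5 * \<Delta> * N"
      proof -
        have "1 * 1 \<le> \<rho> ^ 3 * (N * A)" using \<rho> NA by (intro mult_mono one_le_power) auto
        then obtain j where j: "\<rho> ^ 3 * (N * A) \<le> \<rho> ^ j" "\<rho> ^ j \<le> \<rho> * (\<rho> ^ 3 * (N * A))"
          using ex_power_between[OF \<rho>, of "\<rho> ^ 3 * (N * A)"] by auto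
        have "1 \<le> 1 / (\<rho> * (\<Delta> * D))" using small \<Delta>0 D \<rho> by simp
        then obtain i where i: "1 / (\<rho> * (\<Delta> * D)) \<le> \<rho> ^ i" "\<rho> ^ i \<le> \<rho> * (1 / (\<rho> * (\<Delta> * D)))"
          using ex_power_between[OF \<rho>] by blast
        have i1: "\<Delta> * D \<le> (1 / \<rho>) ^ i" "(1 / \<rho>) ^ i \<le> \<rho> * (\<Delta> * D)"
          unfolding inv using i \<rho> \<Delta>0 D by (simp_all add: field_simps)
        have "1 * (N * A) \<le> \<rho> ^ 3 * (N * A)" using \<rho> NA by (intro mult_right_mono one_le_power) auto
        then have j1: "N * A \<le> \<rho> ^ j" using j by linarith
        have "\<Delta> * D / \<rho> \<le> \<Delta> * D / 1" using \<rho> \<Delta>0 D by (intro divide_left_mono) auto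
        then have ok: "(\<rho> ^ j) powr (-1 + \<eta>) \<le> (1 / \<rho>) ^ i \<and> j \<ge> j0" using i1 by (intro allowed j1) linarith
        have sub: "sublevel \<alpha> (N * D) \<subseteq> R j"
        proof
          fix x assume x: "x \<in> sublevel \<alpha> (N * D)"
          have "qform c x \<le> \<rho> * qform \<alpha> x" by (rule sw)
          also have "\<dots> \<le> \<rho> * (N * D)" using x \<rho> by (intro mult_left_mono) auto
          also have "\<dots> = \<rho> ^ 3 * (N * A)" unfolding ND by (simp add: eval_nat_numeral)
          finally show "x \<in> R j" using x j by (simp add: R_def)
        qed
        have "Q \<le> real (card (close_pairs \<alpha> (R j) ((1 / \<rho>) ^ i)))"
          unfolding Q_def by (intro of_nat_mono card_close_pairs_mono sub i1 finR)
        also have "\<dots> \<le> (1 / \<rho>) ^ i * \<rho> ^ j * \<rho>^2 / D^2" using j0 ok by blast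
        also have "\<dots> \<le> (\<rho> * (\<Delta> * D)) * (\<rho> * (\<rho> ^ 3 * (N * A))) * \<rho>^2 / D^2"
          using i1 j \<rho> \<Delta>0 D by (intro divide_right_mono mult_right_mono mult_mono) auto
        also have "\<dots> = \<rho> ^ 5 * \<Delta> * N" using D \<rho> by (simp add: A_def field_simps eval_nat_numeral)
        finally show ?thesis .
      qed
      have lower: "\<Delta> * N / \<rho> ^ 5 \<le> Q"
      proof -
        obtain j where j: "N * A \<le> \<rho> ^ j" "\<rho> ^ j \<le> \<rho> * (N * A)"
          using ex_power_between[OF \<rho> NA] by blast
        have "1 \<le> 1 / (\<Delta> * D)" using small' \<Delta>0 D by simp
        then obtain i where i: "1 / (\<Delta> * D) \<le> \<rho> ^ i" "\<rho> ^ i \<le> \<rho> * (1 / (\<Delta> * D))"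
          using ex_power_between[OF \<rho>] by blast
        have i1: "\<Delta> * D / \<rho> \<le> (1 / \<rho>) ^ i" "(1 / \<rho>) ^ i \<le> \<Delta> * D"
          unfolding inv using i \<rho> \<Delta>0 D by (simp_all add: field_simps)
        have ok: "(\<rho> ^ j) powr (-1 + \<eta>) \<le> (1 / \<rho>) ^ i \<and> j \<ge> j0" by (rule allowed[OF j(1) i1(1)])
        have sub: "R j \<subseteq> sublevel \<alpha> (N * D)"
        proof
          fix x assume x: "x \<in> R j"
          have "qform \<alpha> x \<le> \<rho> * qform c x" by (rule sw)
          also have "\<dots> \<le> \<rho> * (\<rho> * (N * A))" using x j \<rho> by (intro mult_left_mono) (auto simp: R_def)
          also have "\<dots> = N * D" unfolding ND by (simp add: power2_eq_square)
          finally show "x \<in> sublevel \<alpha> (N * D)" using x by (simp add: R_def)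
        qed
        have "\<Delta> * N / \<rho> ^ 5 = (\<Delta> * D / \<rho>) * (N * A) / (\<rho>^2 * D^2)"
          using D \<rho> by (simp add: A_def field_simps eval_nat_numeral)
        also have "\<dots> \<le> (1 / \<rho>) ^ i * \<rho> ^ j / (\<rho>^2 * D^2)"
          using i1 j \<rho> \<Delta>0 D NA by (intro divide_right_mono mult_mono) auto
        also have "\<dots> \<le> real (card (close_pairs \<alpha> (R j) ((1 / \<rho>) ^ i)))" using j0 ok by blast
        also have "\<dots> \<le> Q" unfolding Q_def by (intro of_nat_mono card_close_pairs_mono sub i1 finQ)
        finally show ?thesis .
      qed
      show "\<Delta> / \<rho> ^ 5 \<le> pair_correlation \<alpha> N {0..\<Delta>} \<and> pair_correlation \<alpha> N {0..\<Delta>} \<le> \<rho> ^ 5 * \<Delta>"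
        unfolding PQ using upper lower N by (simp add: le_divide_eq divide_le_eq)
    qed
  qed
qed

section \<open>The exceptional set\<close>

definition asymptotic_up_to :: "real \<Rightarrow> real \<Rightarrow> real \<times> real \<times> real \<Rightarrow> bool" where
  "asymptotic_up_to \<eta> \<rho> \<alpha> \<longleftrightarrow> (\<forall>\<^sub>F N in at_top. \<forall>\<Delta>\<in>{N powr (-1 + 2 * \<eta>)..N powr (- (2 * \<eta>))}.
    \<Delta> / \<rho> ^ 5 \<le> pair_correlation \<alpha> N {0..\<Delta>} \<and> pair_correlation \<alpha> N {0..\<Delta>} \<le> \<rho> ^ 5 * \<Delta>)"

text \<open>The estimates are local around a centre c, with a radius from
  \<open>qform_sandwich\<close> that depends on c; \<open>locally_negligible_alt\<close> glues the
  neighbourhoods on which the tent exceeds 1/2.\<close>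

lemma negligible_not_asymptotic:
  assumes \<eta>: "0 < \<eta>" "\<eta> \<le> 1 / 8" and \<rho>: "\<rho> > 1"
  shows "negligible {\<alpha> \<in> form_domain. \<not> asymptotic_up_to \<eta> \<rho> \<alpha>}" (is "negligible ?E")
proof (subst locally_negligible_alt, intro ballI)
  fix c assume "c \<in> ?E"
  then have c: "c \<in> form_domain" by simp
  obtain r where r: "r > 0" "\<And>\<alpha> x. tent c r \<alpha> \<noteq> 0 \<Longrightarrow> qform c x \<le> \<rho> * qform \<alpha> x \<and> qform \<alpha> x \<le> \<rho> * qform c x"
    using qform_sandwich[OF c \<rho>] by blast
  define V where "V = {\<alpha>. 1 / 2 < tent c r \<alpha>}"
  have "open V" unfolding V_def by (intro open_Collect_less continuous_intros tent_continuous)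
  moreover have "c \<in> V" by (simp add: V_def tent_def)
  moreover have "negligible (?E \<inter> V)"
  proof -
    from scales_agree_AE[OF c \<rho> \<eta> r(1)] obtain Z where Z: "Z \<in> null_sets lborel"
      "{\<alpha>. \<not> (tent c r \<alpha> \<ge> 1 / 2 \<longrightarrow> scales_agree c \<eta> \<rho> \<alpha>)} \<subseteq> Z"
      by (auto elim!: AE_E simp: null_sets_def)
    have "?E \<inter> V \<subseteq> Z"
    proof (rule subsetI, rule ccontr)
      fix \<alpha> assume a: "\<alpha> \<in> ?E \<inter> V" "\<alpha> \<notin> Z"
      then have t: "tent c r \<alpha> \<ge> 1 / 2" "tent c r \<alpha> \<noteq> 0" "\<alpha> \<in> form_domain" by (auto simp: V_def)
      have agree: "scales_agree c \<eta> \<rho> \<alpha>" using Z(2) a(2) t(1) by blast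
      have sw: "qform c x \<le> \<rho> * qform \<alpha> x" "qform \<alpha> x \<le> \<rho> * qform c x" for x using r(2)[OF t(2)] by auto
      have "asymptotic_up_to \<eta> \<rho> \<alpha>"
        unfolding asymptotic_up_to_def
        by (rule pair_correlation_bounds[OF c t(3) \<rho> _ _ sw eventually_grid_bounds[OF c t(3) \<rho> sw agree]])
          (use \<eta> in auto)
      then show False using a by auto
    qed
    then show ?thesis using Z(1) by (meson negligible_iff_null_sets negligible_subset null_sets_completionI)
  qed
  ultimately show "\<exists>U. openin (top_of_set ?E) U \<and> c \<in> U \<and> negligible U"
    using \<open>c \<in> ?E\<close> by (intro exI[of _ "?E \<inter> V"]) (auto intro: openin_open_Int)
qed

text \<open>In \<open>ennreal\<close> the supremum makes sense without a proof of boundedness; for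
  \<eta> > 1/2 and N > 1 the range of \<Delta> is empty and the supremum is 0.\<close>

theorem theorem1:
  fixes \<eta> :: real
  assumes "\<eta> > 0"
  shows "\<exists>E. E \<subseteq> form_domain \<and> E \<in> null_sets hyp_measure \<and>
           (\<forall>\<alpha> \<in> form_domain - E.
              ((\<lambda>N::real. SUP \<Delta> \<in> {N powr (-1 + \<eta>)..N powr (-\<eta>)}.
                  ennreal \<bar>pair_correlation \<alpha> N {0..\<Delta>} / \<Delta> - 1\<bar>) \<longlongrightarrow> 0) at_top)"
proof -
  \<comment> \<open>Half of \<eta>, since \<open>asymptotic_up_to\<close> covers the range with
    exponents 2 \<zeta>; 1/8 is the saving available in \<open>deviation_rate\<close>.\<close>
  define \<zeta> where "\<zeta> = min (\<eta> / 2) (1 / 8)"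
  have \<zeta>: "0 < \<zeta>" "\<zeta> \<le> 1 / 8" "2 * \<zeta> \<le> \<eta>" using assms by (auto simp: \<zeta>_def)
  \<comment> \<open>Countably many values decreasing to 1 suffice: each bounds the relative error by
    \<rho>^5 - 1, and a countable union of negligible sets is negligible.\<close>
  define \<rho> where "\<rho> m = 1 + 1 / real (Suc m)" for m
  have \<rho>: "\<rho> m > 1" for m by (simp add: \<rho>_def)
  define E where "E = (\<Union>m. {\<alpha> \<in> form_domain. \<not> asymptotic_up_to \<zeta> (\<rho> m) \<alpha>})"
  have "negligible E"
    unfolding E_def using negligible_not_asymptotic[OF \<zeta>(1,2) \<rho>] by (intro negligible_Union_nat)
  moreover have "E \<subseteq> form_domain" by (auto simp: E_def)
  moreover have "((\<lambda>N::real. SUP \<Delta> \<in> {N powr (-1 + \<eta>)..N powr (-\<eta>)}.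
                  ennreal \<bar>pair_correlation \<alpha> N {0..\<Delta>} / \<Delta> - 1\<bar>) \<longlongrightarrow> 0) at_top" if \<alpha>: "\<alpha> \<in> form_domain - E" for \<alpha>
  proof (rule order_tendstoI)
    fix a :: ennreal assume "0 < a"
    have "(\<lambda>m. ennreal (\<rho> m ^ 5 - 1)) \<longlonglongrightarrow> ennreal 0"
      unfolding \<rho>_def by (intro tendsto_ennrealI) real_asymp
    then have "\<forall>\<^sub>F m in sequentially. ennreal (\<rho> m ^ 5 - 1) < a"
      using \<open>0 < a\<close> by (intro order_tendstoD(2)) auto
    then obtain m where m: "ennreal (\<rho> m ^ 5 - 1) < a" by (auto simp: eventually_sequentially)
    have "asymptotic_up_to \<zeta> (\<rho> m) \<alpha>" using \<alpha> by (auto simp: E_def)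
    then show "\<forall>\<^sub>F N in at_top. (SUP \<Delta> \<in> {N powr (-1 + \<eta>)..N powr (-\<eta>)}. ennreal \<bar>pair_correlation \<alpha> N {0..\<Delta>} / \<Delta> - 1\<bar>) < a"
      using eventually_ge_at_top[of 1] unfolding asymptotic_up_to_def
    proof eventually_elim
      case (elim N)
      have "(SUP \<Delta> \<in> {N powr (-1 + \<eta>)..N powr (-\<eta>)}. ennreal \<bar>pair_correlation \<alpha> N {0..\<Delta>} / \<Delta> - 1\<bar>) \<le> ennreal (\<rho> m ^ 5 - 1)"
      proof (rule SUP_least, rule ennreal_leI)
        fix \<Delta> assume \<Delta>: "\<Delta> \<in> {N powr (-1 + \<eta>)..N powr (-\<eta>)}"
        have "N powr (-1 + 2 * \<zeta>) \<le> N powr (-1 + \<eta>)" "N powr (-\<eta>) \<le> N powr (- (2 * \<zeta>))"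
          using elim(2) \<zeta> by (intro powr_mono; simp)+
        then have "\<Delta> \<in> {N powr (-1 + 2 * \<zeta>)..N powr (- (2 * \<zeta>))}" using \<Delta> by auto
        with elim(1) have b: "\<Delta> / \<rho> m ^ 5 \<le> pair_correlation \<alpha> N {0..\<Delta>}" "pair_correlation \<alpha> N {0..\<Delta>} \<le> \<rho> m ^ 5 * \<Delta>"
          by blast+
        have "0 < N powr (-1 + \<eta>)" using elim(2) by simp
        then have \<Delta>0: "\<Delta> > 0" using \<Delta> by (meson atLeastAtMost_iff less_le_trans)
        define z where "z = \<rho> m ^ 5"
        have z: "z > 1" unfolding z_def using \<rho> by (intro one_less_power) auto
        have "1 / z \<le> pair_correlation \<alpha> N {0..\<Delta>} / \<Delta>" "pair_correlation \<alpha> N {0..\<Delta>} / \<Delta> \<le> z"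
          using b \<Delta>0 z unfolding z_def[symmetric] by (simp_all add: field_simps)
        moreover have "1 - 1 / z \<le> z - 1"
        proof -
          have "0 \<le> (z - 1)^2 / z" using z by simp
          also have "\<dots> = z - 1 - (1 - 1 / z)" using z by (simp add: field_simps power2_eq_square)
          finally show ?thesis by simp
        qed
        ultimately show "\<bar>pair_correlation \<alpha> N {0..\<Delta>} / \<Delta> - 1\<bar> \<le> \<rho> m ^ 5 - 1"
          unfolding z_def[symmetric] by linarith
      qed
      also have "\<dots> < a" by (rule m)
      finally show ?case .
    qed
  qed simp
  ultimately show ?thesis by (intro exI[of _ E]) (auto simp: hyp_measure_null_iff)
qed

end
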